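(* Let $n$ be any integer with $n\geq 2$, and let $H$ be an isomorphism class of groups. Then $H\in\mathscr{R}$ if and only if $H$ is the isomorphism class of a solvable subgroup of $F_n$.
   Context: $F_n$ is the generalized R. Thompson group (Brown's group $F_{n,\infty}$): the group under composition of all orientation-preserving piecewise-linear homeomorphisms of $[0,1]$ with finitely many breaks in slope, all of whose slopes are integer powers of $n$ and all of whose breakpoints lie in $\mathbf{Z}[\frac1n]$. In particular $F_2$ is Thompson's group $F$. $\mathscr{R}$ is the smallest non-empty class of isomorphism classes of groups which is closed under the following three operations (given as operations on groups, inducing operations on isomorphism classes): (1) taking subgroups; (2) forming the standard restricted wreath product with $\mathbf{Z}$, i.e. $K\mapsto K\wr\mathbf{Z}$; (3) forming bounded direct sums, i.e. (finite or) countable direct sums of groups in the class for which there is a universal bound on the derived lengths of the summands. The standard restricted wreath product $A\wr T$ is the semidirect product $B\rtimes T$ with $B=\bigoplus_{t\in T}A$, where $T$ acts on $B$ by right multiplication on the index of the direct sum. *)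

theory Defs
  imports
    "HOL-Analysis.Analysis"
    "HOL-Algebra.Bij"
    "HOL-Algebra.Product_Groups"
    "HOL-Algebra.Elementary_Groups"
    "HOL-Algebra.Solvable_Groups"
    "HOL-Library.Extended_Nat"
    "HOL-Library.Infinite_Typeclass"
begin

section \<open>The generalized Thompson groups\<close>

definition inv_adic :: "int \<Rightarrow> real set" where
  "inv_adic n = {of_int a / of_int n ^ k | (a :: int) (k :: nat). True}"

text \<open>For a piecewise-linear homeomorphism of the unit interval, the points where the slope changes
  are the interior points of non-differentiability.  Values outside the unit interval
  play no role because only interior points are considered.\<close>

definition breaks :: "(real \<Rightarrow> real) \<Rightarrow> real set" where
  "breaks f = {x \<in> {0<..<1}. \<not> f differentiable at x}"

definition linear_with_slope_on :: "real \<Rightarrow> real set \<Rightarrow> (real \<Rightarrow> real) \<Rightarrow> bool" where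
  "linear_with_slope_on m S f \<longleftrightarrow> (\<exists>c. \<forall>x\<in>S. f x = m * x + c)"

text \<open>The group operation is composition, inherited from \<^const>\<open>BijGroup\<close>; its elements are
  extensional, so each homeomorphism of the unit interval is represented exactly once.\<close>

definition F_group :: "int \<Rightarrow> (real \<Rightarrow> real) monoid" where
  "F_group n = (BijGroup {0..1}) \<lparr>carrier :=
     {f \<in> Bij {0..1}.
        (\<exists>g. homeomorphism {0..1} {0..1} f g) \<and>
        strict_mono_on {0..1} f \<and>
        finite (breaks f) \<and>
        breaks f \<subseteq> inv_adic n \<and>
        (\<forall>a b. 0 \<le> a \<and> a < b \<and> b \<le> 1 \<and> {a<..<b} \<inter> breaks f = {} \<longrightarrow>
           (\<exists>k::int. linear_with_slope_on (of_int n powi k) {a..b} f))}\<rparr>"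

section \<open>Restricted wreath products\<close>

text \<open>Here \<open>\<phi>\<close> is a left action of \<open>T\<close> on \<open>B\<close> by automorphisms.\<close>

definition semidirect_product ::
    "'b monoid \<Rightarrow> 't monoid \<Rightarrow> ('t \<Rightarrow> 'b \<Rightarrow> 'b) \<Rightarrow> ('b \<times> 't) monoid" where
  "semidirect_product B T \<phi> =
     \<lparr>carrier = carrier B \<times> carrier T,
      monoid.mult = (\<lambda>(b, t) (b', t'). (b \<otimes>\<^bsub>B\<^esub> \<phi> t b', t \<otimes>\<^bsub>T\<^esub> t')),
      one = (\<one>\<^bsub>B\<^esub>, \<one>\<^bsub>T\<^esub>)\<rparr>"

text \<open>The action of \<open>T\<close> on the base \<open>B\<close> is by right multiplication on the index.
  The left action of \<open>t\<close> below moves the entry at index \<open>s\<close> to index \<open>s t\<^sup>-\<^sup>1\<close>; that is,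
  conjugation \<open>b \<mapsto> t\<^sup>-\<^sup>1 b t\<close> moves the entry at \<open>s\<close> to \<open>s t\<close>.\<close>

definition wreath :: "'a monoid \<Rightarrow> 't monoid \<Rightarrow> (('t \<Rightarrow> 'a) \<times> 't) monoid" where
  "wreath A T =
     semidirect_product (sum_group (carrier T) (\<lambda>_. A)) T
       (\<lambda>t b. \<lambda>s\<in>carrier T. b (s \<otimes>\<^bsub>T\<^esub> t))"

section \<open>Isomorphism classes and the class generated by the three operations\<close>

text \<open>HOL has no type of all groups, so isomorphism classes are taken among the groups whose
  carrier consists of elements of a fixed type \<open>'a\<close>.  The group \<open>G\<close> below may live on any other
  type; its class is non-empty as soon as the carrier of \<open>G\<close> is no larger than \<open>'a\<close>.\<close>

definition iso_class :: "'b monoid \<Rightarrow> 'a monoid set" where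
  "iso_class G = {G'. group G' \<and> G' \<cong> G}"

definition iso_classes :: "'a monoid set set" where
  "iso_classes = iso_class ` {G :: 'a monoid. group G}"

text \<open>The derived length is \<open>\<infinity>\<close> for groups that are not solvable.\<close>

definition derived_length :: "'a monoid \<Rightarrow> enat" where
  "derived_length G = (INF d \<in> {d. (derived G ^^ d) (carrier G) = {\<one>\<^bsub>G\<^esub>}}. enat d)"

definition closed_under_subgroups :: "'a monoid set set \<Rightarrow> bool" where
  "closed_under_subgroups C \<longleftrightarrow>
     (\<forall>G \<in> \<Union>C. \<forall>S. subgroup S G \<longrightarrow> iso_class (G\<lparr>carrier := S\<rparr>) \<in> C)"

definition closed_under_wreath_Z :: "'a monoid set set \<Rightarrow> bool" where
  "closed_under_wreath_Z C \<longleftrightarrow> (\<forall>K \<in> \<Union>C. iso_class (wreath K integer_group) \<in> C)"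

text \<open>Subsets of the naturals serve as the finite or countable index sets.\<close>

definition closed_under_bounded_sums :: "'a monoid set set \<Rightarrow> bool" where
  "closed_under_bounded_sums C \<longleftrightarrow>
     (\<forall>(I :: nat set) G.
        (\<forall>i\<in>I. G i \<in> \<Union>C) \<and> (\<exists>d::nat. \<forall>i\<in>I. derived_length (G i) \<le> enat d) \<longrightarrow>
        iso_class (sum_group I G) \<in> C)"

text \<open>For infinite \<open>'a\<close> the three operations produce only groups no larger than \<open>'a\<close> from
  groups on \<open>'a\<close>, so nothing is lost by fixing the type.\<close>

definition class_R :: "'a::infinite monoid set set" where
  "class_R = \<Inter>{C. C \<subseteq> iso_classes \<and> C \<noteq> {} \<and> closed_under_subgroups C \<and>
                  closed_under_wreath_Z C \<and> closed_under_bounded_sums C}"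

end

theory Submission
  imports Defs
begin

text \<open>
Extending by the identity turns \<^term>\<open>F_group n\<close> into a group of maps of the real line on which
piecewise linearity is a purely local condition: at every point both one-sided germs are affine
with slope a power of \<open>n\<close>. Such conditions pass to composites and inverses at once, and their one
dynamical consequence, used throughout, is that to either side of a point a map is near that point
either the identity or free of fixed points (\<open>fix_dichotomy\<close>). Dropping the condition on
breakpoints gives a larger group in which maps may be cut off at arbitrary fixed points.

\<^bold>\<open>Solvable subgroups lie in the class.\<close> The proof is by induction on the derived length
(\<open>solvable_PL_mem\<close>). A map moves points in only finitely many orbitals of the group, so the group
embeds into the direct sum of its restrictions to orbitals (\<open>orbitals_mem\<close>), and it suffices to
treat a group \<open>G\<close> without a global fixed point in an interval \<open>(a,b)\<close>. Let \<open>\<Phi>\<close> be the set of points of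
\<open>(a,b)\<close> fixed by the derived subgroup \<open>G'\<close>. The group acts on \<open>\<Phi>\<close> through an abelian quotient,
so the fixed points of one element in \<open>\<Phi>\<close> form an invariant set; together with the dichotomy this
shows that an element fixing one point of \<open>\<Phi>\<close> fixes all of \<open>\<Phi>\<close> (\<open>fixes_all\<close>). The same fact,
applied to the last term of the derived series that still has no fixed point, shows
\<open>\<Phi> \<noteq> {}\<close> (\<open>fixset_derived_nonempty\<close>). Hence the kernel \<open>H\<close> of the slope at \<open>a\<close> is the pointwise
stabilizer of \<open>\<Phi>\<close>. Slopes are powers of \<open>n\<close>, so \<open>G = H \<langle>c\<rangle>\<close> for a single element \<open>c\<close>, and the
intervals \<open>c\<^sup>s [x, c x)\<close> with \<open>x \<in> \<Phi>\<close> are \<open>H\<close>-invariant and tile \<open>(a,b)\<close>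
(\<open>orbital_structure\<close>). As an element of \<open>H\<close> is the identity near both ends, \<open>G\<close> embeds into
\<open>K \<wr> \<int>\<close>, where \<open>K\<close> is the restriction of \<open>H\<close> to one tile (\<open>one_orbital_mem\<close>). On that tile
\<open>h \<in> H\<close> agrees with the commutator of \<open>h\<close> and a high power of \<open>c\<close>; so \<open>K\<close> is also a quotient of \<open>G'\<close>,
which makes its derived length smaller than that of \<open>G\<close>.

\<^bold>\<open>The class consists of solvable subgroups.\<close> The solvable subgroups of \<^term>\<open>F_group n\<close> form a
class closed under the three operations. Copies of the group scaled into disjoint \<open>n\<close>-adic intervals
realize direct sums (\<open>embeds_sum\<close>); a scaled copy supported in an interval that some element moves
off itself generates, together with that element, a wreath product with \<open>\<int>\<close> (\<open>embeds_wreath\<close>). The group is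
countable (\<open>countable_F\<close>), hence all these groups have a copy on every infinite type.
\<close>

section \<open>Piecewise-linear maps of the line\<close>

text \<open>The side of \<open>x\<close> is a sign \<open>\<sigma>\<close>, so that one statement serves for both one-sided germs.\<close>

definition has_slope :: "real \<Rightarrow> (real \<Rightarrow> real) \<Rightarrow> real \<Rightarrow> real \<Rightarrow> int \<Rightarrow> bool" where
  "has_slope r f x \<sigma> k \<longleftrightarrow> (\<forall>\<^sub>F t in at_right 0. f (x + \<sigma> * t) = f x + \<sigma> * (r powi k * t))"

abbreviation affine_germ where
  "affine_germ r D f x \<sigma> k \<equiv> has_slope r f x \<sigma> k \<and> f x - r powi k * x \<in> D"

text \<open>The groups of piecewise-linear homeomorphisms of the line with support in the unit interval and slopes in
the powers of \<open>r\<close>, with breakpoints and one-sided intercepts in \<open>D\<close>. Requiring the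
intercepts, and not only the breakpoints, to lie in \<open>D\<close> makes the condition local and stable under
composition and inversion. For \<open>D = \<int>[1/n]\<close> this is the Thompson group, for \<open>D = UNIV\<close>
breakpoints are arbitrary. Finiteness of the set of breakpoints follows from compactness.\<close>

definition PL :: "real \<Rightarrow> real set \<Rightarrow> (real \<Rightarrow> real) monoid" where
  "PL r D =
    \<lparr>carrier = {f. strict_mono f \<and> surj f \<and> (\<forall>x. x \<notin> {0..1} \<longrightarrow> f x = x) \<and>
       (\<forall>x. (\<forall>\<sigma>\<in>{1,-1}. \<exists>k. affine_germ r D f x \<sigma> k) \<and>
            (x \<notin> D \<longrightarrow> (\<exists>k. \<forall>\<sigma>\<in>{1,-1}. has_slope r f x \<sigma> k)))},
     monoid.mult = (\<circ>), one = id\<rparr>"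

lemma PL_simps [simp]: "monoid.mult (PL r D) f g = f \<circ> g" "one (PL r D) = id"
  by (auto simp: PL_def)

lemma has_slope_cong:
  assumes "has_slope r f x \<sigma> k" "f x = g x" "\<forall>\<^sub>F t in at_right 0. f (x + \<sigma> * t) = g (x + \<sigma> * t)"
  shows "has_slope r g x \<sigma> k"
  using assms(1) assms(3) unfolding has_slope_def
  by eventually_elim (use assms(2) in auto)

locale slopes =
  fixes r :: real
  assumes r_gt_1: "r > 1"
begin

lemma r_pos [simp]: "0 < r powi k"
  using r_gt_1 by (intro zero_less_power_int) auto

lemma r_powi_eq_1_iff: "r powi k = 1 \<longleftrightarrow> k = 0"
proof -
  have "r powi k = r powr of_int k"
    using r_gt_1 by (simp add: powr_real_of_int')
  then show ?thesis
    using r_gt_1 by simp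
qed

lemma r_powi_inject: "r powi k = r powi l \<longleftrightarrow> k = l"
proof -
  have "r powi (k - l) = r powi k / r powi l"
    using r_gt_1 by (simp add: power_int_diff)
  then show ?thesis
    using r_powi_eq_1_iff[of "k - l"] r_pos[of l] r_gt_1 by (auto simp: field_simps)
qed

lemma r_powi_cancel: "r powi (-k) * (r powi k * x) = x" "r powi k * (r powi (-k) * x) = x"
  using r_gt_1 by (simp_all add: power_int_minus)

lemma filterlim_scale: "filterlim (\<lambda>t. r powi k * t) (at_right 0) (at_right 0)"
  unfolding filterlim_at
proof
  have "((\<lambda>t. r powi k * t) \<longlongrightarrow> r powi k * 0) (at_right 0)"
    by (intro tendsto_intros)
  then show "((\<lambda>t. r powi k * t) \<longlongrightarrow> 0) (at_right 0)"
    by simp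
  show "\<forall>\<^sub>F x in at_right 0. r powi k * x \<in> {0<..} \<and> r powi k * x \<noteq> 0"
    using eventually_at_right_less[of 0] by eventually_elim (use r_gt_1 in auto)
qed

lemma has_slope_unique:
  assumes "has_slope r f x \<sigma> k" "has_slope r f x \<sigma> l" "\<sigma> \<in> {1,-1}"
  shows "k = l"
proof -
  have "\<forall>\<^sub>F t in at_right (0::real). r powi k = r powi l"
    using assms(1,2)[unfolded has_slope_def] eventually_at_right_less[of 0]
    by eventually_elim (use assms(3) in auto)
  then have "r powi k = r powi l" by simp
  then show ?thesis by (simp add: r_powi_inject)
qed

lemma has_slope_comp:
  assumes "has_slope r g x \<sigma> k" "has_slope r f (g x) \<sigma> l"
  shows "has_slope r (f \<circ> g) x \<sigma> (l + k)"
proof -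
  have "\<forall>\<^sub>F t in at_right 0. f (g x + \<sigma> * (r powi k * t)) = f (g x) + \<sigma> * (r powi l * (r powi k * t))"
    using assms(2) unfolding has_slope_def by (rule eventually_compose_filterlim[OF _ filterlim_scale])
  then show ?thesis
    using assms(1) unfolding has_slope_def
    by eventually_elim (use r_gt_1 in \<open>simp add: power_int_add\<close>)
qed

lemma has_slope_inv:
  assumes "has_slope r f x \<sigma> k" "bij f"
  shows "has_slope r (inv_into UNIV f) (f x) \<sigma> (- k)"
proof -
  have "\<forall>\<^sub>F t in at_right 0. f (x + \<sigma> * (r powi (-k) * t)) = f x + \<sigma> * (r powi k * (r powi (-k) * t))"
    using assms(1) unfolding has_slope_def by (rule eventually_compose_filterlim[OF _ filterlim_scale])
  then show ?thesis
    unfolding has_slope_def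
  proof eventually_elim
    case (elim t)
    have "r powi k * (r powi (-k) * t) = t"
      using r_pos[of k] r_gt_1 by (simp add: power_int_minus)
    then have "f (x + \<sigma> * (r powi (-k) * t)) = f x + \<sigma> * t"
      using elim by simp
    then show ?case
      using assms(2) by (metis bij_inv_eq_iff)
  qed
qed

lemma PL_D:
  assumes "f \<in> carrier (PL r D)"
  shows "strict_mono f" "surj f" "bij f" "inj f" "x \<notin> {0..1} \<Longrightarrow> f x = x"
    "\<sigma> \<in> {1,-1} \<Longrightarrow> \<exists>k. affine_germ r D f x \<sigma> k"
    "x \<notin> D \<Longrightarrow> \<exists>k. \<forall>\<sigma>\<in>{1,-1}. has_slope r f x \<sigma> k"
  using assms unfolding PL_def bij_def by (auto simp: strict_mono_imp_inj_on)

lemma PL_I: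
  assumes "strict_mono f" "surj f" "\<And>x. x \<notin> {0..1} \<Longrightarrow> f x = x"
    "\<And>x \<sigma>. \<sigma> \<in> {1,-1} \<Longrightarrow> \<exists>k. affine_germ r D f x \<sigma> k"
    "\<And>x. x \<notin> D \<Longrightarrow> \<exists>k. \<forall>\<sigma>\<in>{1,-1}. has_slope r f x \<sigma> k"
  shows "f \<in> carrier (PL r D)"
  using assms unfolding PL_def by simp

lemma PL_less_iff: "f \<in> carrier (PL r D) \<Longrightarrow> f x < f y \<longleftrightarrow> x < y"
  by (meson PL_D(1) strict_mono_less)

lemma PL_le_iff: "f \<in> carrier (PL r D) \<Longrightarrow> f x \<le> f y \<longleftrightarrow> x \<le> y"
  by (meson PL_D(1) strict_mono_less_eq)

lemma PL_eq_iff: "f \<in> carrier (PL r D) \<Longrightarrow> f x = f y \<longleftrightarrow> x = y"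
  by (meson PL_D(1) strict_mono_eq)

lemma PL_continuous: "f \<in> carrier (PL r D) \<Longrightarrow> continuous_on A f"
proof -
  assume f: "f \<in> carrier (PL r D)"
  have "continuous_on UNIV f"
    by (rule continuous_onI_mono) (use PL_D(2)[OF f] PL_le_iff[OF f] in auto)
  then show ?thesis
    by (rule continuous_on_subset) simp
qed

lemma PL_UNIV: "f \<in> carrier (PL r D) \<Longrightarrow> f \<in> carrier (PL r UNIV)"
  apply (rule PL_I)
  using PL_D[of f D] apply (auto)[3]
  using PL_D(6)[of f D] apply blast
  by simp

text \<open>An affine map has at most one fixed point or is the identity.\<close>

lemma fix_dichotomy:
  assumes "f \<in> carrier (PL r D)" "\<sigma> \<in> {1,-1}"
  shows "(\<forall>\<^sub>F t in at_right 0. f (x + \<sigma> * t) = x + \<sigma> * t) \<or>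
         (\<forall>\<^sub>F t in at_right 0. f (x + \<sigma> * t) \<noteq> x + \<sigma> * t)"
proof -
  obtain k where k: "has_slope r f x \<sigma> k"
    using PL_D(6)[OF assms] by blast
  show ?thesis
  proof (cases "k = 0")
    case True
    then have *: "\<forall>\<^sub>F t in at_right 0. f (x + \<sigma> * t) = f x + \<sigma> * t"
      using k by (simp add: has_slope_def)
    show ?thesis
    proof (cases "f x = x")
      case True
      have "\<forall>\<^sub>F t in at_right 0. f (x + \<sigma> * t) = x + \<sigma> * t"
        using * by eventually_elim (simp add: True)
      then show ?thesis ..
    next
      case False
      have "\<forall>\<^sub>F t in at_right 0. f (x + \<sigma> * t) \<noteq> x + \<sigma> * t"
        using * by eventually_elim (simp add: False)
      then show ?thesis ..
    qed
  next
    case False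
    then have ne: "1 - r powi k \<noteq> 0" using r_powi_eq_1_iff[of k] by auto
    define t0 where "t0 = \<sigma> * (f x - x) / (1 - r powi k)"
    have "\<forall>\<^sub>F t in at_right 0. t \<noteq> t0"
      by (rule eventually_neq_at_within)
    then have "\<forall>\<^sub>F t in at_right 0. f (x + \<sigma> * t) \<noteq> x + \<sigma> * t"
      using k[unfolded has_slope_def]
    proof eventually_elim
      case (elim t)
      have "t = t0" if "f x + \<sigma> * (r powi k * t) = x + \<sigma> * t"
        using that ne assms(2) unfolding t0_def by (auto simp: field_simps)
      then show ?case using elim by auto
    qed
    then show ?thesis ..
  qed
qed

end

locale scaling = slopes +
  fixes D :: "real set"
  assumes D_0: "0 \<in> D" and D_1: "1 \<in> D"
    and D_add: "x \<in> D \<Longrightarrow> y \<in> D \<Longrightarrow> x + y \<in> D"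
    and D_minus: "x \<in> D \<Longrightarrow> - x \<in> D"
    and D_scale: "x \<in> D \<Longrightarrow> r powi k * x \<in> D"
begin

lemma D_diff: "x \<in> D \<Longrightarrow> y \<in> D \<Longrightarrow> x - y \<in> D"
  using D_add[of x "-y"] D_minus by simp

text \<open>Solving \<open>f x = r\<^sup>k x + m\<close> with \<open>m \<in> D\<close> for \<open>x\<close>.\<close>

lemma PL_maps_D:
  assumes f: "f \<in> carrier (PL r D)"
  shows "f x \<in> D \<longleftrightarrow> x \<in> D"
proof -
  obtain k where k: "f x - r powi k * x \<in> D"
    using PL_D(6)[OF f, of 1] by blast
  show ?thesis
  proof
    assume "f x \<in> D"
    then have "r powi (-k) * (f x - (f x - r powi k * x)) \<in> D"
      by (intro D_scale D_diff[OF \<open>f x \<in> D\<close> k])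
    moreover have "f x - (f x - r powi k * x) = r powi k * x" by simp
    ultimately show "x \<in> D" by (simp only: r_powi_cancel)
  next
    assume "x \<in> D"
    then have "(f x - r powi k * x) + r powi k * x \<in> D"
      using k by (intro D_add D_scale)
    then show "f x \<in> D" by simp
  qed
qed

lemma PL_comp:
  assumes f: "f \<in> carrier (PL r D)" and g: "g \<in> carrier (PL r D)"
  shows "f \<circ> g \<in> carrier (PL r D)"
proof (rule PL_I)
  show "strict_mono (f \<circ> g)"
    using PL_D(1)[OF f] PL_D(1)[OF g] by (rule strict_mono_o)
  show "surj (f \<circ> g)"
    using PL_D(2)[OF f] PL_D(2)[OF g] by (rule comp_surj[rotated])
  show "(f \<circ> g) x = x" if "x \<notin> {0..1}" for x
    using PL_D(5)[OF f that] PL_D(5)[OF g that] by simp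
  show "\<exists>k. has_slope r (f \<circ> g) x \<sigma> k \<and> (f \<circ> g) x - r powi k * x \<in> D" if s: "\<sigma> \<in> {1,-1}" for x \<sigma>
  proof -
    obtain k where k: "has_slope r g x \<sigma> k" "g x - r powi k * x \<in> D"
      using PL_D(6)[OF g s] by blast
    obtain l where l: "has_slope r f (g x) \<sigma> l" "f (g x) - r powi l * g x \<in> D"
      using PL_D(6)[OF f s] by blast
    have "(f (g x) - r powi l * g x) + r powi l * (g x - r powi k * x) \<in> D"
      using k l by (intro D_add D_scale)
    also have "(f (g x) - r powi l * g x) + r powi l * (g x - r powi k * x) = (f \<circ> g) x - r powi (l + k) * x"
      using r_gt_1 by (simp add: power_int_add algebra_simps)
    finally show ?thesis
      using has_slope_comp[OF k(1) l(1)] by blast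
  qed
  show "\<exists>k. \<forall>\<sigma>\<in>{1,-1}. has_slope r (f \<circ> g) x \<sigma> k" if x: "x \<notin> D" for x
  proof -
    obtain k where k: "\<forall>\<sigma>\<in>{1,-1}. has_slope r g x \<sigma> k"
      using PL_D(7)[OF g x] by blast
    obtain l where l: "\<forall>\<sigma>\<in>{1,-1}. has_slope r f (g x) \<sigma> l"
      using PL_D(7)[OF f, of "g x"] PL_maps_D[OF g] x by blast
    show ?thesis
      using has_slope_comp k l by meson
  qed
qed

lemma PL_inv:
  assumes f: "f \<in> carrier (PL r D)"
  shows "inv_into UNIV f \<in> carrier (PL r D)"
proof (rule PL_I)
  note b = PL_D(3)[OF f]
  have fi: "f (inv_into UNIV f x) = x" for x
    using PL_D(2)[OF f] by (simp add: surj_f_inv_f)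
  show "strict_mono (inv_into UNIV f)"
    by (rule strict_monoI) (metis PL_less_iff[OF f] fi)
  show "surj (inv_into UNIV f)"
    using b bij_imp_bij_inv bij_is_surj by blast
  show "inv_into UNIV f x = x" if "x \<notin> {0..1}" for x
    using PL_D(5)[OF f that] b by (metis bij_inv_eq_iff)
  show "\<exists>k. affine_germ r D (inv_into UNIV f) x \<sigma> k" if s: "\<sigma> \<in> {1,-1}" for x \<sigma>
  proof -
    obtain k where k: "has_slope r f (inv_into UNIV f x) \<sigma> k" "f (inv_into UNIV f x) - r powi k * inv_into UNIV f x \<in> D"
      using PL_D(6)[OF f s] by blast
    have "r powi (-k) * - (f (inv_into UNIV f x) - r powi k * inv_into UNIV f x) \<in> D"
      using k by (intro D_scale D_minus)
    also have "r powi (-k) * - (f (inv_into UNIV f x) - r powi k * inv_into UNIV f x) = inv_into UNIV f x - r powi (-k) * x"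
      using r_gt_1 by (simp add: fi power_int_minus field_simps)
    finally show ?thesis
      using has_slope_inv[OF k(1) b] fi by auto
  qed
  show "\<exists>k. \<forall>\<sigma>\<in>{1,-1}. has_slope r (inv_into UNIV f) x \<sigma> k" if x: "x \<notin> D" for x
  proof -
    have "inv_into UNIV f x \<notin> D" using PL_maps_D[OF f, of "inv_into UNIV f x"] x fi by simp
    then obtain k where "\<forall>\<sigma>\<in>{1,-1}. has_slope r f (inv_into UNIV f x) \<sigma> k"
      using PL_D(7)[OF f] by blast
    then show ?thesis
      using has_slope_inv[OF _ b, of "inv_into UNIV f x"] fi by (metis)
  qed
qed

lemma PL_id: "id \<in> carrier (PL r D)"
proof (rule PL_I)
  have *: "has_slope r id x \<sigma> 0" for x \<sigma>
    by (simp add: has_slope_def)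
  show "\<exists>k. affine_germ r D id x \<sigma> k" for x \<sigma>
    using *[of x \<sigma>] D_0 by (intro exI[of _ 0]) auto
  show "\<exists>k. \<forall>\<sigma>\<in>{1,-1}. has_slope r id x \<sigma> k" for x
    using * by blast
qed (auto simp: strict_mono_def)

lemma group_PL: "group (PL r D)"
proof (rule groupI)
  show "\<exists>g\<in>carrier (PL r D). g \<otimes>\<^bsub>PL r D\<^esub> f = \<one>\<^bsub>PL r D\<^esub>" if "f \<in> carrier (PL r D)" for f
    using PL_inv[OF that] PL_D(4)[OF that] by (intro bexI[of _ "inv_into UNIV f"]) auto
qed (use PL_comp PL_id in \<open>auto simp: o_assoc\<close>)

lemma inv_PL: "f \<in> carrier (PL r D) \<Longrightarrow> inv\<^bsub>PL r D\<^esub> f = inv_into UNIV f"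
  by (rule group.inv_equality[OF group_PL]) (use PL_inv PL_D(4) in auto)

end

section \<open>Solvable groups acting on an interval\<close>

sublocale slopes \<subseteq> U: scaling r UNIV
  by unfold_locales auto

sublocale slopes \<subseteq> P: group "PL r UNIV"
  by (rule U.group_PL)

context slopes begin

abbreviation P where "P \<equiv> PL r UNIV"

abbreviation PL_sub where "PL_sub L \<equiv> P\<lparr>carrier := L\<rparr>"

lemma subgroup_PL_D:
  assumes "subgroup L P"
  shows "g \<in> L \<Longrightarrow> g \<in> carrier P"
    "g \<in> L \<Longrightarrow> h \<in> L \<Longrightarrow> g \<circ> h \<in> L"
    "g \<in> L \<Longrightarrow> inv_into UNIV g \<in> L"
    "id \<in> L"
  using assms subgroup.mem_carrier[OF assms] subgroup.m_closed[OF assms] subgroup.m_inv_closed[OF assms]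
    subgroup.one_closed[OF assms] by (auto simp: U.inv_PL[symmetric])

lemma PL_inv_apply [simp]:
  assumes "g \<in> carrier P" shows "g (inv_into UNIV g x) = x" "inv_into UNIV g (g x) = x"
  using PL_D(2,4)[OF assms] by (auto simp: surj_f_inv_f)

lemma PL_inv_fixes: "g \<in> carrier P \<Longrightarrow> g x = x \<Longrightarrow> inv_into UNIV g x = x"
  by (metis PL_inv_apply(2))

lemma commutator_in_derived:
  assumes "subgroup L P" "f \<in> L" "g \<in> L"
  shows "f \<circ> g \<circ> inv_into UNIV f \<circ> inv_into UNIV g \<in> derived P L"
  unfolding derived_def
  by (rule generate.incl) (use assms subgroup_PL_D(1)[OF assms(1)] in \<open>auto simp: U.inv_PL\<close>)

end

definition fixset :: "(real \<Rightarrow> real) set \<Rightarrow> real \<Rightarrow> real \<Rightarrow> real set" where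
  "fixset L a b = {x \<in> {a<..<b}. \<forall>g\<in>L. g x = x}"

locale interval_action = slopes +
  fixes L :: "(real \<Rightarrow> real) set" and a b :: real
  assumes L: "subgroup L P" and ab: "a < b"
    and fix_a: "g \<in> L \<Longrightarrow> g a = a" and fix_b: "g \<in> L \<Longrightarrow> g b = b"
begin

lemmas LD = subgroup_PL_D[OF L]

lemma in_interval: "g \<in> L \<Longrightarrow> x \<in> {a<..<b} \<Longrightarrow> g x \<in> {a<..<b}"
  using PL_less_iff[OF LD(1), of g a x] PL_less_iff[OF LD(1), of g x b] fix_a[of g] fix_b[of g] by auto

lemma L_less_iff: "g \<in> L \<Longrightarrow> g x < g y \<longleftrightarrow> x < y"
  using PL_less_iff[OF LD(1)] by blast

lemma derived_subset: "derived P L \<subseteq> L"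
  by (rule P.derived_incl[OF subset_refl L])

text \<open>Normality of the derived subgroup: \<open>g\<^sup>-\<^sup>1 h g h\<^sup>-\<^sup>1\<close> is a commutator, so \<open>g\<^sup>-\<^sup>1 h g\<close> fixes \<open>x\<close> whenever \<open>h\<close> and all
commutators do.\<close>

lemma derived_invariant:
  assumes "g \<in> L" "x \<in> fixset (derived P L) a b"
  shows "g x \<in> fixset (derived P L) a b"
proof -
  have "h (g x) = g x" if h: "h \<in> derived P L" for h
  proof -
    have hL: "h \<in> L" using h derived_subset by blast
    have "inv_into UNIV g \<circ> h \<circ> inv_into UNIV (inv_into UNIV g) \<circ> inv_into UNIV h \<in> derived P L"
      using assms(1) hL by (intro commutator_in_derived[OF L] LD)
    then have "(inv_into UNIV g \<circ> h \<circ> inv_into UNIV (inv_into UNIV g) \<circ> inv_into UNIV h) x = x"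
      using assms(2) unfolding fixset_def by blast
    moreover have "inv_into UNIV h x = x"
      using assms(2) h LD(1)[OF hL] by (intro PL_inv_fixes) (auto simp: fixset_def)
    moreover have "inv_into UNIV (inv_into UNIV g) = g"
      using PL_D(3)[OF LD(1)[OF assms(1)]] by (rule inv_inv_eq)
    ultimately have "inv_into UNIV g (h (g x)) = x" by simp
    then show ?thesis
      using PL_inv_apply(1)[OF LD(1)[OF assms(1)]] by metis
  qed
  then show ?thesis
    using assms in_interval[OF assms(1)] by (auto simp: fixset_def)
qed

text \<open>On the points fixed by the derived subgroup the group acts through its abelianization.\<close>

lemma commute_on_fixset:
  assumes "f \<in> L" "g \<in> L" "x \<in> fixset (derived P L) a b"
  shows "f (g x) = g (f x)"
proof -
  have "(f \<circ> g \<circ> inv_into UNIV f \<circ> inv_into UNIV g) (g (f x)) = g (f x)"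
    using commutator_in_derived[OF L assms(1,2)] derived_invariant assms unfolding fixset_def by blast
  then show ?thesis
    using PL_inv_apply(2)[OF LD(1)] assms by simp
qed

text \<open>The contradiction behind \<open>fixes_all\<close>. Let \<open>q\<^sub>0\<close> be the fixed point of \<open>f\<close> in the fixed set \<open>\<Phi>\<close> of the derived
subgroup that is closest to \<open>p\<close> on the side of \<open>q\<close>. Some \<open>g\<close> moves \<open>q\<^sub>0\<close> towards \<open>p\<close>; as \<open>f\<close> and \<open>g\<close>
commute on \<open>\<Phi>\<close>, the point \<open>g q\<^sub>0\<close> is again fixed by \<open>f\<close> and lies beyond \<open>p\<close>. Iterating \<open>g\<close>
yields fixed points \<open>g\<^sup>i q\<^sub>0\<close> and moved points \<open>g\<^sup>i p\<close> of \<open>f\<close> which alternate and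
converge to one point, against \<open>fix_dichotomy\<close>.\<close>

lemma fixes_all_aux:
  assumes nofix: "fixset L a b = {}"
    and f: "f \<in> L" and q: "q \<in> fixset (derived P L) a b" "f q = q"
    and p: "p \<in> fixset (derived P L) a b" "f p \<noteq> p"
    and \<sigma>: "\<sigma> \<in> {1,-1}" and qp: "\<sigma> * q < \<sigma> * p"
  shows False
proof -
  define \<Phi> where "\<Phi> = fixset (derived P L) a b"
  define W where "W = {s. \<sigma> * q \<le> s \<and> s \<le> \<sigma> * p \<and> f (\<sigma> * s) = \<sigma> * s \<and> (\<forall>h\<in>derived P L. h (\<sigma> * s) = \<sigma> * s)}"
  have ss: "\<sigma> * (\<sigma> * s) = s" for s using \<sigma> by auto
  have cont: "continuous_on UNIV (\<lambda>s. g (\<sigma> * s))" if "g \<in> L" for g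
    by (rule continuous_on_compose2[OF PL_continuous[OF LD(1)[OF that], of UNIV]]) (auto intro!: continuous_intros)
  have "W = {\<sigma> * q..\<sigma> * p} \<inter> {s. f (\<sigma> * s) = \<sigma> * s} \<inter> (\<Inter>h\<in>derived P L. {s. h (\<sigma> * s) = \<sigma> * s})"
    unfolding W_def by auto
  moreover have "closed {s. g (\<sigma> * s) = \<sigma> * s}" if "g \<in> L" for g
    by (rule closed_Collect_eq[OF cont[OF that]]) (auto intro!: continuous_intros)
  ultimately have clW: "closed W"
    using f derived_subset by (auto intro!: closed_Int closed_INT)
  have qW: "\<sigma> * q \<in> W"
    unfolding W_def mem_Collect_eq ss using q qp unfolding fixset_def by auto
  have bdd: "bdd_above W" unfolding W_def by (auto intro!: bdd_aboveI[of _ "\<sigma> * p"])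
  have "Sup W \<in> W"
    using closed_contains_Sup[OF _ bdd clW] qW by blast
  moreover define q0 where "q0 = \<sigma> * Sup W"
  ultimately have q0W: "\<sigma> * q0 \<in> W" and q0Sup: "\<And>s. s \<in> W \<Longrightarrow> s \<le> \<sigma> * q0"
    using cSup_upper[OF _ bdd] by (auto simp: ss)
  have Phi_between: "y \<in> \<Phi>" if "\<sigma> * y \<in> W" for y
    using that q(1) p(1) \<sigma> ss[of y] unfolding W_def \<Phi>_def fixset_def by auto
  have q0: "q0 \<in> \<Phi>" "f q0 = q0"
    using Phi_between[OF q0W] q0W by (auto simp: W_def ss)
  have "q0 \<noteq> p" using q0(2) p(2) by auto
  then have q0p: "\<sigma> * q0 < \<sigma> * p"
    using q0W \<sigma> by (auto simp: W_def)
  have mono: "\<sigma> * g x < \<sigma> * g y \<longleftrightarrow> \<sigma> * x < \<sigma> * y" if "g \<in> L" for g x y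
    using \<sigma> L_less_iff[OF that, of x y] L_less_iff[OF that, of y x] by auto
  obtain g where g: "g \<in> L" "\<sigma> * q0 < \<sigma> * g q0"
  proof -
    obtain g where g: "g \<in> L" "g q0 \<noteq> q0"
      using nofix q0(1) unfolding \<Phi>_def fixset_def by blast
    show thesis
    proof (cases "\<sigma> * q0 < \<sigma> * g q0")
      case True then show ?thesis using that g by blast
    next
      case False
      then have "\<sigma> * g q0 < \<sigma> * q0" using g(2) \<sigma> by auto
      then have "\<sigma> * inv_into UNIV g (g q0) < \<sigma> * inv_into UNIV g q0"
        using mono[OF LD(3)[OF g(1)]] by blast
      then show ?thesis
        using that[OF LD(3)[OF g(1)]] LD(1)[OF g(1)] by simp
    qed
  qed
  have pg: "\<sigma> * p < \<sigma> * g q0"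
  proof (rule ccontr)
    assume "\<not> ?thesis"
    moreover have "f (g q0) = g q0"
      using commute_on_fixset[OF f g(1), of q0] q0 by (simp add: \<Phi>_def)
    moreover have "g q0 \<in> \<Phi>" using derived_invariant[OF g(1)] q0(1) by (simp add: \<Phi>_def)
    ultimately have "\<sigma> * g q0 \<in> W"
      using g(2) q0W unfolding W_def \<Phi>_def fixset_def by (auto simp: ss)
    then show False using q0Sup g(2) by fastforce
  qed
  define Q where "Q i = (g ^^ i) q0" for i
  define R where "R i = (g ^^ i) p" for i
  have order: "\<sigma> * Q i < \<sigma> * R i \<and> \<sigma> * R i < \<sigma> * Q (Suc i)" for i
  proof (induction i)
    case 0 show ?case using q0p pg by (simp add: Q_def R_def)
  next
    case (Suc i)
    then show ?case using mono[OF g(1)] by (simp add: Q_def R_def)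
  qed
  have Q: "Q i \<in> \<Phi> \<and> f (Q i) = Q i" for i
  proof (induction i)
    case 0 show ?case using q0 by (simp add: Q_def)
  next
    case (Suc i)
    then show ?case
      using derived_invariant[OF g(1)] commute_on_fixset[OF f g(1), of "Q i"] by (simp add: Q_def \<Phi>_def)
  qed
  have R: "R i \<in> \<Phi> \<and> f (R i) \<noteq> R i" for i
  proof (induction i)
    case 0 show ?case using p by (simp add: R_def \<Phi>_def)
  next
    case (Suc i)
    then show ?case
      using derived_invariant[OF g(1)] commute_on_fixset[OF f g(1), of "R i"] PL_eq_iff[OF LD(1)[OF g(1)]]
      by (simp add: R_def \<Phi>_def)
  qed
  define z where "z = (SUP i. \<sigma> * Q i)"
  have "\<sigma> * Q i \<le> max b (- a)" for i
    using Q[of i] \<sigma> unfolding \<Phi>_def fixset_def by auto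
  then have bddQ: "bdd_above (range (\<lambda>i. \<sigma> * Q i))"
    by (auto intro!: bdd_aboveI)
  have Qz: "\<sigma> * Q i < z" for i
  proof -
    have "\<sigma> * Q i < \<sigma> * Q (Suc i)" using order[of i] by linarith
    also have "\<dots> \<le> z" unfolding z_def by (rule cSUP_upper[OF _ bddQ]) simp
    finally show ?thesis .
  qed
  have approach: "\<exists>i. z - e < \<sigma> * Q i" if "e > 0" for e
    using less_cSUP_iff[OF _ bddQ, of "z - e"] that unfolding z_def by auto
  have "- \<sigma> \<in> {1,-1}" using \<sigma> by auto
  from fix_dichotomy[OF LD(1)[OF f] this, of "\<sigma> * z"] show False
  proof
    assume "\<forall>\<^sub>F t in at_right 0. f (\<sigma> * z + - \<sigma> * t) = \<sigma> * z + - \<sigma> * t"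
    then obtain e where e: "e > 0" "\<And>t. 0 < t \<Longrightarrow> t < e \<Longrightarrow> f (\<sigma> * z + - \<sigma> * t) = \<sigma> * z + - \<sigma> * t"
      by (auto simp: eventually_at_right_field)
    obtain i where "z - e < \<sigma> * Q i" using approach[OF e(1)] by blast
    then have "0 < z - \<sigma> * R i" "z - \<sigma> * R i < e"
      using order[of i] Qz[of "Suc i"] by auto
    from e(2)[OF this] have "f (R i) = R i"
      by (simp add: algebra_simps ss)
    then show False using R by blast
  next
    assume "\<forall>\<^sub>F t in at_right 0. f (\<sigma> * z + - \<sigma> * t) \<noteq> \<sigma> * z + - \<sigma> * t"
    then obtain e where e: "e > 0" "\<And>t. 0 < t \<Longrightarrow> t < e \<Longrightarrow> f (\<sigma> * z + - \<sigma> * t) \<noteq> \<sigma> * z + - \<sigma> * t"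
      by (auto simp: eventually_at_right_field)
    obtain i where "z - e < \<sigma> * Q i" using approach[OF e(1)] by blast
    then have "0 < z - \<sigma> * Q i" "z - \<sigma> * Q i < e"
      using Qz[of i] by auto
    from e(2)[OF this] have "f (Q i) \<noteq> Q i"
      by (simp add: algebra_simps ss)
    then show False using Q by blast
  qed
qed

lemma fixes_all:
  assumes nofix: "fixset L a b = {}"
    and f: "f \<in> L" and q: "q \<in> fixset (derived P L) a b" "f q = q"
    and p: "p \<in> fixset (derived P L) a b"
  shows "f p = p"
proof (rule ccontr)
  assume ne: "f p \<noteq> p"
  then consider "q < p" | "p < q" using q by fastforce
  then show False
  proof cases
    case 1 then show ?thesis using fixes_all_aux[OF nofix f q p ne, of 1] by simp
  next
    case 2 then show ?thesis using fixes_all_aux[OF nofix f q p ne, of "-1"] by simp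
  qed
qed

text \<open>The infimum and the supremum of an invariant set are fixed points, so they can only be the ends of
the interval. Only points of the closure have to be moved: the set of acting maps may well have other fixed
points.\<close>

lemma invariant_set_accumulates_if_limits_move:
  assumes M: "M \<subseteq> L" "\<And>g. g \<in> M \<Longrightarrow> inv_into UNIV g \<in> M"
    and A: "A \<subseteq> {a<..<b}" "A \<noteq> {}" "\<And>g x. g \<in> M \<Longrightarrow> x \<in> A \<Longrightarrow> g x \<in> A"
    and nofix: "\<And>z. z \<in> closure A \<Longrightarrow> z \<in> {a<..<b} \<Longrightarrow> \<exists>g\<in>M. g z \<noteq> z"
  shows "a < y \<Longrightarrow> \<exists>x\<in>A. x < y" "y < b \<Longrightarrow> \<exists>x\<in>A. y < x"
proof -
  obtain w where w: "w \<in> A" using A by blast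
  have bdd: "bdd_below A" "bdd_above A"
    using A(1) by (meson bdd_above_Ioo bdd_above_mono bdd_below_Ioo bdd_below_mono)+
  note inL = subsetD[OF M(1)]
  have fixed: "g z = z" if le: "(\<forall>g\<in>M. g z \<le> z) \<or> (\<forall>g\<in>M. z \<le> g z)" and g: "g \<in> M" for g z
  proof -
    note gP = LD(1)[OF inL[OF g]]
    have "g z \<le> z \<and> inv_into UNIV g z \<le> z \<or> z \<le> g z \<and> z \<le> inv_into UNIV g z"
      using le M(2)[OF g] g by blast
    then have "g z \<le> z \<and> g (inv_into UNIV g z) \<le> g z \<or> z \<le> g z \<and> g z \<le> g (inv_into UNIV g z)"
      by (simp only: PL_le_iff[OF gP])
    then show ?thesis by (auto simp: PL_inv_apply(1)[OF gP])
  qed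
  {
    assume y: "a < y"
    show "\<exists>x\<in>A. x < y"
    proof (rule ccontr)
      assume "\<not> ?thesis"
      then have "y \<le> Inf A" using A(2) by (intro cInf_greatest) auto
      moreover have "Inf A \<le> w" using w bdd by (intro cInf_lower)
      ultimately have z: "Inf A \<in> {a<..<b}" using y w A(1) by auto
      have le: "g (Inf A) \<le> Inf A" if g: "g \<in> M" for g
      proof (rule cInf_greatest[OF A(2)])
        fix x assume x: "x \<in> A"
        have "inv_into UNIV g x \<in> A" using A(3) M(2) g x by blast
        then have "Inf A \<le> inv_into UNIV g x" using bdd by (intro cInf_lower)
        then have "g (Inf A) \<le> g (inv_into UNIV g x)" using PL_le_iff[OF LD(1)[OF inL[OF g]]] by blast
        then show "g (Inf A) \<le> x" using LD(1)[OF inL[OF g]] by simp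
      qed
      then show False using fixed[of "Inf A"] nofix[OF closure_contains_Inf[OF A(2) bdd(1)] z] by blast
    qed
  next
    assume y: "y < b"
    show "\<exists>x\<in>A. y < x"
    proof (rule ccontr)
      assume "\<not> ?thesis"
      then have "Sup A \<le> y" using A(2) by (intro cSup_least) auto
      moreover have "w \<le> Sup A" using w bdd by (intro cSup_upper)
      ultimately have z: "Sup A \<in> {a<..<b}" using y w A(1) by auto
      have le: "Sup A \<le> g (Sup A)" if g: "g \<in> M" for g
      proof (rule cSup_least[OF A(2)])
        fix x assume x: "x \<in> A"
        have "inv_into UNIV g x \<in> A" using A(3) M(2) g x by blast
        then have "inv_into UNIV g x \<le> Sup A" using bdd by (intro cSup_upper)
        then have "g (inv_into UNIV g x) \<le> g (Sup A)" using PL_le_iff[OF LD(1)[OF inL[OF g]]] by blast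
        then show "x \<le> g (Sup A)" using LD(1)[OF inL[OF g]] by simp
      qed
      then show False using fixed[of "Sup A"] nofix[OF closure_contains_Sup[OF A(2) bdd(2)] z] by blast
    qed
  }
qed

lemma invariant_set_accumulates:
  assumes nofix: "fixset L a b = {}"
    and A: "A \<subseteq> {a<..<b}" "A \<noteq> {}" "\<And>g x. g \<in> L \<Longrightarrow> x \<in> A \<Longrightarrow> g x \<in> A"
  shows "a < y \<Longrightarrow> \<exists>x\<in>A. x < y" "y < b \<Longrightarrow> \<exists>x\<in>A. y < x"
proof -
  have *: "\<exists>g\<in>L. g z \<noteq> z" if "z \<in> {a<..<b}" for z
    using nofix that unfolding fixset_def by blast
  show "\<exists>x\<in>A. x < y" if "a < y"
    by (rule invariant_set_accumulates_if_limits_move(1)[of L A]) (use LD(3) A * that in auto)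
  show "\<exists>x\<in>A. y < x" if "y < b"
    by (rule invariant_set_accumulates_if_limits_move(2)[of L A]) (use LD(3) A * that in auto)
qed

text \<open>The exponent of the slope to the right of the left end; it is a homomorphism to the integers because \<open>a\<close> is
a common fixed point.\<close>

definition germ :: "(real \<Rightarrow> real) \<Rightarrow> int" where
  "germ g = (SOME k. has_slope r g a 1 k)"

lemma has_slope_germ: "g \<in> L \<Longrightarrow> has_slope r g a 1 (germ g)"
  unfolding germ_def using PL_D(6)[OF LD(1), of g 1 a] by (metis insertI1 someI_ex)

lemma germ_eqI: "g \<in> L \<Longrightarrow> has_slope r g a 1 k \<Longrightarrow> germ g = k"
  using has_slope_unique[OF has_slope_germ] by simp

lemma germ_comp: "f \<in> L \<Longrightarrow> g \<in> L \<Longrightarrow> germ (f \<circ> g) = germ f + germ g"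
  by (rule germ_eqI[OF LD(2)])
    (use has_slope_comp[OF has_slope_germ, of g f] has_slope_germ[of f] fix_a[of g] in auto)

lemma germ_inv: "g \<in> L \<Longrightarrow> germ (inv_into UNIV g) = - germ g"
  by (rule germ_eqI[OF LD(3)]) (use has_slope_inv[OF has_slope_germ PL_D(3)[OF LD(1)], of g] fix_a[of g] in auto)

lemma germ_id: "germ id = 0"
  by (rule germ_eqI[OF LD(4)]) (simp add: has_slope_def)

definition germ_kernel where "germ_kernel = {g \<in> L. germ g = 0}"

lemma subgroup_germ_kernel: "subgroup germ_kernel P"
  by (rule P.subgroupI)
    (use LD germ_comp germ_inv germ_id in \<open>auto simp: germ_kernel_def U.inv_PL\<close>)

lemma derived_subset_germ_kernel: "derived P L \<subseteq> germ_kernel"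
  unfolding derived_def
proof (rule P.generate_subgroup_incl[OF _ subgroup_germ_kernel])
  show "derived_set P L \<subseteq> germ_kernel"
    using LD by (auto simp: germ_kernel_def U.inv_PL germ_comp germ_inv)
qed

lemma germ_kernel_near_a:
  assumes "g \<in> germ_kernel"
  obtains e where "e > 0" "\<And>y. y \<le> a + e \<Longrightarrow> a \<le> y \<Longrightarrow> g y = y"
proof -
  have g: "g \<in> L" "germ g = 0" using assms by (auto simp: germ_kernel_def)
  have "has_slope r g a 1 0" using has_slope_germ[OF g(1)] g(2) by simp
  then obtain d where d: "d > 0" "\<And>t. 0 < t \<Longrightarrow> t < d \<Longrightarrow> g (a + t) = a + t"
    using fix_a[OF g(1)] by (auto simp: has_slope_def eventually_at_right_field)
  show thesis
  proof (rule that[of "d / 2"])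
    show "d / 2 > 0" using d by simp
    show "g y = y" if "y \<le> a + d / 2" "a \<le> y" for y
    proof (cases "y = a")
      case False then show ?thesis using d(2)[of "y - a"] that d(1) by simp
    qed (use fix_a[OF g(1)] in auto)
  qed
qed

lemma interval_action_derived:
  "interval_action r ((derived P ^^ i) L) a b" "(derived P ^^ i) L \<subseteq> L"
proof -
  show sub: "(derived P ^^ i) L \<subseteq> L"
    by (induction i) (use P.derived_incl[OF _ L] in auto)
  show "interval_action r ((derived P ^^ i) L) a b"
    by (intro interval_action.intro interval_action_axioms.intro slopes_axioms
        P.exp_of_derived_is_subgroup[OF L] ab) (use sub fix_a fix_b in auto)
qed

text \<open>Otherwise let \<open>L\<close> be the last term of the derived series without a fixed point in the interval. It is
contained in the derived subgroup, so its elements have trivial germ at \<open>a\<close> and thus fix points of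
the fixed set of \<open>L'\<close>, which accumulates at \<open>a\<close>. By \<open>fixes_all\<close> they fix this whole set, and
\<open>L\<close> has a fixed point after all.\<close>

lemma fixset_derived_nonempty:
  assumes nofix: "fixset L a b = {}" and solv: "(derived P ^^ d) L = {id}"
  shows "fixset (derived P L) a b \<noteq> {}"
proof -
  have "(a + b) / 2 \<in> fixset ((derived P ^^ d) L) a b"
    using ab solv by (auto simp: fixset_def field_simps)
  then have ex: "fixset ((derived P ^^ d) L) a b \<noteq> {}" by blast
  define m where "m = (LEAST i. fixset ((derived P ^^ i) L) a b \<noteq> {})"
  have m: "fixset ((derived P ^^ m) L) a b \<noteq> {}"
    unfolding m_def by (rule LeastI[of _ d]) (rule ex)
  have "m \<noteq> 0" using m nofix by (intro notI) simp
  then obtain i where i: "m = Suc i" by (cases m) auto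
  have nofix_i: "fixset ((derived P ^^ i) L) a b = {}"
    using not_less_Least[of i "\<lambda>i. fixset ((derived P ^^ i) L) a b \<noteq> {}"] i unfolding m_def by auto
  show ?thesis
  proof (cases i)
    case 0
    then show ?thesis using m i by simp
  next
    case (Suc j)
    interpret I: interval_action r "(derived P ^^ i) L" a b by (rule interval_action_derived)
    have m': "fixset (derived P ((derived P ^^ i) L)) a b \<noteq> {}" using m i by simp
    then obtain p where p: "p \<in> fixset (derived P ((derived P ^^ i) L)) a b" by blast
    have sub: "(derived P ^^ i) L \<subseteq> germ_kernel"
      using P.mono_derived[OF interval_action_derived(2)[of j]] derived_subset_germ_kernel Suc by auto
    have "f p = p" if f: "f \<in> (derived P ^^ i) L" for f
    proof -
      obtain e where e: "e > 0" "\<And>y. y \<le> a + e \<Longrightarrow> a \<le> y \<Longrightarrow> f y = y"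
        using germ_kernel_near_a sub f by blast
      have "fixset (derived P ((derived P ^^ i) L)) a b \<subseteq> {a<..<b}"
        by (auto simp: fixset_def)
      then obtain q where q: "q \<in> fixset (derived P ((derived P ^^ i) L)) a b" "q < a + e"
        using I.invariant_set_accumulates(1)[OF nofix_i _ m', of "a + e"] I.derived_invariant e(1)
        by auto
      then have "f q = q" using e(2)[of q] by (auto simp: fixset_def)
      then show ?thesis using I.fixes_all[OF nofix_i f q(1) _ p] by blast
    qed
    then have "p \<in> fixset ((derived P ^^ i) L) a b" using p by (auto simp: fixset_def)
    then show ?thesis using nofix_i by blast
  qed
qed

end

section \<open>The structure of a solvable group with a single orbital\<close>

context interval_action begin

abbreviation cpow where "cpow c t \<equiv> c [^]\<^bsub>P\<^esub> (t::int)"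

lemma cpow_simps:
  assumes "c \<in> L"
  shows "cpow c t \<in> L" "cpow c (s + t) = cpow c s \<circ> cpow c t" "cpow c 0 = id" "cpow c 1 = c"
    "inv_into UNIV (cpow c t) = cpow c (- t)"
proof -
  note c = LD(1)[OF assms]
  show t: "cpow c t \<in> L" for t
    using P.subgroup_int_pow_closed[OF L assms] .
  show "cpow c (s + t) = cpow c s \<circ> cpow c t"
    using P.int_pow_mult[OF c, of s t] by simp
  show "cpow c 0 = id" "cpow c 1 = c" using c by simp_all
  show "inv_into UNIV (cpow c t) = cpow c (- t)"
    using P.int_pow_neg[OF c, of t] U.inv_PL[OF LD(1)[OF t]] by simp
qed

lemma germ_cpow: "c \<in> L \<Longrightarrow> germ (cpow c t) = t * germ c"
proof (induction t rule: int_induct[of _ 0])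
  case base
  then show ?case using cpow_simps(3)[of c] germ_id by (simp only: mult_zero_left)
next
  case (step1 i)
  have "cpow c (i + 1) = cpow c i \<circ> c"
    using cpow_simps(2)[OF step1.prems, of i 1] cpow_simps(4)[OF step1.prems] by simp
  moreover have "germ (cpow c i \<circ> c) = germ (cpow c i) + germ c"
    using step1.prems by (intro germ_comp cpow_simps)
  ultimately have "germ (cpow c (i + 1)) = germ (cpow c i) + germ c" by metis
  then show ?case using step1 by (simp add: algebra_simps)
next
  case (step2 i)
  have "germ (cpow c (i - 1) \<circ> c) = germ (cpow c (i - 1)) + germ c"
    using step2.prems by (intro germ_comp cpow_simps)
  moreover have "cpow c (i - 1) \<circ> c = cpow c i"
    using cpow_simps(2)[OF step2.prems, of "i - 1" 1] cpow_simps(4)[OF step2.prems] by simp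
  ultimately have "germ (cpow c i) = germ (cpow c (i - 1)) + germ c" by metis
  then show ?case using step2 by (simp add: algebra_simps)
qed

lemma subset_fixset: "fixset M a b \<subseteq> {a<..<b}"
  by (auto simp: fixset_def)

lemma closure_fixset:
  assumes "M \<subseteq> L" "z \<in> closure (fixset M a b)" "z \<in> {a<..<b}"
  shows "z \<in> fixset M a b"
proof -
  have "closed (\<Inter>g\<in>M. {y. g y = y})"
    using assms(1) PL_continuous[OF LD(1)]
    by (intro closed_INT closed_Collect_eq ballI continuous_on_id) auto
  then have "closure (fixset M a b) \<subseteq> (\<Inter>g\<in>M. {y. g y = y})"
    by (intro closure_minimal) (auto simp: fixset_def)
  then show ?thesis using assms by (auto simp: fixset_def)
qed

text \<open>This is how fixed points near the left end determine the slope there.\<close>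

lemma holds_somewhere_near_end:
  assumes "A \<subseteq> {a<..<b}" "\<And>y. a < y \<Longrightarrow> \<exists>x\<in>A. x < y" "\<forall>\<^sub>F t in at_right 0. Q (a + t)"
  shows "\<exists>x\<in>A. Q x"
proof -
  obtain e where e: "e > 0" "\<And>t. 0 < t \<Longrightarrow> t < e \<Longrightarrow> Q (a + t)"
    using assms(3) by (auto simp: eventually_at_right_field)
  obtain x where "x \<in> A" "x < a + e" using assms(2)[of "a + e"] e by auto
  then show ?thesis using e(2)[of "x - a"] assms(1) by fastforce
qed

text \<open>The element \<open>c\<close> generates the group modulo the kernel of the germ at \<open>a\<close>, and \<open>x\<close> is a fixed point of the
derived subgroup. The last conclusion lowers the derived length: conjugating \<open>h\<close> by a power of \<open>c\<close> that pushes the tile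
\<open>[x, c x)\<close> into the region near \<open>a\<close> where \<open>h\<close> is trivial gives a map that is trivial on this tile, so on the tile
\<open>h\<close> agrees with a commutator.\<close>

lemma orbital_structure:
  assumes nofix: "fixset L a b = {}" and solv: "(derived P ^^ d) L = {id}"
  obtains c x where "c \<in> L" "x \<in> {a<..<b}" "x < c x"
    "\<And>h. h \<in> germ_kernel \<Longrightarrow> h x = x \<and> h (c x) = c x"
    "\<And>g. g \<in> L \<Longrightarrow> \<exists>t. g \<circ> cpow c (- t) \<in> germ_kernel"
    "\<And>t. cpow c t \<in> germ_kernel \<Longrightarrow> t = 0"
    "\<And>y. y \<in> {a<..<b} \<Longrightarrow> \<exists>s. cpow c s x \<le> y \<and> y < cpow c (s + 1) x"
    "\<And>h. h \<in> germ_kernel \<Longrightarrow> finite {s. \<exists>y\<in>{x..<c x}. (cpow c s \<circ> h \<circ> cpow c (- s)) y \<noteq> y}"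
    "\<And>h. h \<in> germ_kernel \<Longrightarrow> \<exists>g\<in>derived P L. \<forall>y\<in>{x..<c x}. g y = h y"
proof -
  define \<Phi> where "\<Phi> = fixset (derived P L) a b"
  have \<Phi>_ne: "\<Phi> \<noteq> {}" and \<Phi>_sub: "\<Phi> \<subseteq> {a<..<b}"
    using fixset_derived_nonempty[OF nofix solv] subset_fixset unfolding \<Phi>_def by blast+
  have \<Phi>_inv: "g p \<in> \<Phi>" if "g \<in> L" "p \<in> \<Phi>" for g p
    using derived_invariant that unfolding \<Phi>_def by blast
  have \<Phi>_a: "\<exists>x\<in>\<Phi>. x < y" if "a < y" for y
    using invariant_set_accumulates(1)[of \<Phi> y] nofix \<Phi>_sub \<Phi>_ne \<Phi>_inv that by auto
  have \<Phi>_b: "\<exists>x\<in>\<Phi>. y < x" if "y < b" for y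
    using invariant_set_accumulates(2)[of \<Phi> y] nofix \<Phi>_sub \<Phi>_ne \<Phi>_inv that by auto
  have \<Phi>_all: "f p = p" if "f \<in> L" "q \<in> \<Phi>" "f q = q" "p \<in> \<Phi>" for f q p
    using fixes_all[OF nofix] that unfolding \<Phi>_def by blast
  have KL: "h \<in> L" if "h \<in> germ_kernel" for h using that by (simp add: germ_kernel_def)
  have K_fixes: "h p = p" if h: "h \<in> germ_kernel" and p: "p \<in> \<Phi>" for h p
  proof -
    obtain e where e: "e > 0" "\<And>y. y \<le> a + e \<Longrightarrow> a \<le> y \<Longrightarrow> h y = y"
      using germ_kernel_near_a[OF h] by blast
    obtain q where q: "q \<in> \<Phi>" "q < a + e" using \<Phi>_a[of "a + e"] e(1) by auto
    then have "h q = q" using e(2)[of q] \<Phi>_sub by auto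
    then show ?thesis using \<Phi>_all[OF KL[OF h] q(1) _ p] by blast
  qed
  have K_if_fixes: "g \<in> germ_kernel" if g: "g \<in> L" and p: "p \<in> \<Phi>" "g p = p" for g p
  proof -
    have "\<exists>x\<in>\<Phi>. g x = a + r powi germ g * (x - a)"
      by (rule holds_somewhere_near_end[OF \<Phi>_sub \<Phi>_a])
        (use has_slope_germ[OF g] fix_a[OF g] in \<open>simp_all add: has_slope_def\<close>)
    then obtain x where x: "x \<in> \<Phi>" "g x = a + r powi germ g * (x - a)" by blast
    have "x \<noteq> a" using x(1) \<Phi>_sub by auto
    moreover have "x - a = r powi germ g * (x - a)"
      using \<Phi>_all[OF g p x(1)] x(2) by linarith
    ultimately have "r powi germ g = 1" by simp
    then show ?thesis using g by (simp add: germ_kernel_def r_powi_eq_1_iff)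
  qed
  \<comment> \<open>The germs form a non-trivial subgroup of the integers; \<open>c\<close> has the least positive one.\<close>
  obtain p where p: "p \<in> \<Phi>" using \<Phi>_ne by blast
  define m where "m = (LEAST n::nat. 0 < n \<and> (\<exists>c\<in>L. germ c = int n))"
  have "\<exists>n::nat. 0 < n \<and> (\<exists>c\<in>L. germ c = int n)"
  proof -
    obtain g where g: "g \<in> L" "g p \<noteq> p"
      using nofix p \<Phi>_sub unfolding fixset_def by blast
    then have "germ g \<noteq> 0" using K_fixes[OF _ p, of g] by (auto simp: germ_kernel_def)
    then consider "germ g > 0" | "germ (inv_into UNIV g) > 0" using germ_inv[OF g(1)] by linarith
    then show ?thesis
    proof cases
      case 1
      then show ?thesis using g(1) by (intro exI[of _ "nat (germ g)"]) auto
    next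
      case 2
      then show ?thesis using LD(3)[OF g(1)] by (intro exI[of _ "nat (germ (inv_into UNIV g))"]) auto
    qed
  qed
  from LeastI_ex[OF this] obtain c where c: "c \<in> L" "germ c = int m" and m: "m > 0"
    unfolding m_def[symmetric] by blast
  note cp = cpow_simps[OF c(1)]
  have decomp: "\<exists>t. g \<circ> cpow c (- t) \<in> germ_kernel" if g: "g \<in> L" for g
  proof (intro exI)
    let ?q = "germ g div int m"
    let ?g = "g \<circ> cpow c (- ?q)"
    have gL: "?g \<in> L" using g cp(1) by (intro LD)
    have germ: "germ ?g = germ g mod int m"
      using germ_comp[OF g cp(1)] germ_cpow[OF c(1)] c(2) by (simp add: minus_div_mult_eq_mod[symmetric])
    have "germ ?g = 0"
    proof (rule ccontr)
      assume ne: "germ ?g \<noteq> 0"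
      have rng: "0 \<le> germ ?g" "germ ?g < int m" using m by (simp_all add: germ)
      then have "0 < nat (germ ?g) \<and> (\<exists>c\<in>L. germ c = int (nat (germ ?g)))"
        using ne gL by (intro conjI bexI[of _ ?g]) auto
      then have "m \<le> nat (germ ?g)" unfolding m_def by (rule Least_le)
      then show False using rng by linarith
    qed
    then show "?g \<in> germ_kernel" using gL by (simp add: germ_kernel_def)
  qed
  have uniq: "t = 0" if "cpow c t \<in> germ_kernel" for t
    using that germ_cpow[OF c(1), of t] c(2) m by (simp add: germ_kernel_def)
  \<comment> \<open>Since the slope of \<open>c\<close> at \<open>a\<close> exceeds 1, \<open>c\<close> moves every point close to \<open>a\<close> to the right.\<close>
  have "\<exists>x\<in>\<Phi>. c x = a + r powi germ c * (x - a)"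
    by (rule holds_somewhere_near_end[OF \<Phi>_sub \<Phi>_a])
      (use has_slope_germ[OF c(1)] fix_a[OF c(1)] in \<open>simp_all add: has_slope_def\<close>)
  then obtain x where x: "x \<in> \<Phi>" "c x = a + r powi germ c * (x - a)" by blast
  have "1 < r powi germ c" using r_gt_1 m c(2) by (simp add: one_less_power)
  then have "1 * (x - a) < r powi germ c * (x - a)"
    using x(1) \<Phi>_sub by (intro mult_strict_right_mono) auto
  then have xc: "x < c x" using x(2) by simp
  have cpx: "cpow c s x \<in> \<Phi>" for s using \<Phi>_inv[OF cp(1) x(1)] .
  have Suc: "cpow c s x < cpow c (s + 1) x" for s
    using L_less_iff[OF cp(1), of s x "c x"] xc by (simp add: cp(2) cp(4))
  have mono_nat: "cpow c s x < cpow c (s + int (Suc n)) x" for s n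
  proof (induction n)
    case 0 show ?case using Suc[of s] by simp
  next
    case (Suc n)
    also have "cpow c (s + int (Suc n)) x < cpow c (s + int (Suc n) + 1) x" by (rule \<open>\<And>s. cpow c s x < cpow c (s + 1) x\<close>)
    finally show ?case by (simp add: algebra_simps)
  qed
  have mono: "cpow c s x < cpow c t x" if "s < t" for s t
    using mono_nat[of s "nat (t - s) - 1"] that by (simp add: Suc_diff_1)
  have mono_iff: "cpow c s x < cpow c t x \<longleftrightarrow> s < t" for s t
    using mono[of s t] mono[of t s] by (cases s t rule: linorder_cases) auto
  \<comment> \<open>A limit of the orbit inside the interval would be a point of \<open>\<Phi>\<close> fixed by \<open>c\<close>.\<close>
  let ?A = "range (\<lambda>s. cpow c s x)" and ?M = "{c, inv_into UNIV c}"
  have M: "?M \<subseteq> L" "\<And>g. g \<in> ?M \<Longrightarrow> inv_into UNIV g \<in> ?M"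
    using c(1) LD(3) inv_inv_eq[OF PL_D(3)[OF LD(1)[OF c(1)]]] by auto
  have A: "?A \<subseteq> {a<..<b}" "?A \<noteq> {}" using cpx \<Phi>_sub by auto
  have inv_c: "inv_into UNIV c = cpow c (- 1)" using cp(5)[of 1] cp(4) by simp
  have A_inv: "g y \<in> ?A" if gy: "g \<in> ?M" "y \<in> ?A" for g y
  proof -
    obtain s where s: "y = cpow c s x" using gy(2) by blast
    have "c y = cpow c (1 + s) x" using cp(2)[of 1 s] cp(4) s by simp
    moreover have "inv_into UNIV c y = cpow c (- 1 + s) x" using cp(2)[of "-1" s] inv_c s by simp
    ultimately show ?thesis using gy(1) by blast
  qed
  have nofix_c: "\<exists>g\<in>?M. g z \<noteq> z" if z: "z \<in> closure ?A" "z \<in> {a<..<b}" for z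
  proof (rule ccontr)
    assume "\<not> ?thesis"
    then have "c z = z" by blast
    have "?A \<subseteq> fixset (derived P L) a b" using cpx by (auto simp: \<Phi>_def)
    then have "z \<in> \<Phi>"
      using closure_fixset[OF derived_subset _ z(2)] closure_mono z(1) unfolding \<Phi>_def by blast
    then have "c \<in> germ_kernel" using K_if_fixes[OF c(1)] \<open>c z = z\<close> by blast
    then show False using uniq[of 1] cp(4) by simp
  qed
  have "\<exists>z\<in>?A. z < y" if "a < y" for y
    by (rule invariant_set_accumulates_if_limits_move(1)[of ?M ?A y]) (fact M A A_inv nofix_c that)+
  then have acc_a: "\<exists>s. cpow c s x < y" if "a < y" for y
    using that by blast
  have "\<exists>z\<in>?A. y < z" if "y < b" for y
    by (rule invariant_set_accumulates_if_limits_move(2)[of ?M ?A y]) (fact M A A_inv nofix_c that)+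
  then have acc_b: "\<exists>s. y < cpow c s x" if "y < b" for y
    using that by blast
  have tile: "\<exists>s. cpow c s x \<le> y \<and> y < cpow c (s + 1) x" if y: "y \<in> {a<..<b}" for y
  proof -
    obtain s0 where s0: "cpow c s0 x < y" using acc_a y by auto
    obtain s1 where s1: "y < cpow c s1 x" using acc_b y by auto
    have "s0 < s1" using s0 s1 mono_iff[of s0 s1] by simp
    then have ex: "\<exists>n::nat. y < cpow c (s0 + int n) x" using s1 by (intro exI[of _ "nat (s1 - s0)"]) simp
    define n where "n = (LEAST n::nat. y < cpow c (s0 + int n) x)"
    have n: "y < cpow c (s0 + int n) x" unfolding n_def by (rule LeastI_ex[OF ex])
    have "n \<noteq> 0" using n s0 by (intro notI) simp
    then obtain k where k: "n = Suc k" by (cases n) auto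
    have "\<not> y < cpow c (s0 + int k) x"
      by (rule not_less_Least) (use k in \<open>simp add: n_def[symmetric]\<close>)
    then show ?thesis using n k by (intro exI[of _ "s0 + int k"]) (simp add: algebra_simps)
  qed
  have cancel: "cpow c s (cpow c (- s) y) = y" "cpow c (- s) (cpow c s y) = y" for s y
    using cp(2)[of s "- s"] cp(2)[of "- s" s] cp(3) by (simp_all add: fun_eq_iff)
  have stepc: "cpow c s (c y) = cpow c (s + 1) y" for s y
    using cp(2)[of s 1] cp(4) by simp
  have fin: "finite {s. \<exists>y\<in>{x..<c x}. (cpow c s \<circ> h \<circ> cpow c (- s)) y \<noteq> y}" if h: "h \<in> germ_kernel" for h
  proof -
    obtain e where e: "e > 0" "\<And>y. y \<le> a + e \<Longrightarrow> a \<le> y \<Longrightarrow> h y = y"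
      using germ_kernel_near_a[OF h] by blast
    have "\<forall>\<^sub>F t in at_right 0. h (b + (-1) * t) = b + (-1) * t"
    proof (rule ccontr)
      assume "\<not> ?thesis"
      then have "\<forall>\<^sub>F t in at_right 0. h (b + (-1) * t) \<noteq> b + (-1) * t"
        using fix_dichotomy[OF LD(1)[OF KL[OF h]], of "-1" b] by blast
      then obtain e where e: "e > 0" "\<And>t. 0 < t \<Longrightarrow> t < e \<Longrightarrow> h (b + (-1) * t) \<noteq> b + (-1) * t"
        by (auto simp: eventually_at_right_field)
      obtain q where q: "q \<in> \<Phi>" "b - e < q" using \<Phi>_b[of "b - e"] e(1) by auto
      then have "q < b" using \<Phi>_sub by auto
      then show False using e(2)[of "b - q"] q(2) K_fixes[OF h q(1)] by simp
    qed
    then obtain f where f: "f > 0" "\<And>t. 0 < t \<Longrightarrow> t < f \<Longrightarrow> h (b + (-1) * t) = b + (-1) * t"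
      by (auto simp: eventually_at_right_field)
    obtain N0 where N0: "b - f < cpow c N0 x" using acc_b[of "b - f"] f(1) by auto
    obtain N1 where N1: "cpow c N1 x < a + e" using acc_a[of "a + e"] e(1) by auto
    \<comment> \<open>For all other \<open>s\<close> the tile with index \<open>-s\<close> lies so close to an end that \<open>h\<close> is the identity on it.\<close>
    have "{s. \<exists>y\<in>{x..<c x}. (cpow c s \<circ> h \<circ> cpow c (- s)) y \<noteq> y} \<subseteq> {- N0..1 - N1}"
    proof
      fix s assume "s \<in> {s. \<exists>y\<in>{x..<c x}. (cpow c s \<circ> h \<circ> cpow c (- s)) y \<noteq> y}"
      then obtain y where y: "y \<in> {x..<c x}" "(cpow c s \<circ> h \<circ> cpow c (- s)) y \<noteq> y" by blast
      define w where "w = cpow c (- s) y"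
      have hw: "h w \<noteq> w" using y(2) cancel(1)[of s y] unfolding w_def by auto
      have "x \<in> {a<..<b}" "c x \<in> {a<..<b}" using x(1) \<Phi>_inv[OF c(1) x(1)] \<Phi>_sub by auto
      then have "y \<in> {a<..<b}" using y(1) by auto
      then have w: "w \<in> {a<..<b}" using in_interval[OF cp(1)] unfolding w_def by blast
      have "w < b - f \<or> w = b - f" using f(2)[of "b - w"] hw w by (cases "w \<le> b - f") auto
      moreover have "cpow c (- s) x \<le> w"
        using y(1) PL_le_iff[OF LD(1)[OF cp(1)]] unfolding w_def by simp
      ultimately have "cpow c (- s) x < cpow c N0 x" using N0 by linarith
      then have "- s < N0" using mono_iff by blast
      moreover have "a + e < w" using e(2)[of w] hw w by (cases "w \<le> a + e") auto
      moreover have "w < cpow c (- s + 1) x"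
        using y(1) L_less_iff[OF cp(1), of "-s" y "c x"] unfolding w_def by (simp only: stepc) simp
      ultimately have "cpow c N1 x < cpow c (- s + 1) x" using N1 by linarith
      then have "N1 < - s + 1" using mono_iff by blast
      then show "s \<in> {- N0..1 - N1}" using \<open>- s < N0\<close> by auto
    qed
    then show ?thesis by (rule finite_subset) simp
  qed
  have der: "\<exists>g\<in>derived P L. \<forall>y\<in>{x..<c x}. g y = h y" if h: "h \<in> germ_kernel" for h
  proof -
    obtain e where e: "e > 0" "\<And>y. y \<le> a + e \<Longrightarrow> a \<le> y \<Longrightarrow> h y = y"
      using germ_kernel_near_a[OF h] by blast
    obtain N1 where N1: "cpow c N1 x < a + e" using acc_a[of "a + e"] e(1) by auto
    \<comment> \<open>The \<open>-M\<close>-th power of \<open>c\<close> moves the tile to the left of \<open>a + e\<close>, where \<open>h\<close> is the identity.\<close>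
    define M where "M = 1 - N1"
    let ?g = "h \<circ> cpow c M \<circ> inv_into UNIV h \<circ> inv_into UNIV (cpow c M)"
    have "?g y = h y" if y: "y \<in> {x..<c x}" for y
    proof -
      define w where "w = cpow c (- M) y"
      have "x \<in> {a<..<b}" "c x \<in> {a<..<b}" using x(1) \<Phi>_inv[OF c(1) x(1)] \<Phi>_sub by auto
      then have "y \<in> {a<..<b}" using y(1) by auto
      then have w: "w \<in> {a<..<b}" using in_interval[OF cp(1)] unfolding w_def by blast
      have "w < cpow c (- M + 1) x"
        using y(1) L_less_iff[OF cp(1), of "-M" y "c x"] unfolding w_def by (simp only: stepc) simp
      then have "w < a + e" using N1 by (simp add: M_def)
      then have "h w = w" using e(2) w by simp
      then have "inv_into UNIV h w = w" by (rule PL_inv_fixes[OF LD(1)[OF KL[OF h]]])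
      then show ?thesis using cancel(1)[of M y] by (simp add: cp(5) w_def)
    qed
    then show ?thesis
      using commutator_in_derived[OF L KL[OF h] cp(1)] by blast
  qed
  show thesis
  proof (rule that[of c x])
    show "h x = x \<and> h (c x) = c x" if "h \<in> germ_kernel" for h
      using K_fixes[OF that] x(1) \<Phi>_inv[OF c(1) x(1)] by blast
    show "x \<in> {a<..<b}" using x(1) \<Phi>_sub by blast
  qed (fact c xc decomp uniq tile fin der)+
qed

end

section \<open>Embeddings, derived length and isomorphism classes\<close>

abbreviation wreath_Z where "wreath_Z K \<equiv> wreath K integer_group"

text \<open>Wherever the class is concerned only embeddability matters, since the class is closed under subgroups.\<close>

definition embeds :: "('g, 'u) monoid_scheme \<Rightarrow> ('h, 'v) monoid_scheme \<Rightarrow> bool" where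
  "embeds G H \<longleftrightarrow> (\<exists>h\<in>hom G H. inj_on h (carrier G))"

lemma embedsI: "h \<in> hom G H \<Longrightarrow> inj_on h (carrier G) \<Longrightarrow> embeds G H"
  by (auto simp: embeds_def)

lemma iso_imp_embeds: "G \<cong> H \<Longrightarrow> embeds G H"
  by (auto simp: embeds_def is_iso_def iso_iff)

lemma embeds_trans:
  assumes "embeds G H" "embeds H K" shows "embeds G K"
proof -
  obtain f where f: "f \<in> hom G H" "inj_on f (carrier G)" using assms(1) by (auto simp: embeds_def)
  obtain g where g: "g \<in> hom H K" "inj_on g (carrier H)" using assms(2) by (auto simp: embeds_def)
  have "inj_on (g \<circ> f) (carrier G)"
    using f g by (intro comp_inj_on inj_on_subset[OF g(2)]) (auto simp: hom_def)
  then show ?thesis using hom_compose[OF f(1) g(1)] by (rule embedsI[rotated])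
qed

lemma embeds_iso_image:
  assumes "group G" "group H" "h \<in> hom G H" "inj_on h (carrier G)"
  shows "subgroup (h ` carrier G) H" "h \<in> iso G (H\<lparr>carrier := h ` carrier G\<rparr>)"
proof -
  interpret group_hom G H h
    using assms by (simp add: group_hom_def group_hom_axioms_def)
  show "subgroup (h ` carrier G) H" by (rule img_is_subgroup)
  show "h \<in> iso G (H\<lparr>carrier := h ` carrier G\<rparr>)"
    unfolding Group.iso_iff using assms by (simp add: hom_def)
qed

lemma derived_trivial_embeds:
  assumes "group G" "group H" "embeds G H" "(derived H ^^ d) (carrier H) = {\<one>\<^bsub>H\<^esub>}"
  shows "(derived G ^^ d) (carrier G) = {\<one>\<^bsub>G\<^esub>}"
proof -
  obtain h where h: "h \<in> hom G H" "inj_on h (carrier G)" using assms(3) by (auto simp: embeds_def)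
  interpret group_hom G H h
    using assms h by (simp add: group_hom_def group_hom_axioms_def)
  have sub: "subgroup ((derived G ^^ d) (carrier G)) G"
    by (rule G.exp_of_derived_is_subgroup) (rule G.subgroup_self)
  have "h ` (derived G ^^ d) (carrier G) = (derived H ^^ d) (h ` carrier G)"
    by (rule exp_of_derived_img[symmetric]) simp
  also have "\<dots> \<subseteq> (derived H ^^ d) (carrier H)"
    by (rule H.mono_exp_of_derived) auto
  finally have "h ` (derived G ^^ d) (carrier G) \<subseteq> {\<one>\<^bsub>H\<^esub>}" using assms(4) by simp
  then have "x = \<one>\<^bsub>G\<^esub>" if "x \<in> (derived G ^^ d) (carrier G)" for x
    using inj_onD[OF h(2), of x "\<one>\<^bsub>G\<^esub>"] that subgroup.mem_carrier[OF sub that] hom_one by auto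
  then show ?thesis using subgroup.one_closed[OF sub] by blast
qed

lemma embeds_carrier_subset:
  assumes "S \<subseteq> carrier G" shows "embeds (G\<lparr>carrier := S\<rparr>) G"
  by (rule embedsI[of "\<lambda>x. x"]) (use assms in \<open>auto simp: hom_def\<close>)

lemma solvable_embeds:
  assumes "group G" "group H" "embeds G H" "solvable H" shows "solvable G"
proof -
  obtain d where "(derived H ^^ d) (carrier H) = {\<one>\<^bsub>H\<^esub>}"
    using assms(4) group.solvable_iff_trivial_derived_seq[OF assms(2)] by blast
  then have "(derived G ^^ d) (carrier G) = {\<one>\<^bsub>G\<^esub>}"
    by (rule derived_trivial_embeds[OF assms(1-3)])
  then show ?thesis using group.solvable_iff_trivial_derived_seq[OF assms(1)] by blast
qed

lemma derived_length_le_iff: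
  assumes "group G"
  shows "derived_length G \<le> enat d \<longleftrightarrow> (derived G ^^ d) (carrier G) = {\<one>\<^bsub>G\<^esub>}"
proof
  interpret group G by fact
  assume "derived_length G \<le> enat d"
  then have "derived_length G < enat (Suc d)"
    by (metis enat_ord_simps(2) lessI order_le_less_trans)
  then obtain e where e: "(derived G ^^ e) (carrier G) = {\<one>\<^bsub>G\<^esub>}" "e \<le> d"
    unfolding derived_length_def by (auto simp: INF_less_iff)
  have "(derived G ^^ (e + k)) (carrier G) = {\<one>\<^bsub>G\<^esub>}" for k
  proof (induction k)
    case (Suc k)
    have "derived G {\<one>\<^bsub>G\<^esub>} \<subseteq> {\<one>\<^bsub>G\<^esub>}" by (rule derived_incl[OF subset_refl triv_subgroup])
    moreover have "\<one>\<^bsub>G\<^esub> \<in> derived G {\<one>\<^bsub>G\<^esub>}"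
      by (intro subgroup.one_closed derived_is_subgroup) simp
    ultimately show ?case using Suc by auto
  qed (simp add: e)
  from this[of "d - e"] show "(derived G ^^ d) (carrier G) = {\<one>\<^bsub>G\<^esub>}" using e(2) by simp
next
  assume "(derived G ^^ d) (carrier G) = {\<one>\<^bsub>G\<^esub>}"
  then show "derived_length G \<le> enat d"
    unfolding derived_length_def by (intro INF_lower) simp
qed

lemma iso_class_cong:
  assumes "group G" "G \<cong> H" shows "iso_class G = iso_class H"
proof -
  have "X \<cong> G \<longleftrightarrow> X \<cong> H" for X :: "'c monoid"
    using iso_trans[of X G H] iso_trans[of X H G] assms(2) group.iso_sym[OF assms] by blast
  then show ?thesis by (simp add: iso_class_def)
qed

text \<open>An infinite type contains a copy of every countable set, to which the group structure is transported.\<close>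

lemma iso_class_representative:
  assumes Y: "group Y" "countable (carrier Y)"
  shows "(iso_class Y :: 'a::infinite monoid set) \<in> iso_classes"
proof -
  obtain e :: "nat \<Rightarrow> 'a" where e: "inj e"
    using infinite_countable_subset[OF infinite_UNIV] by blast
  define h where "h = e \<circ> to_nat_on (carrier Y)"
  have inj: "inj_on h (carrier Y)"
    unfolding h_def using inj_on_to_nat_on[OF Y(2)] e by (intro comp_inj_on) (auto intro: inj_on_subset)
  define M :: "'a monoid" where
    "M = \<lparr>carrier = UNIV, monoid.mult = (\<lambda>a b. h (inv_into (carrier Y) h a \<otimes>\<^bsub>Y\<^esub> inv_into (carrier Y) h b)), one = h \<one>\<^bsub>Y\<^esub>\<rparr>"
  have hom: "h \<in> hom Y M"
    by (rule homI) (use inj in \<open>auto simp: M_def inv_into_f_f\<close>)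
  define Z where "Z = M\<lparr>carrier := h ` carrier Y, one := h \<one>\<^bsub>Y\<^esub>\<rparr>"
  have Z: "group Z" unfolding Z_def by (rule group.hom_imp_img_group[OF Y(1) hom])
  have "h \<in> iso Y Z"
    unfolding Group.iso_iff using hom inj by (auto simp: Z_def hom_def)
  then have "Y \<cong> Z" by (auto simp: is_iso_def)
  then have "(iso_class Y :: 'a monoid set) = iso_class Z" by (rule iso_class_cong[OF Y(1)])
  then show ?thesis using Z by (auto simp: iso_classes_def)
qed

text \<open>The families whose intersection is \<^term>\<open>class_R\<close>: by the empty direct sum
such a family contains the class of the trivial group.\<close>

locale closed_family =
  fixes C :: "'a monoid set set"
  assumes C_sub: "C \<subseteq> iso_classes"
    and C_subgroups: "closed_under_subgroups C"
    and C_wreath: "closed_under_wreath_Z C"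
    and C_sums: "closed_under_bounded_sums C"
begin

lemma representative:
  assumes "iso_class X \<in> C"
  obtains Z where "Z \<in> \<Union>C" "group Z" "Z \<cong> X"
proof -
  obtain G :: "'a monoid" where G: "group G" "iso_class X = (iso_class G :: 'a monoid set)"
    using assms C_sub unfolding iso_classes_def by blast
  have "G \<in> iso_class G" using G(1) by (simp add: iso_class_def iso_refl)
  then have *: "G \<in> iso_class X" using G(2) by simp
  show thesis
  proof (rule that[OF _ G(1)])
    show "G \<in> \<Union>C" using * assms by blast
    show "G \<cong> X" using * by (simp add: iso_class_def)
  qed
qed

text \<open>The family consists of groups on one type, whereas \<open>X\<close> and \<open>Y\<close> may live on others; a
representative of the class of \<open>X\<close> contains a copy of \<open>Y\<close>.\<close>

lemma embeds_mem:
  assumes "iso_class X \<in> C" "group Y" "embeds Y X"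
  shows "iso_class Y \<in> C"
proof -
  obtain Z where Z: "Z \<in> \<Union>C" "group Z" "Z \<cong> X"
    using assms(1) by (rule representative)
  have "embeds Y Z"
    by (rule embeds_trans[OF assms(3) iso_imp_embeds[OF group.iso_sym[OF Z(2,3)]]])
  then obtain h where h: "h \<in> hom Y Z" "inj_on h (carrier Y)" by (auto simp: embeds_def)
  note im = embeds_iso_image[OF assms(2) Z(2) h]
  have "iso_class (Z\<lparr>carrier := h ` carrier Y\<rparr>) \<in> C"
    using C_subgroups Z(1) im(1) unfolding closed_under_subgroups_def by blast
  moreover have "iso_class Y = (iso_class (Z\<lparr>carrier := h ` carrier Y\<rparr>) :: 'a monoid set)"
    by (rule iso_class_cong[OF assms(2)]) (use im(2) in \<open>auto simp: is_iso_def\<close>)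
  ultimately show ?thesis by simp
qed

lemma sum_mem:
  fixes G :: "nat \<Rightarrow> 'b monoid"
  assumes "\<And>i. i \<in> I \<Longrightarrow> group (G i)" "\<And>i. i \<in> I \<Longrightarrow> iso_class (G i) \<in> C"
    "\<And>i. i \<in> I \<Longrightarrow> (derived (G i) ^^ d) (carrier (G i)) = {\<one>\<^bsub>G i\<^esub>}"
    and Y: "group Y" "embeds Y (sum_group I G)"
  shows "iso_class Y \<in> C"
proof -
  have "\<exists>Z. Z \<in> \<Union>C \<and> group Z \<and> Z \<cong> G i" if "i \<in> I" for i
    by (rule representative[OF assms(2)[OF that]]) (intro exI conjI)
  then have "\<exists>Z. \<forall>i\<in>I. Z i \<in> \<Union>C \<and> group (Z i) \<and> Z i \<cong> G i" by (intro bchoice ballI)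
  then obtain Z where Z': "\<forall>i\<in>I. Z i \<in> \<Union>C \<and> group (Z i) \<and> Z i \<cong> G i" by (rule exE)
  note Z = bspec[OF Z']
  have "derived_length (Z i) \<le> enat d" if "i \<in> I" for i
    using derived_trivial_embeds[OF _ assms(1)[OF that] iso_imp_embeds assms(3)[OF that], of "Z i"] Z[OF that]
    by (simp add: derived_length_le_iff)
  moreover have "Z i \<in> \<Union>C" if "i \<in> I" for i using Z[OF that] by (rule conjunct1)
  ultimately have "(\<forall>i\<in>I. Z i \<in> \<Union>C) \<and> (\<exists>d. \<forall>i\<in>I. derived_length (Z i) \<le> enat d)"
    by (intro conjI ballI exI[of _ d])
  then have "iso_class (sum_group I Z) \<in> C"
    by (rule C_sums[unfolded closed_under_bounded_sums_def, THEN spec, THEN spec, THEN mp])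
  moreover have "sum_group I G \<cong> sum_group I Z"
  proof (rule iso_sum_groupI)
    fix i assume i: "i \<in> I"
    show "G i \<cong> Z i" using group.iso_sym[of "Z i" "G i"] Z[OF i] by simp
    show "group (G i)" by (rule assms(1)[OF i])
    show "group (Z i)" using Z[OF i] by simp
  qed
  ultimately show ?thesis
    by (rule embeds_mem[OF _ Y(1) embeds_trans[OF Y(2) iso_imp_embeds]])
qed

lemma trivial_mem:
  assumes "group Y" "carrier Y = {\<one>\<^bsub>Y\<^esub>}"
  shows "iso_class Y \<in> C"
proof (rule sum_mem)
  show "embeds Y (sum_group {} (\<lambda>_::nat. Y))"
    by (rule embedsI[of "\<lambda>_ _. undefined"]) (use assms in \<open>auto simp: hom_def carrier_sum_group\<close>)
qed (use assms in auto)

lemma wreath_representative: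
  assumes "group K" "iso_class K \<in> C"
  obtains Z :: "'a monoid" where "group Z" "embeds K Z" "iso_class (wreath_Z Z) \<in> C"
proof -
  obtain Z where Z: "Z \<in> \<Union>C" "group Z" "Z \<cong> K"
    using assms(2) by (rule representative)
  show thesis
  proof (rule that[OF Z(2)])
    show "embeds K Z" by (rule iso_imp_embeds[OF group.iso_sym[OF Z(2,3)]])
    show "iso_class (wreath_Z Z) \<in> C"
      using C_wreath Z(1) unfolding closed_under_wreath_Z_def by blast
  qed
qed

end

section \<open>Wreath products with the integers and bounded direct sums\<close>

lemma wreath_int_simps:
  assumes "group Z"
  shows "carrier (wreath_Z Z) = {b. (\<forall>s. b s \<in> carrier Z) \<and> finite {s. b s \<noteq> \<one>\<^bsub>Z\<^esub>}} \<times> UNIV"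
    "(b, t) \<otimes>\<^bsub>wreath_Z Z\<^esub> (b', t') = (\<lambda>s. b s \<otimes>\<^bsub>Z\<^esub> b' (s + t), t + t')"
    "\<one>\<^bsub>wreath_Z Z\<^esub> = (\<lambda>_. \<one>\<^bsub>Z\<^esub>, 0)"
  using assms by (auto simp: wreath_def semidirect_product_def carrier_sum_group)

lemma group_wreath_int:
  assumes "group K" shows "group (wreath_Z K)"
proof -
  interpret K: group K by fact
  note simps = wreath_int_simps[OF assms]
  have shift: "finite {s. b (s + t) \<noteq> \<one>\<^bsub>K\<^esub>}" if "finite {s. b s \<noteq> \<one>\<^bsub>K\<^esub>}" for b and t :: int
  proof (rule finite_subset)
    show "{s. b (s + t) \<noteq> \<one>\<^bsub>K\<^esub>} \<subseteq> (\<lambda>s. s - t) ` {s. b s \<noteq> \<one>\<^bsub>K\<^esub>}"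
      by (auto intro!: image_eqI[of _ _ "_ + t"])
  qed (use that in simp)
  show ?thesis
  proof (rule groupI)
    fix x y assume xy: "x \<in> carrier (wreath_Z K)" "y \<in> carrier (wreath_Z K)"
    obtain b t c u where x: "x = (b, t)" and y: "y = (c, u)" by (cases x, cases y) auto
    have b: "\<And>s. b s \<in> carrier K" "finite {s. b s \<noteq> \<one>\<^bsub>K\<^esub>}"
      and c: "\<And>s. c s \<in> carrier K" "finite {s. c s \<noteq> \<one>\<^bsub>K\<^esub>}"
      using xy unfolding x y simps by auto
    have "finite {s. b s \<otimes>\<^bsub>K\<^esub> c (s + t) \<noteq> \<one>\<^bsub>K\<^esub>}"
      by (rule finite_subset[OF _ finite_UnI[OF b(2) shift[OF c(2), of t]]]) (use b(1) c(1) in auto)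
    then show "x \<otimes>\<^bsub>wreath_Z K\<^esub> y \<in> carrier (wreath_Z K)"
      unfolding x y simps using b c by auto
  next
    show "\<one>\<^bsub>wreath_Z K\<^esub> \<in> carrier (wreath_Z K)" unfolding simps by simp
  next
    fix x y z
    assume "x \<in> carrier (wreath_Z K)" "y \<in> carrier (wreath_Z K)" "z \<in> carrier (wreath_Z K)"
    then show "x \<otimes>\<^bsub>wreath_Z K\<^esub> y \<otimes>\<^bsub>wreath_Z K\<^esub> z
        = x \<otimes>\<^bsub>wreath_Z K\<^esub> (y \<otimes>\<^bsub>wreath_Z K\<^esub> z)"
      by (cases x, cases y, cases z) (auto simp: simps K.m_assoc add.assoc)
  next
    fix x assume "x \<in> carrier (wreath_Z K)"
    then show "\<one>\<^bsub>wreath_Z K\<^esub> \<otimes>\<^bsub>wreath_Z K\<^esub> x = x"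
      by (cases x) (auto simp: simps)
  next
    fix x assume x: "x \<in> carrier (wreath_Z K)"
    obtain b t where bt: "x = (b, t)" by (cases x) auto
    have b: "\<And>s. b s \<in> carrier K" "finite {s. b s \<noteq> \<one>\<^bsub>K\<^esub>}"
      using x unfolding bt simps by auto
    show "\<exists>y\<in>carrier (wreath_Z K). y \<otimes>\<^bsub>wreath_Z K\<^esub> x = \<one>\<^bsub>wreath_Z K\<^esub>"
    proof
      show "(\<lambda>s. inv\<^bsub>K\<^esub> b (s + - t), - t) \<otimes>\<^bsub>wreath_Z K\<^esub> x = \<one>\<^bsub>wreath_Z K\<^esub>"
        unfolding bt simps using b(1) by simp
      show "(\<lambda>s. inv\<^bsub>K\<^esub> b (s + - t), - t) \<in> carrier (wreath_Z K)"
        unfolding simps using b shift[OF b(2), of "- t"] by (simp add: K.inv_eq_1_iff)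
    qed
  qed
qed

text \<open>The projection to a summand maps the derived series into that of the summand. A common bound \<open>d\<close> is what makes
an infinite direct sum solvable.\<close>

lemma derived_sum_group_trivial:
  assumes G: "\<And>i. i \<in> I \<Longrightarrow> group (G i)"
    and d: "\<And>i. i \<in> I \<Longrightarrow> (derived (G i) ^^ d) (carrier (G i)) = {\<one>\<^bsub>G i\<^esub>}"
  shows "(derived (sum_group I G) ^^ d) (carrier (sum_group I G)) = {\<one>\<^bsub>sum_group I G\<^esub>}"
proof -
  let ?S = "sum_group I G" and ?D = "(derived (sum_group I G) ^^ d) (carrier (sum_group I G))"
  interpret S: group ?S by (rule sum_group) (rule G)
  note car = carrier_sum_group[of I G, OF G]
  have sub: "subgroup ?D ?S" by (rule S.exp_of_derived_is_subgroup) (rule S.subgroup_self)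
  have comp: "x i = \<one>\<^bsub>G i\<^esub>" if x: "x \<in> ?D" and i: "i \<in> I" for x i
  proof -
    interpret Gi: group "G i" by (rule G[OF i])
    have "(\<lambda>x. x i) \<in> hom ?S (G i)"
      using i by (auto simp: hom_def car)
    then interpret group_hom ?S "G i" "\<lambda>x. x i"
      by (simp add: group_hom_def group_hom_axioms_def S.group_axioms Gi.group_axioms)
    have "(\<lambda>x. x i) ` ?D = (derived (G i) ^^ d) ((\<lambda>x. x i) ` carrier ?S)"
      by (rule exp_of_derived_img[symmetric]) simp
    also have "\<dots> \<subseteq> (derived (G i) ^^ d) (carrier (G i))"
      by (rule Gi.mono_exp_of_derived) auto
    finally show ?thesis using d[OF i] x by blast
  qed
  have "x = \<one>\<^bsub>?S\<^esub>" if x: "x \<in> ?D" for x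
  proof -
    have "x \<in> carrier ?S" using subgroup.mem_carrier[OF sub x] .
    then have "x \<in> extensional I" by (simp add: car PiE_def)
    then show ?thesis using comp[OF x] by (auto simp: fun_eq_iff restrict_def extensional_def)
  qed
  then show ?thesis using subgroup.one_closed[OF sub] by blast
qed

text \<open>The wreath product is an extension of a direct sum of copies of \<open>K\<close> by the integers.\<close>

lemma solvable_wreath_int:
  assumes "group K" "solvable K" shows "solvable (wreath_Z K)"
proof -
  interpret K: group K by fact
  let ?B = "sum_group (UNIV :: int set) (\<lambda>_. K)"
  note simps = wreath_int_simps[OF assms(1)]
  note car = carrier_sum_group[of UNIV "\<lambda>_. K", OF assms(1)]
  have B: "group ?B" by (rule sum_group) (rule assms(1))
  obtain d where d: "(derived K ^^ d) (carrier K) = {\<one>\<^bsub>K\<^esub>}"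
    using assms(2) K.solvable_iff_trivial_derived_seq by blast
  have "solvable ?B"
    unfolding group.solvable_iff_trivial_derived_seq[OF B]
    by (rule exI[of _ d], rule derived_sum_group_trivial) (rule assms(1) d)+
  moreover have "solvable integer_group"
    using comm_group.derived_eq_singleton[OF abelian_integer_group subset_refl]
    unfolding group.solvable_iff_trivial_derived_seq[OF group_integer_group]
    by (intro exI[of _ 1]) simp
  moreover have "group_hom ?B (wreath_Z K) (\<lambda>b. (b, 0))"
    using B group_wreath_int[OF assms(1)]
    by (auto simp: group_hom_def group_hom_axioms_def hom_def simps car)
  moreover have "group_hom (wreath_Z K) integer_group snd"
    using group_wreath_int[OF assms(1)]
    by (auto simp: group_hom_def group_hom_axioms_def hom_def simps)
  ultimately show ?thesis
  proof (rule solvable_condition[rotated 4])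
    show "snd ` carrier (wreath_Z K) = carrier integer_group"
      unfolding simps by (force intro!: image_eqI[of _ snd "(\<lambda>_. \<one>\<^bsub>K\<^esub>, _)"])
    show "kernel (wreath_Z K) integer_group snd \<subseteq> (\<lambda>b. (b, 0)) ` carrier ?B"
      by (auto simp: kernel_def simps car)
  qed
qed

section \<open>A single orbital embeds into a wreath product\<close>

lemma (in group) exp_derived_consistent:
  assumes "K \<subseteq> H" "subgroup H G"
  shows "(derived (G\<lparr>carrier := H\<rparr>) ^^ n) K = (derived G ^^ n) K"
proof (induction n)
  case (Suc n)
  have "(derived G ^^ n) K \<subseteq> H"
    by (induction n) (use assms(1) derived_incl[OF _ assms(2)] in auto)
  then show ?case using Suc derived_consistent[OF _ assms(2)] by simp
qed simp

text \<open>Restriction to \<open>[s,t)\<close>, continued by the identity; a homomorphism on maps that fix both ends. The new breakpoints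
\<open>s\<close> and \<open>t\<close> are arbitrary reals, which is the reason for working without a condition on breakpoints.\<close>

definition cut :: "real \<Rightarrow> real \<Rightarrow> (real \<Rightarrow> real) \<Rightarrow> real \<Rightarrow> real" where
  "cut s t h y = (if s \<le> y \<and> y < t then h y else y)"

text \<open>At an end of the interval the side decides which case occurs. The information on \<open>x\<close> itself ensures that a map cut
to the interval has the right value at \<open>x\<close> also there, since the ends are fixed.\<close>

lemma eventually_in_or_out:
  fixes s t x \<sigma> :: real
  assumes "\<sigma> \<in> {1,-1}"
  obtains "\<forall>\<^sub>F u in at_right 0. s \<le> x + \<sigma> * u \<and> x + \<sigma> * u < t" "s \<le> x \<and> x \<le> t"
  | "\<forall>\<^sub>F u in at_right 0. \<not> (s \<le> x + \<sigma> * u \<and> x + \<sigma> * u < t)" "x \<notin> {s<..<t}"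
proof -
  have ev: "\<forall>\<^sub>F u in at_right 0. Q u" if "e > 0" "\<And>u. 0 < u \<Longrightarrow> u < e \<Longrightarrow> Q u" for e :: real and Q
    using that by (auto simp: eventually_at_right_field)
  consider "\<sigma> = 1" "s \<le> x" "x < t" | "\<sigma> = 1" "x < s" | "\<sigma> = 1" "t \<le> x"
    | "\<sigma> = -1" "s < x" "x \<le> t" | "\<sigma> = -1" "x \<le> s" | "\<sigma> = -1" "t < x"
    using assms by fastforce
  then show thesis
  proof cases
    case 1 show ?thesis by (rule that(1), rule ev[of "t - x"]) (use 1 in auto)
  next
    case 2 show ?thesis by (rule that(2), rule ev[of "s - x"]) (use 2 in auto)
  next
    case 3 show ?thesis by (rule that(2), rule ev[of 1]) (use 3 in auto)
  next
    case 4 show ?thesis by (rule that(1), rule ev[of "x - s"]) (use 4 in auto)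
  next
    case 5 show ?thesis by (rule that(2), rule ev[of 1]) (use 5 in auto)
  next
    case 6 show ?thesis by (rule that(2), rule ev[of "x - t"]) (use 6 in auto)
  qed
qed

context slopes begin

lemma in_cut_iff:
  assumes "h \<in> carrier P" "h s = s" "h t = t"
  shows "s \<le> h y \<longleftrightarrow> s \<le> y" "h y < t \<longleftrightarrow> y < t"
  using PL_le_iff[OF assms(1), of s y] PL_less_iff[OF assms(1), of y t] assms by auto

lemma cut_comp:
  assumes "g \<in> carrier P" "g s = s" "g t = t"
  shows "cut s t (h \<circ> g) = cut s t h \<circ> cut s t g"
  using in_cut_iff[OF assms] by (auto simp: cut_def fun_eq_iff)

lemma cut_id: "cut s t id = id"
  by (auto simp: cut_def fun_eq_iff)

lemma cut_PL:
  assumes h: "h \<in> carrier P" "h s = s" "h t = t"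
  shows "cut s t h \<in> carrier P"
proof (rule PL_I)
  show "strict_mono (cut s t h)"
  proof (rule strict_monoI)
    fix x y :: real assume "x < y"
    then show "cut s t h x < cut s t h y"
      using PL_less_iff[OF h(1), of x y] in_cut_iff[OF h, of x] in_cut_iff[OF h, of y]
      by (auto simp: cut_def)
  qed
  have "cut s t h (cut s t (inv_into UNIV h) y) = y" for y
  proof -
    have "inv_into UNIV h s = s" "inv_into UNIV h t = t"
      using PL_inv_fixes[OF h(1)] h by auto
    then have "(cut s t h \<circ> cut s t (inv_into UNIV h)) = cut s t (h \<circ> inv_into UNIV h)"
      using cut_comp[OF U.PL_inv[OF h(1)]] by simp
    also have "h \<circ> inv_into UNIV h = id" using h(1) by (auto simp: fun_eq_iff)
    finally show ?thesis by (metis cut_id comp_apply id_apply)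
  qed
  then show "surj (cut s t h)" by (metis surjI)
  show "cut s t h x = x" if "x \<notin> {0..1}" for x
    using PL_D(5)[OF h(1) that] by (simp add: cut_def)
  show "\<exists>k. affine_germ r UNIV (cut s t h) x \<sigma> k" if \<sigma>: "\<sigma> \<in> {1,-1}" for x \<sigma>
    using \<sigma>
  proof (cases rule: eventually_in_or_out[of \<sigma> s x t])
    case 1
    obtain k where k: "has_slope r h x \<sigma> k" using PL_D(6)[OF h(1) \<sigma>] by blast
    have "has_slope r (cut s t h) x \<sigma> k"
    proof (rule has_slope_cong[OF k])
      show "\<forall>\<^sub>F u in at_right 0. h (x + \<sigma> * u) = cut s t h (x + \<sigma> * u)"
        using 1(1) by eventually_elim (simp add: cut_def)
      show "h x = cut s t h x" using 1(2) h(3) by (auto simp: cut_def)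
    qed
    then show ?thesis by blast
  next
    case 2
    have "has_slope r id x \<sigma> 0" by (simp add: has_slope_def)
    then have "has_slope r (cut s t h) x \<sigma> 0"
    proof (rule has_slope_cong)
      show "\<forall>\<^sub>F u in at_right 0. id (x + \<sigma> * u) = cut s t h (x + \<sigma> * u)"
        using 2(1) by eventually_elim (auto simp: cut_def)
      show "id x = cut s t h x" using 2(2) h(2) by (auto simp: cut_def)
    qed
    then show ?thesis by blast
  qed
qed simp

lemma cut_group_hom:
  assumes "subgroup K P" "\<And>h. h \<in> K \<Longrightarrow> h s = s" "\<And>h. h \<in> K \<Longrightarrow> h t = t"
  shows "group_hom (PL_sub K) P (cut s t)"
proof -
  have "cut s t \<in> hom (PL_sub K) P"
    using assms subgroup_PL_D(1)[OF assms(1)] cut_PL cut_comp by (auto simp: hom_def)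
  then show ?thesis
    by (simp add: group_hom_def group_hom_axioms_def P.subgroup_imp_group[OF assms(1)] P.group_axioms)
qed

lemma cut_image:
  assumes "subgroup K P" "\<And>h. h \<in> K \<Longrightarrow> h s = s" "\<And>h. h \<in> K \<Longrightarrow> h t = t"
  shows "subgroup (cut s t ` K) P"
    "M \<subseteq> K \<Longrightarrow> (derived P ^^ d) (cut s t ` M) = cut s t ` ((derived P ^^ d) M)"
proof -
  interpret group_hom "PL_sub K" P "cut s t"
    using cut_group_hom[of K s t] assms by blast
  show "subgroup (cut s t ` K) P" using img_is_subgroup by simp
  show "(derived P ^^ d) (cut s t ` M) = cut s t ` ((derived P ^^ d) M)" if "M \<subseteq> K"
    using exp_of_derived_img[of M d] that P.exp_derived_consistent[OF that assms(1)] by simp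
qed

text \<open>Write \<open>g = h c\<^sup>t\<close> with \<open>h\<close> in the kernel of the germ. The embedding sends \<open>g\<close> to \<open>t\<close> together with the
family of restrictions of \<open>c\<^sup>s h c\<^sup>-\<^sup>s\<close> to the tile \<open>[x, c x)\<close>, that is, of \<open>h\<close> to the
tile \<open>c\<^sup>-\<^sup>s [x, c x)\<close>. The map \<open>\<phi> s g\<close> below is \<open>c\<^sup>s h c\<^sup>-\<^sup>s\<close> written in terms of \<open>g\<close>.\<close>

lemma one_orbital_mem:
  fixes C :: "'a monoid set set"
  assumes C: "closed_family C" and act: "interval_action r L a b"
    and nofix: "fixset L a b = {}" and out: "\<And>g y. g \<in> L \<Longrightarrow> y \<notin> {a<..<b} \<Longrightarrow> g y = y"
    and solv: "(derived P ^^ Suc d) L = {id}"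
    and IH: "\<And>K. subgroup K P \<Longrightarrow> (derived P ^^ d) K = {id} \<Longrightarrow> iso_class (PL_sub K) \<in> C"
  shows "iso_class (PL_sub L) \<in> C"
proof -
  interpret C: closed_family C by fact
  interpret interval_action r L a b by fact
  define H where "H = germ_kernel"
  obtain c x where c: "c \<in> L" and x: "x \<in> {a<..<b}" and xc: "x < c x"
    and H_fix: "\<And>h. h \<in> H \<Longrightarrow> h x = x \<and> h (c x) = c x"
    and decomp: "\<And>g. g \<in> L \<Longrightarrow> \<exists>t. g \<circ> cpow c (- t) \<in> H"
    and uniq: "\<And>t. cpow c t \<in> H \<Longrightarrow> t = 0"
    and tile: "\<And>y. y \<in> {a<..<b} \<Longrightarrow> \<exists>s. cpow c s x \<le> y \<and> y < cpow c (s + 1) x"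
    and fin: "\<And>h. h \<in> H \<Longrightarrow> finite {s. \<exists>y\<in>{x..<c x}. (cpow c s \<circ> h \<circ> cpow c (- s)) y \<noteq> y}"
    and der: "\<And>h. h \<in> H \<Longrightarrow> \<exists>g\<in>derived P L. \<forall>y\<in>{x..<c x}. g y = h y"
    by (rule orbital_structure[OF nofix solv, folded H_def]) (rule that; assumption)
  note cp = cpow_simps[OF c]
  have merge: "cpow c s (cpow c t y) = cpow c (s + t) y" for s t y using cp(2)[of s t] by simp
  have cp0: "cpow c 0 y = y" for y using cp(3) by simp
  have H_iff: "h \<in> H \<longleftrightarrow> h \<in> L \<and> germ h = 0" for h by (simp add: H_def germ_kernel_def)
  have H: "subgroup H P" unfolding H_def by (rule subgroup_germ_kernel)
  let ?cut = "cut x (c x)"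
  define K where "K = ?cut ` H"
  note ci = cut_image[OF H, of x "c x"]
  have K: "subgroup K P" unfolding K_def by (rule ci) (use H_fix in auto)
  have "K = ?cut ` derived P L"
  proof
    show "?cut ` derived P L \<subseteq> K" using derived_subset_germ_kernel by (auto simp: K_def H_def)
    show "K \<subseteq> ?cut ` derived P L"
    proof
      fix k assume "k \<in> K"
      then obtain h where h: "h \<in> H" "k = ?cut h" by (auto simp: K_def)
      obtain g where g: "g \<in> derived P L" "\<forall>y\<in>{x..<c x}. g y = h y" using der[OF h(1)] by blast
      then have "k = ?cut g" by (auto simp: h(2) cut_def fun_eq_iff)
      then show "k \<in> ?cut ` derived P L" using g(1) by blast
    qed
  qed
  then have "(derived P ^^ d) K = ?cut ` ((derived P ^^ d) (derived P L))"
    using ci(2)[of "derived P L" d] H_fix derived_subset_germ_kernel by (auto simp: H_def)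
  also have "\<dots> = {id}"
    using solv by (simp add: funpow_swap1 cut_id)
  finally have "iso_class (PL_sub K) \<in> C" by (rule IH[OF K])
  then obtain Z :: "'a monoid" where Z: "group Z" "embeds (PL_sub K) Z" "iso_class (wreath_Z Z) \<in> C"
    using C.wreath_representative[OF P.subgroup_imp_group[OF K]] by blast
  obtain \<theta> where \<theta>: "\<theta> \<in> hom (PL_sub K) Z" "inj_on \<theta> K"
    using Z(2) by (auto simp: embeds_def)
  have \<theta>_id: "\<theta> id = \<one>\<^bsub>Z\<^esub>"
    using hom_one[OF \<theta>(1) P.subgroup_imp_group[OF K] Z(1)] by simp
  have m0: "germ c \<noteq> 0" using uniq[of 1] c by (auto simp: H_iff cp(4))
  define tt where "tt g = germ g div germ c" for g
  have tt: "germ g = tt g * germ c" if "g \<in> L" for g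
  proof -
    obtain t where t: "g \<circ> cpow c (- t) \<in> H" using decomp[OF \<open>g \<in> L\<close>] by blast
    then have "germ g = t * germ c"
      using germ_comp[OF \<open>g \<in> L\<close> cp(1), of "-t"] germ_cpow[OF c] by (simp add: H_iff)
    then show ?thesis unfolding tt_def using m0 by simp
  qed
  have tt_comp: "tt (f \<circ> g) = tt f + tt g" if "f \<in> L" "g \<in> L" for f g
  proof -
    have "tt (f \<circ> g) * germ c = (tt f + tt g) * germ c"
      using tt[OF LD(2)[OF that]] germ_comp[OF that] tt that by (simp add: distrib_right)
    then show ?thesis using m0 by simp
  qed
  define \<phi> where "\<phi> s g = cpow c s \<circ> g \<circ> cpow c (- (tt g + s))" for s g
  have \<phi>_H: "\<phi> s g \<in> H" if g: "g \<in> L" for s g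
  proof -
    have "germ (\<phi> s g) = germ (cpow c s) + germ g + germ (cpow c (- (tt g + s)))"
      unfolding \<phi>_def using germ_comp[OF LD(2)[OF cp(1) g] cp(1)] germ_comp[OF cp(1) g] by simp
    also have "\<dots> = 0" using tt[OF g] germ_cpow[OF c] by (simp add: algebra_simps)
    finally show ?thesis unfolding H_iff \<phi>_def using g cp(1) by (auto intro!: LD(2))
  qed
  have \<phi>_comp: "\<phi> s (f \<circ> g) = \<phi> s f \<circ> \<phi> (s + tt f) g" if "f \<in> L" "g \<in> L" for s f g
    unfolding \<phi>_def tt_comp[OF that] by (simp add: fun_eq_iff merge cp0 algebra_simps)
  define \<Psi> where "\<Psi> g = ((\<lambda>s. \<theta> (?cut (\<phi> s g))), tt g)" for g
  have cutK: "?cut (\<phi> s g) \<in> K" if "g \<in> L" for s g using \<phi>_H[OF that] by (auto simp: K_def)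
  have "\<Psi> \<in> hom (PL_sub L) (wreath_Z Z)"
  proof (rule homI)
    fix g assume "g \<in> carrier (PL_sub L)"
    then have g: "g \<in> L" by simp
    have hH: "g \<circ> cpow c (- tt g) \<in> H" using \<phi>_H[OF g, of 0] by (simp add: \<phi>_def cp(3))
    have "{s. \<theta> (?cut (\<phi> s g)) \<noteq> \<one>\<^bsub>Z\<^esub>}
        \<subseteq> {s. \<exists>y\<in>{x..<c x}. (cpow c s \<circ> (g \<circ> cpow c (- tt g)) \<circ> cpow c (- s)) y \<noteq> y}"
    proof
      fix s assume s: "s \<in> {s. \<theta> (?cut (\<phi> s g)) \<noteq> \<one>\<^bsub>Z\<^esub>}"
      then have "?cut (\<phi> s g) \<noteq> id" using \<theta>_id by auto
      then obtain y where "y \<in> {x..<c x}" "\<phi> s g y \<noteq> y" by (auto simp: fun_eq_iff cut_def split: if_splits)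
      moreover have "\<phi> s g y = (cpow c s \<circ> (g \<circ> cpow c (- tt g)) \<circ> cpow c (- s)) y"
        by (simp add: \<phi>_def merge)
      ultimately show "s \<in> {s. \<exists>y\<in>{x..<c x}. (cpow c s \<circ> (g \<circ> cpow c (- tt g)) \<circ> cpow c (- s)) y \<noteq> y}" by auto
    qed
    then have "finite {s. \<theta> (?cut (\<phi> s g)) \<noteq> \<one>\<^bsub>Z\<^esub>}" by (rule finite_subset) (rule fin[OF hH])
    moreover have "\<theta> (?cut (\<phi> s g)) \<in> carrier Z" for s
      using \<theta>(1) cutK[OF g] by (auto simp: hom_def)
    ultimately show "\<Psi> g \<in> carrier (wreath_Z Z)"
      by (simp add: wreath_int_simps[OF Z(1)] \<Psi>_def)
  next
    fix f g assume "f \<in> carrier (PL_sub L)" "g \<in> carrier (PL_sub L)"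
    then have fg: "f \<in> L" "g \<in> L" by simp_all
    have "\<theta> (?cut (\<phi> s (f \<circ> g))) = \<theta> (?cut (\<phi> s f)) \<otimes>\<^bsub>Z\<^esub> \<theta> (?cut (\<phi> (s + tt f) g))" for s
    proof -
      have "?cut (\<phi> s (f \<circ> g)) = ?cut (\<phi> s f) \<circ> ?cut (\<phi> (s + tt f) g)"
        unfolding \<phi>_comp[OF fg]
        by (rule cut_comp) (use H_fix \<phi>_H[OF fg(2)] subgroup_PL_D(1)[OF H] in auto)
      then show ?thesis using \<theta>(1) cutK fg by (simp add: hom_def)
    qed
    then show "\<Psi> (f \<otimes>\<^bsub>PL_sub L\<^esub> g) = \<Psi> f \<otimes>\<^bsub>wreath_Z Z\<^esub> \<Psi> g"
      by (simp add: \<Psi>_def wreath_int_simps[OF Z(1)] tt_comp[OF fg])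
  qed
  moreover have "inj_on \<Psi> L"
  proof (rule inj_onI)
    fix f g assume f: "f \<in> L" and g: "g \<in> L" and eq: "\<Psi> f = \<Psi> g"
    have t: "tt f = tt g" using eq by (simp add: \<Psi>_def)
    have "\<theta> (?cut (\<phi> s f)) = \<theta> (?cut (\<phi> s g))" for s using eq by (simp add: \<Psi>_def fun_eq_iff)
    then have ceq: "?cut (\<phi> s f) = ?cut (\<phi> s g)" for s
      using inj_onD[OF \<theta>(2) _ cutK[OF f] cutK[OF g]] by blast
    show "f = g"
    proof
      fix y
      show "f y = g y"
      proof (cases "y \<in> {a<..<b}")
        case False
        then show ?thesis using out[OF f False] out[OF g False] by simp
      next
        case True
        define w where "w = cpow c (tt g) y"
        have "w \<in> {a<..<b}" unfolding w_def by (rule in_interval[OF cp(1) True])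
        then obtain s where s: "cpow c s x \<le> w" "w < cpow c (s + 1) x" using tile by blast
        define y0 where "y0 = cpow c (- s) w"
        have "cpow c (- s) (cpow c s x) \<le> y0"
          using s(1) PL_le_iff[OF LD(1)[OF cp(1)]] unfolding y0_def by blast
        moreover have "y0 < cpow c (- s) (cpow c (s + 1) x)"
          using s(2) L_less_iff[OF cp(1)] unfolding y0_def by blast
        ultimately have y0: "x \<le> y0" "y0 < c x" by (simp_all add: merge cp0 cp(4))
        have "\<phi> (- s) f y0 = \<phi> (- s) g y0"
          using fun_cong[OF ceq[of "- s"], of y0] y0 by (simp add: cut_def)
        then have "cpow c (- s) (f y) = cpow c (- s) (g y)"
          by (simp add: \<phi>_def y0_def w_def merge t cp0)
        then show ?thesis using PL_eq_iff[OF LD(1)[OF cp(1)]] by blast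
      qed
    qed
  qed
  ultimately have "embeds (PL_sub L) (wreath_Z Z)"
    by (intro embedsI) auto
  then show ?thesis
    by (rule C.embeds_mem[OF Z(3) P.subgroup_imp_group[OF L]])
qed

end

section \<open>Splitting a group into its orbitals\<close>

text \<open>The ends of the component of a bounded open set that contains a given point.\<close>

definition left_end :: "real set \<Rightarrow> real \<Rightarrow> real" where "left_end U x = Sup {y. y \<le> x \<and> y \<notin> U}"
definition right_end :: "real set \<Rightarrow> real \<Rightarrow> real" where "right_end U x = Inf {y. x \<le> y \<and> y \<notin> U}"

locale open_in_unit =
  fixes U :: "real set"
  assumes closed_compl: "closed (- U)" and U_unit: "U \<subseteq> {0..1}"
begin

lemma left_end_props:
  assumes x: "x \<in> U"
  shows "left_end U x \<notin> U" "left_end U x < x" "\<And>y. left_end U x < y \<Longrightarrow> y \<le> x \<Longrightarrow> y \<in> U"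
proof -
  let ?S = "{y. y \<le> x \<and> y \<notin> U}"
  have ne: "?S \<noteq> {}" using U_unit x by (auto intro!: exI[of _ "-1"])
  have bdd: "bdd_above ?S" by (auto intro!: bdd_aboveI[of _ x])
  have "?S = {..x} \<inter> (- U)" by auto
  then have "closed ?S" using closed_compl by (auto intro!: closed_Int)
  then have mem: "left_end U x \<in> ?S" unfolding left_end_def using closed_contains_Sup[OF ne bdd] by blast
  then show "left_end U x \<notin> U" by blast
  then show "left_end U x < x" using mem x by (metis (no_types, lifting) mem_Collect_eq order_le_less)
  show "y \<in> U" if "left_end U x < y" "y \<le> x" for y
    using cSup_upper[OF _ bdd, of y] that unfolding left_end_def by fastforce
qed

lemma right_end_props:
  assumes x: "x \<in> U"
  shows "right_end U x \<notin> U" "x < right_end U x" "\<And>y. x \<le> y \<Longrightarrow> y < right_end U x \<Longrightarrow> y \<in> U"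
proof -
  let ?S = "{y. x \<le> y \<and> y \<notin> U}"
  have ne: "?S \<noteq> {}" using U_unit x by (auto intro!: exI[of _ "2"])
  have bdd: "bdd_below ?S" by (auto intro!: bdd_belowI[of _ x])
  have "?S = {x..} \<inter> (- U)" by auto
  then have "closed ?S" using closed_compl by (auto intro!: closed_Int)
  then have mem: "right_end U x \<in> ?S" unfolding right_end_def using closed_contains_Inf[OF ne bdd] by blast
  then show "right_end U x \<notin> U" by blast
  then show "x < right_end U x" using mem x by (metis (no_types, lifting) mem_Collect_eq order_le_less)
  show "y \<in> U" if "x \<le> y" "y < right_end U x" for y
    using cInf_lower[OF _ bdd, of y] that unfolding right_end_def by fastforce
qed

lemma component_subset: "x \<in> U \<Longrightarrow> {left_end U x<..<right_end U x} \<subseteq> U"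
proof
  fix y assume "x \<in> U" "y \<in> {left_end U x<..<right_end U x}"
  then show "y \<in> U" using left_end_props(3)[of x y] right_end_props(3)[of x y] by (cases "y \<le> x") auto
qed

lemma component_eq:
  assumes x: "x \<in> U" and y: "y \<in> {left_end U x<..<right_end U x}"
  shows "left_end U y = left_end U x" "right_end U y = right_end U x"
proof -
  have yU: "y \<in> U" using component_subset[OF x] y by blast
  have "\<not> left_end U y < left_end U x"
    using left_end_props(3)[OF yU, of "left_end U x"] y left_end_props(1)[OF x] by auto
  moreover have "\<not> left_end U x < left_end U y"
    using component_subset[OF x] left_end_props(1,2)[OF yU] y by (metis greaterThanLessThan_iff order.strict_trans subset_iff)
  ultimately show "left_end U y = left_end U x" by linarith
  have "\<not> right_end U x < right_end U y"
    using right_end_props(3)[OF yU, of "right_end U x"] y right_end_props(1)[OF x] by auto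
  moreover have "\<not> right_end U y < right_end U x"
    using component_subset[OF x] right_end_props(1,2)[OF yU] y by (metis greaterThanLessThan_iff order.strict_trans subset_iff)
  ultimately show "right_end U y = right_end U x" by linarith
qed

lemma separated:
  assumes "x \<in> U" "y \<in> U" "x < y" "left_end U x \<noteq> left_end U y"
  shows "\<exists>w. x < w \<and> w < y \<and> w \<notin> U"
proof (intro exI conjI)
  show "x < right_end U x" "right_end U x \<notin> U" using right_end_props[OF assms(1)] by auto
  show "right_end U x < y"
  proof (rule ccontr)
    assume "\<not> ?thesis"
    then have "y < right_end U x" using right_end_props(1)[OF assms(1)] assms(2) by (cases "right_end U x = y") auto
    then show False using component_eq(1)[OF assms(1), of y] left_end_props(2)[OF assms(1)] assms(3,4) by auto
  qed
qed

end

context slopes begin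

text \<open>Infinitely many moved points \<open>p i\<close> in different components would accumulate somewhere. Between any two of them lies
an end of a component, which is fixed, so near the accumulation point moved and fixed points would
alternate on one side, against \<open>fix_dichotomy\<close>.\<close>

lemma support_meets_finitely_many:
  assumes U: "open_in_unit U" and g: "g \<in> carrier P" "\<And>y. y \<notin> U \<Longrightarrow> g y = y"
    and p: "\<And>i. i \<in> J \<Longrightarrow> p i \<in> U \<and> g (p i) \<noteq> p i"
    and inj: "\<And>i j. i \<in> J \<Longrightarrow> j \<in> J \<Longrightarrow> i \<noteq> j \<Longrightarrow> left_end U (p i) \<noteq> left_end U (p j)"
  shows "finite J"
proof (rule ccontr)
  interpret open_in_unit U by fact
  assume inf: "infinite J"
  have "inj_on p J" using inj by (metis inj_onI)
  then have "infinite (p ` J)" using inf finite_imageD by blast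
  moreover have "p ` J \<subseteq> {0..1}" using p U_unit by blast
  ultimately obtain z where z: "z islimpt (p ` J)"
    using Heine_Borel_imp_Bolzano_Weierstrass[of "{0..1::real}" "p ` J"] by auto
  have side: "\<exists>e>0. \<forall>t u. 0 < t \<and> t < u \<and> u < e \<longrightarrow> \<not> (z + \<sigma> * t \<in> p ` J \<and> z + \<sigma> * u \<in> p ` J)"
    if \<sigma>: "\<sigma> \<in> {1,-1}" for \<sigma>
    using fix_dichotomy[OF g(1) \<sigma>, of z]
  proof
    assume "\<forall>\<^sub>F t in at_right 0. g (z + \<sigma> * t) = z + \<sigma> * t"
    then obtain e where e: "e > 0" "\<And>t. 0 < t \<Longrightarrow> t < e \<Longrightarrow> g (z + \<sigma> * t) = z + \<sigma> * t"
      by (auto simp: eventually_at_right_field)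
    have "z + \<sigma> * t \<notin> p ` J" if "0 < t" "t < e" for t
      using e(2)[OF that] p by (metis imageE)
    then show ?thesis using e(1) by (meson order.strict_trans)
  next
    assume "\<forall>\<^sub>F t in at_right 0. g (z + \<sigma> * t) \<noteq> z + \<sigma> * t"
    then obtain e where e: "e > 0" "\<And>t. 0 < t \<Longrightarrow> t < e \<Longrightarrow> g (z + \<sigma> * t) \<noteq> z + \<sigma> * t"
      by (auto simp: eventually_at_right_field)
    have "\<not> (z + \<sigma> * t \<in> p ` J \<and> z + \<sigma> * u \<in> p ` J)" if tu: "0 < t" "t < u" "u < e" for t u
    proof
      assume "z + \<sigma> * t \<in> p ` J \<and> z + \<sigma> * u \<in> p ` J"
      then obtain i j where ij: "i \<in> J" "j \<in> J" "p i = z + \<sigma> * t" "p j = z + \<sigma> * u" by auto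
      have "i \<noteq> j" using ij tu \<sigma> by auto
      then have ne: "left_end U (p i) \<noteq> left_end U (p j)" using inj ij by blast
      have "\<exists>w. w \<notin> U \<and> \<sigma> * p i < \<sigma> * w \<and> \<sigma> * w < \<sigma> * p j"
      proof (cases "\<sigma> = 1")
        case True
        then show ?thesis
          using separated[OF conjunct1[OF p[OF ij(1)]] conjunct1[OF p[OF ij(2)]] _ ne] ij(3,4) tu by auto
      next
        case False
        then have "\<sigma> = -1" using \<sigma> by simp
        moreover have "p j < p i" using ij(3,4) tu calculation by simp
        then obtain w where "p j < w" "w < p i" "w \<notin> U"
          using separated[OF conjunct1[OF p[OF ij(2)]] conjunct1[OF p[OF ij(1)]] _ ne[symmetric]] by blast
        ultimately show ?thesis by (intro exI[of _ w]) auto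
      qed
      then obtain w where w: "w \<notin> U" "\<sigma> * p i < \<sigma> * w" "\<sigma> * w < \<sigma> * p j" by blast
      define v where "v = \<sigma> * (w - z)"
      have wv: "w = z + \<sigma> * v" unfolding v_def using \<sigma> by auto
      have "0 < v" "v < e" using w(2,3) tu \<sigma> ij(3,4) by (auto simp: wv)
      then show False using e(2)[of v] g(2)[OF w(1)] wv by auto
    qed
    then show ?thesis using e(1) by blast
  qed
  obtain e1 where e1: "e1 > 0" "\<And>t u. 0 < t \<Longrightarrow> t < u \<Longrightarrow> u < e1 \<Longrightarrow> \<not> (z + t \<in> p ` J \<and> z + u \<in> p ` J)"
    using side[of 1] by auto
  obtain e2 where e2: "e2 > 0" "\<And>t u. 0 < t \<Longrightarrow> t < u \<Longrightarrow> u < e2 \<Longrightarrow> \<not> (z - t \<in> p ` J \<and> z - u \<in> p ` J)"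
    using side[of "-1"] by auto
  have single: "finite A" if "\<And>x y. x \<in> A \<Longrightarrow> y \<in> A \<Longrightarrow> \<not> x < y" for A :: "real set"
  proof (cases "A = {}")
    case False
    then obtain x where "x \<in> A" by blast
    then have "A \<subseteq> {x}" using that by (metis insertI1 linorder_neqE_linordered_idom subsetI)
    then show ?thesis by (rule finite_subset) simp
  qed simp
  have "finite (p ` J \<inter> {z<..<z + e1})"
  proof (rule single, rule notI)
    fix x y assume "x \<in> p ` J \<inter> {z<..<z + e1}" "y \<in> p ` J \<inter> {z<..<z + e1}" "x < y"
    then show False using e1(2)[of "x - z" "y - z"] by auto
  qed
  moreover have "finite (p ` J \<inter> {z - e2<..<z})"
  proof (rule single, rule notI)
    fix x y assume "x \<in> p ` J \<inter> {z - e2<..<z}" "y \<in> p ` J \<inter> {z - e2<..<z}" "x < y"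
    then show False using e2(2)[of "z - y" "z - x"] by auto
  qed
  ultimately have "finite (insert z ((p ` J \<inter> {z<..<z + e1}) \<union> (p ` J \<inter> {z - e2<..<z})))"
    by simp
  moreover have "p ` J \<inter> ball z (min e1 e2) \<subseteq> insert z ((p ` J \<inter> {z<..<z + e1}) \<union> (p ` J \<inter> {z - e2<..<z}))"
    by (auto simp: dist_real_def)
  ultimately have "finite (p ` J \<inter> ball z (min e1 e2))" by (rule finite_subset[rotated])
  then show False using z e1(1) e2(1) unfolding islimpt_eq_infinite_ball by (meson min_less_iff_conj)
qed

text \<open>Every component of the set of points moved by some element contains a rational number; indexing a component
by the first rational in it under a fixed enumeration makes the family of orbitals a family over a set of natural numbers.\<close>

lemma orbitals_mem:
  fixes C :: "'a monoid set set"
  assumes C: "closed_family C" and L: "subgroup L P"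
    and solv: "(derived P ^^ Suc d) L = {id}"
    and IH: "\<And>K. subgroup K P \<Longrightarrow> (derived P ^^ d) K = {id} \<Longrightarrow> iso_class (PL_sub K) \<in> C"
  shows "iso_class (PL_sub L) \<in> C"
proof -
  interpret C: closed_family C by fact
  note LD = subgroup_PL_D[OF L]
  define U where "U = {x. \<exists>g\<in>L. g x \<noteq> x}"
  have out: "g y = y" if "g \<in> L" "y \<notin> U" for g y using that by (auto simp: U_def)
  interpret open_in_unit U
  proof
    have "- U = (\<Inter>g\<in>L. {y. g y = y})" by (auto simp: U_def)
    moreover have "closed \<dots>"
      using PL_continuous[OF LD(1)] by (intro closed_INT closed_Collect_eq ballI continuous_on_id) auto
    ultimately show "closed (- U)" by simp
    show "U \<subseteq> {0..1}"
    proof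
      fix x assume "x \<in> U"
      then obtain g where "g \<in> L" "g x \<noteq> x" by (auto simp: U_def)
      then show "x \<in> {0..1}" using PL_D(5)[OF LD(1)] by blast
    qed
  qed
  define q :: "nat \<Rightarrow> real" where "q i = of_rat (nat_to_rat_surj i)" for i
  define I where "I = {i. q i \<in> U \<and> (\<forall>j<i. q j \<in> U \<longrightarrow> left_end U (q j) \<noteq> left_end U (q i))}"
  define a where "a i = left_end U (q i)" for i
  define b where "b i = right_end U (q i)" for i
  have I_U: "q i \<in> U" if "i \<in> I" for i using that by (simp add: I_def)
  have I_inj: "a i \<noteq> a j" if "i \<in> I" "j \<in> I" "i \<noteq> j" for i j
    using that by (cases i j rule: linorder_cases) (auto simp: I_def a_def)
  have cover: "\<exists>i\<in>I. y \<in> {a i<..<b i}" if y: "y \<in> U" for y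
  proof -
    obtain w where w: "left_end U y < of_rat w" "of_rat w < right_end U y"
      using of_rat_dense[of "left_end U y" "right_end U y"] left_end_props(2)[OF y] right_end_props(2)[OF y] by auto
    obtain n where n: "w = nat_to_rat_surj n" using surj_nat_to_rat_surj by (rule surjE)
    then have qn: "q n \<in> {left_end U y<..<right_end U y}" using w by (simp add: q_def)
    then have "q n \<in> U \<and> left_end U (q n) = left_end U y" using component_subset[OF y] component_eq[OF y] by blast
    then have ex: "\<exists>n. q n \<in> U \<and> left_end U (q n) = left_end U y" ..
    define i where "i = (LEAST n. q n \<in> U \<and> left_end U (q n) = left_end U y)"
    have i: "q i \<in> U" "left_end U (q i) = left_end U y" unfolding i_def using LeastI_ex[OF ex] by auto
    have "i \<in> I"
      unfolding I_def using i not_less_Least[of _ "\<lambda>n. q n \<in> U \<and> left_end U (q n) = left_end U y"]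
      by (auto simp: i_def[symmetric])
    moreover have "y < right_end U (q i)"
    proof (rule ccontr)
      assume "\<not> ?thesis"
      moreover have "left_end U y < right_end U (q i)" using i left_end_props(2)[OF i(1)] right_end_props(2)[OF i(1)] by auto
      ultimately show False using left_end_props(3)[OF y, of "right_end U (q i)"] right_end_props(1)[OF i(1)] by auto
    qed
    ultimately show ?thesis using i left_end_props(2)[OF y] by (intro bexI[of _ i]) (auto simp: a_def b_def)
  qed
  have ends: "g (a i) = a i" "g (b i) = b i" if "i \<in> I" "g \<in> L" for i g
    using out[OF that(2)] left_end_props(1) right_end_props(1) I_U[OF that(1)] unfolding a_def b_def by auto
  define Gi where "Gi i = cut (a i) (b i) ` L" for i
  have Gi: "subgroup (Gi i) P" "iso_class (PL_sub (Gi i)) \<in> C"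
    "(derived (PL_sub (Gi i)) ^^ Suc d) (carrier (PL_sub (Gi i))) = {\<one>\<^bsub>PL_sub (Gi i)\<^esub>}"
    if i: "i \<in> I" for i
  proof -
    note ci = cut_image[OF L, of "a i" "b i"]
    show sub: "subgroup (Gi i) P" unfolding Gi_def using ci(1) ends[OF i] by blast
    have ab: "a i < q i" "q i < b i" unfolding a_def b_def using left_end_props(2) right_end_props(2) I_U[OF i] by blast+
    have act: "interval_action r (Gi i) (a i) (b i)"
      by (intro interval_action.intro interval_action_axioms.intro slopes_axioms sub)
        (use ab ends[OF i] in \<open>auto simp: Gi_def cut_def\<close>)
    have nofix: "fixset (Gi i) (a i) (b i) = {}"
    proof -
      have "\<exists>g\<in>Gi i. g y \<noteq> y" if y: "y \<in> {a i<..<b i}" for y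
      proof -
        have "y \<in> U" using component_subset[OF I_U[OF i]] y unfolding a_def b_def by blast
        then obtain g where "g \<in> L" "g y \<noteq> y" by (auto simp: U_def)
        then show ?thesis using y by (intro bexI[of _ "cut (a i) (b i) g"]) (auto simp: Gi_def cut_def)
      qed
      then show ?thesis by (auto simp: fixset_def)
    qed
    have outi: "g y = y" if "g \<in> Gi i" "y \<notin> {a i<..<b i}" for g y
      using that ends[OF i] by (auto simp: Gi_def cut_def)
    have "(derived P ^^ Suc d) (Gi i) = cut (a i) (b i) ` ((derived P ^^ Suc d) L)"
      unfolding Gi_def using ci(2)[of L "Suc d"] ends[OF i] by blast
    then have solvi: "(derived P ^^ Suc d) (Gi i) = {id}" unfolding solv by (simp only: cut_id image_insert image_empty)
    show "iso_class (PL_sub (Gi i)) \<in> C"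
      by (rule one_orbital_mem[where C = C and L = "Gi i" and d = d and a = "a i" and b = "b i"])
        (fact C act nofix outi solvi IH)+
    show "(derived (PL_sub (Gi i)) ^^ Suc d) (carrier (PL_sub (Gi i))) = {\<one>\<^bsub>PL_sub (Gi i)\<^esub>}"
    proof -
      have "carrier (PL_sub (Gi i)) = Gi i" "\<one>\<^bsub>PL_sub (Gi i)\<^esub> = id"
        by simp_all
      then show ?thesis
        using P.exp_derived_consistent[OF subset_refl sub, of "Suc d"] solvi by (simp only:)
    qed
  qed
  have grp: "group (PL_sub (Gi i))" if "i \<in> I" for i
    by (rule P.subgroup_imp_group[OF Gi(1)[OF that]])
  define \<Psi> where "\<Psi> g = (\<lambda>i\<in>I. cut (a i) (b i) g)" for g
  have fin: "finite {i\<in>I. cut (a i) (b i) g \<noteq> id}" if g: "g \<in> L" for g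
  proof -
    let ?J = "{i\<in>I. cut (a i) (b i) g \<noteq> id}"
    have "\<exists>y. y \<in> {a i<..<b i} \<and> g y \<noteq> y" if "i \<in> ?J" for i
    proof -
      obtain y where "a i \<le> y" "y < b i" "g y \<noteq> y"
        using \<open>i \<in> ?J\<close> by (auto simp: cut_def fun_eq_iff split: if_splits)
      moreover then have "y \<noteq> a i" using ends \<open>i \<in> ?J\<close> g by auto
      ultimately show ?thesis by (intro exI[of _ y]) auto
    qed
    then have "\<exists>p. \<forall>i\<in>?J. p i \<in> {a i<..<b i} \<and> g (p i) \<noteq> p i" by (intro bchoice ballI)
    then obtain p where p': "\<forall>i\<in>?J. p i \<in> {a i<..<b i} \<and> g (p i) \<noteq> p i" by (rule exE)
    note p = bspec[OF p']
    have left_end_p: "left_end U (p i) = a i" "p i \<in> U" if "i \<in> ?J" for i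
      using component_eq(1)[OF I_U, of i "p i"] component_subset[OF I_U, of i] p[OF that] that
      unfolding a_def b_def by auto
    show ?thesis
    proof (rule support_meets_finitely_many[OF open_in_unit_axioms LD(1)[OF g] out[OF g], of ?J p])
      show "p i \<in> U \<and> g (p i) \<noteq> p i" if "i \<in> ?J" for i using left_end_p[OF that] p[OF that] by blast
      show "left_end U (p i) \<noteq> left_end U (p j)" if "i \<in> ?J" "j \<in> ?J" "i \<noteq> j" for i j
        using left_end_p[OF that(1)] left_end_p[OF that(2)] I_inj that by auto
    qed
  qed
  have car: "carrier (sum_group I (\<lambda>i. PL_sub (Gi i))) = {x \<in> \<Pi>\<^sub>E i\<in>I. Gi i. finite {i\<in>I. x i \<noteq> id}}"
    using carrier_sum_group[of I "\<lambda>i. PL_sub (Gi i)"] grp by simp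
  have "\<Psi> \<in> hom (PL_sub L) (sum_group I (\<lambda>i. PL_sub (Gi i)))"
  proof (rule homI)
    fix g assume "g \<in> carrier (PL_sub L)"
    then have g: "g \<in> L" by simp
    have "{i \<in> I. \<Psi> g i \<noteq> id} = {i\<in>I. cut (a i) (b i) g \<noteq> id}" by (auto simp: \<Psi>_def)
    then show "\<Psi> g \<in> carrier (sum_group I (\<lambda>i. PL_sub (Gi i)))"
      using fin[OF g] g unfolding car by (auto simp: \<Psi>_def Gi_def)
  next
    fix f g assume "f \<in> carrier (PL_sub L)" "g \<in> carrier (PL_sub L)"
    then have fg: "f \<in> L" "g \<in> L" by simp_all
    have "cut (a i) (b i) (f \<circ> g) = cut (a i) (b i) f \<circ> cut (a i) (b i) g" if "i \<in> I" for i
      by (rule cut_comp) (use ends[OF that fg(2)] LD(1)[OF fg(2)] in auto)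
    then show "\<Psi> (f \<otimes>\<^bsub>PL_sub L\<^esub> g) = \<Psi> f \<otimes>\<^bsub>sum_group I (\<lambda>i. PL_sub (Gi i))\<^esub> \<Psi> g"
      by (auto simp: \<Psi>_def intro!: restrict_ext)
  qed
  moreover have "inj_on \<Psi> L"
  proof (rule inj_onI)
    fix f g assume f: "f \<in> L" and g: "g \<in> L" and eq: "\<Psi> f = \<Psi> g"
    show "f = g"
    proof
      fix y
      show "f y = g y"
      proof (cases "y \<in> U")
        case True
        then obtain i where i: "i \<in> I" "y \<in> {a i<..<b i}" using cover by blast
        then have "cut (a i) (b i) f = cut (a i) (b i) g"
          using fun_cong[OF eq, of i] by (simp add: \<Psi>_def)
        then show ?thesis using i(2) by (auto simp: cut_def fun_eq_iff dest: spec[of _ y])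
      qed (simp add: out[OF f] out[OF g])
    qed
  qed
  ultimately have "embeds (PL_sub L) (sum_group I (\<lambda>i. PL_sub (Gi i)))"
    by (intro embedsI) auto
  note emb = this
  have grpL: "group (PL_sub L)" by (rule P.subgroup_imp_group[OF L])
  show ?thesis
    by (rule C.sum_mem[where I = I and G = "\<lambda>i. PL_sub (Gi i)" and d = "Suc d"])
      (fact grp Gi(2) Gi(3) grpL emb)+
qed

theorem solvable_PL_mem:
  assumes C: "closed_family C" and "subgroup L P" "(derived P ^^ d) L = {id}"
  shows "iso_class (PL_sub L) \<in> C"
  using assms(2,3)
proof (induction d arbitrary: L)
  case 0
  then show ?case
    by (intro closed_family.trivial_mem[OF C] P.subgroup_imp_group) auto
next
  case (Suc d)
  show ?case
    by (rule orbitals_mem[where C = C and L = L and d = d]) (fact C Suc.prems Suc.IH)+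
qed

end

section \<open>Thompson groups as groups of maps of the line\<close>

lemma countable_inv_adic: "countable (inv_adic n)"
proof -
  have "inv_adic n = (\<lambda>(a, k). of_int a / of_int n ^ k) ` (UNIV :: (int \<times> nat) set)"
    by (auto simp: inv_adic_def)
  then show ?thesis by simp
qed

definition extend :: "(real \<Rightarrow> real) \<Rightarrow> real \<Rightarrow> real" where
  "extend f x = (if x \<in> {0..1} then f x else x)"

locale thompson =
  fixes n :: int
  assumes n_ge_2: "n \<ge> 2"

sublocale thompson \<subseteq> scaling "of_int n" "inv_adic n"
proof
  have n0: "real_of_int n \<noteq> 0" using n_ge_2 by simp
  show "1 < real_of_int n" using n_ge_2 by simp
  show "0 \<in> inv_adic n" unfolding inv_adic_def by (intro CollectI exI[of _ 0] exI[of _ "0::nat"]) simp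
  show "1 \<in> inv_adic n" unfolding inv_adic_def by (intro CollectI exI[of _ 1] exI[of _ "0::nat"]) simp
  show "x + y \<in> inv_adic n" if xy: "x \<in> inv_adic n" "y \<in> inv_adic n" for x y
  proof -
    obtain a k b l where ab: "x = of_int a / of_int n ^ k" "y = of_int b / of_int n ^ l"
      using xy by (auto simp: inv_adic_def)
    have "x + y = of_int (a * n ^ l + b * n ^ k) / of_int n ^ (k + l)"
      unfolding ab using n0 by (simp add: field_simps power_add)
    then show ?thesis unfolding inv_adic_def by blast
  qed
  show "- x \<in> inv_adic n" if x: "x \<in> inv_adic n" for x
  proof -
    obtain a k where "x = of_int a / of_int n ^ k"
      using x by (auto simp: inv_adic_def)
    then have "- x = of_int (- a) / of_int n ^ k" by simp
    then show ?thesis unfolding inv_adic_def by blast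
  qed
  show "of_int n powi k * x \<in> inv_adic n" if x: "x \<in> inv_adic n" for x k
  proof -
    obtain a l where l: "x = of_int a / of_int n ^ l"
      using x by (auto simp: inv_adic_def)
    show ?thesis
    proof (cases "k \<ge> 0")
      case True
      then have "of_int n powi k * x = of_int (a * n ^ nat k) / of_int n ^ l"
        by (simp add: l power_int_def)
      then show ?thesis unfolding inv_adic_def by blast
    next
      case False
      then have "of_int n powi k * x = of_int a / of_int n ^ (l + nat (- k))"
        using n0 by (simp add: l power_int_def power_add field_simps)
      then show ?thesis unfolding inv_adic_def by blast
    qed
  qed
qed

context thompson begin

abbreviation base :: real where "base \<equiv> of_int n"
abbreviation D where "D \<equiv> inv_adic n"

text \<open>The ends of the unit interval count as nodes, so that every point lies between two nodes.\<close>

definition nodes :: "(real \<Rightarrow> real) \<Rightarrow> real set" where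
  "nodes f = insert 0 (insert 1 (breaks f))"

lemma F_D:
  assumes "f \<in> carrier (F_group n)"
  shows "f \<in> extensional {0..1}" "bij_betw f {0..1} {0..1}"
    "\<And>x y. x \<in> {0..1} \<Longrightarrow> y \<in> {0..1} \<Longrightarrow> x < y \<Longrightarrow> f x < f y"
    "finite (nodes f)" "nodes f \<subseteq> D" "nodes f \<subseteq> {0..1}" "f 0 = 0" "f 1 = 1"
proof -
  have f: "f \<in> Bij {0..1}" "strict_mono_on {0..1} f" "finite (breaks f)" "breaks f \<subseteq> D"
    using assms by (auto simp: F_group_def)
  show "f \<in> extensional {0..1}" and bij: "bij_betw f {0..1} {0..1}" using f(1) by (auto simp: Bij_def)
  show mono: "f x < f y" if "x \<in> {0..1}" "y \<in> {0..1}" "x < y" for x y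
    using f(2) that by (auto simp: strict_mono_on_def)
  show "finite (nodes f)" "nodes f \<subseteq> D" using f D_0 D_1 by (auto simp: nodes_def)
  show "nodes f \<subseteq> {0..1}" by (auto simp: nodes_def breaks_def)
  have im: "f ` {0..1} = {0..1}" using bij by (simp add: bij_betw_def)
  then have rng: "f x \<in> {0..1}" if "x \<in> {0..1}" for x using that by blast
  have "(0::real) \<in> f ` {0..1}" "(1::real) \<in> f ` {0..1}" using im by auto
  then obtain u v where u: "u \<in> {0..1}" "f u = 0" and v: "v \<in> {0..1}" "f v = 1" by force
  show "f 0 = 0" using mono[of 0 u] rng[of 0] u by (cases "u = 0") auto
  show "f 1 = 1" using mono[of v 1] rng[of 1] v by (cases "v = 1") auto
qed

lemma F_piece:
  assumes "f \<in> carrier (F_group n)" "0 \<le> p" "p < q" "q \<le> 1" "{p<..<q} \<inter> nodes f = {}"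
  obtains k :: int where "\<And>y. p \<le> y \<Longrightarrow> y \<le> q \<Longrightarrow> f y = f p + base powi k * (y - p)"
proof -
  have "{p<..<q} \<inter> breaks f = {}" using assms(5) by (auto simp: nodes_def)
  moreover have "\<forall>a b. 0 \<le> a \<and> a < b \<and> b \<le> 1 \<and> {a<..<b} \<inter> breaks f = {} \<longrightarrow>
      (\<exists>k. linear_with_slope_on (base powi k) {a..b} f)"
    using assms(1) by (simp add: F_group_def)
  ultimately obtain k :: int where "linear_with_slope_on (base powi k) {p..q} f"
    using assms(2-4) by blast
  then obtain c where c: "\<And>y. p \<le> y \<Longrightarrow> y \<le> q \<Longrightarrow> f y = base powi k * y + c"
    by (auto simp: linear_with_slope_on_def)
  show thesis
  proof (rule that[of k])
    fix y assume "p \<le> y" "y \<le> q"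
    then show "f y = f p + base powi k * (y - p)"
      using c[of y] c[of p] assms(3) by (simp add: algebra_simps)
  qed
qed

lemma node_below:
  assumes "f \<in> carrier (F_group n)" "0 < x"
  obtains p where "p \<in> nodes f" "p < x" "{p<..<x} \<inter> nodes f = {}"
proof -
  let ?S = "{y \<in> nodes f. y < x}"
  have fin: "finite ?S" using F_D(4)[OF assms(1)] by simp
  have ne: "?S \<noteq> {}" using assms(2) by (auto simp: nodes_def)
  show thesis
  proof (rule that[of "Max ?S"])
    show "Max ?S \<in> nodes f" "Max ?S < x" using Max_in[OF fin ne] by auto
    show "{Max ?S<..<x} \<inter> nodes f = {}" using Max_ge[OF fin] by fastforce
  qed
qed

lemma node_above:
  assumes "f \<in> carrier (F_group n)" "x < 1"
  obtains q where "q \<in> nodes f" "x < q" "{x<..<q} \<inter> nodes f = {}"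
proof -
  let ?S = "{y \<in> nodes f. x < y}"
  have fin: "finite ?S" using F_D(4)[OF assms(1)] by simp
  have ne: "?S \<noteq> {}" using assms(2) by (auto simp: nodes_def)
  show thesis
  proof (rule that[of "Min ?S"])
    show "Min ?S \<in> nodes f" "x < Min ?S" using Min_in[OF fin ne] by auto
    show "{x<..<Min ?S} \<inter> nodes f = {}" using Min_le[OF fin] by fastforce
  qed
qed

lemma between_nodes:
  assumes f: "f \<in> carrier (F_group n)" and x: "0 < x" "x < 1" "x \<notin> nodes f"
  obtains p q where "p \<in> nodes f" "q \<in> nodes f" "p < x" "x < q" "0 \<le> p" "p < q" "q \<le> 1"
    "{p<..<q} \<inter> nodes f = {}"
proof -
  obtain p where p: "p \<in> nodes f" "p < x" "{p<..<x} \<inter> nodes f = {}"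
    using node_below[OF f x(1)] by auto
  obtain q where q: "q \<in> nodes f" "x < q" "{x<..<q} \<inter> nodes f = {}"
    using node_above[OF f x(2)] by auto
  have "y \<notin> nodes f" if "p < y" "y < q" for y
    using p(3) q(3) x(3) that by (cases y x rule: linorder_cases) auto
  then have "{p<..<q} \<inter> nodes f = {}" by auto
  then show thesis by (rule that[OF p(1) q(1) p(2) q(2), rotated 3]) (use p q F_D(6)[OF f] in auto)
qed

text \<open>Induction on the number of nodes to the left of \<open>p\<close>: on the piece ending at \<open>p\<close> the map is
affine, and its left end is a node with a value in \<open>D\<close> by induction.\<close>

lemma F_maps_D:
  assumes f: "f \<in> carrier (F_group n)" and "p \<in> D" "p \<in> {0..1}"
  shows "f p \<in> D"
  using assms(2,3)
proof (induction "card {y \<in> nodes f. y < p}" arbitrary: p rule: less_induct)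
  case less
  show ?case
  proof (cases "p = 0")
    case True
    then show ?thesis using F_D(7)[OF f] D_0 by simp
  next
    case False
    then obtain q where q: "q \<in> nodes f" "q < p" "{q<..<p} \<inter> nodes f = {}"
      using node_below[OF f, of p] less.prems by auto
    have qD: "q \<in> D" "q \<in> {0..1}" using q F_D(5,6)[OF f] by auto
    have "{y \<in> nodes f. y < q} \<subset> {y \<in> nodes f. y < p}" using q by auto
    then have "card {y \<in> nodes f. y < q} < card {y \<in> nodes f. y < p}"
      using F_D(4)[OF f] by (intro psubset_card_mono) auto
    then have "f q \<in> D" using less.hyps qD by blast
    obtain k :: int where k: "\<And>y. q \<le> y \<Longrightarrow> y \<le> p \<Longrightarrow> f y = f q + base powi k * (y - q)"
      using F_piece[OF f _ q(2) _ q(3)] qD less.prems by auto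
    have fp: "f p = f q + base powi k * (p - q)" by (rule k) (use q(2) in auto)
    have "f q + base powi k * (p - q) \<in> D"
      by (rule D_add[OF \<open>f q \<in> D\<close> D_scale[OF D_diff[OF less.prems(1) qD(1)]]])
    then show ?thesis by (simp only: fp)
  qed
qed

lemma F_piece_around:
  assumes f: "f \<in> carrier (F_group n)" and pq: "p \<in> nodes f" "0 \<le> p" "p < q" "q \<le> 1" "{p<..<q} \<inter> nodes f = {}"
  obtains k :: int where
    "\<And>x. p \<le> x \<Longrightarrow> x < q \<Longrightarrow> affine_germ base D (extend f) x 1 k"
    "\<And>x. p < x \<Longrightarrow> x \<le> q \<Longrightarrow> affine_germ base D (extend f) x (-1) k"
proof -
  obtain k :: int where k: "\<And>y. p \<le> y \<Longrightarrow> y \<le> q \<Longrightarrow> f y = f p + base powi k * (y - p)"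
    using F_piece[OF f pq(2-5)] by blast
  have ext: "extend f y = f p + base powi k * (y - p)" if "p \<le> y" "y \<le> q" for y
    using k[OF that] that pq by (simp add: extend_def)
  have "p \<in> D" using pq(1) F_D(5)[OF f] by blast
  then have "f p - base powi k * p \<in> D"
    using F_maps_D[OF f \<open>p \<in> D\<close>] pq by (intro D_diff D_scale) auto
  then have inD: "extend f x - base powi k * x \<in> D" if "p \<le> x" "x \<le> q" for x
  proof -
    have "extend f x - base powi k * x = f p - base powi k * p"
      using ext[OF that] by (simp add: algebra_simps)
    then show ?thesis using \<open>f p - base powi k * p \<in> D\<close> by simp
  qed
  show thesis
  proof (rule that[of k])
    fix x assume x: "p \<le> x" "x < q"
    have "has_slope base (extend f) x 1 k"
      unfolding has_slope_def eventually_at_right_field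
    proof (intro exI[of _ "q - x"] conjI allI impI)
      show "0 < q - x" using x by simp
      fix t assume "0 < t" "t < q - x"
      then have "extend f x = f p + base powi k * (x - p)" "extend f (x + t) = f p + base powi k * (x + t - p)"
        using x by (auto intro!: ext)
      then show "extend f (x + 1 * t) = extend f x + 1 * (base powi k * t)"
        by (simp add: algebra_simps)
    qed
    then show "affine_germ base D (extend f) x 1 k"
      using inD x by simp
  next
    fix x assume x: "p < x" "x \<le> q"
    have "has_slope base (extend f) x (-1) k"
      unfolding has_slope_def eventually_at_right_field
    proof (intro exI[of _ "x - p"] conjI allI impI)
      show "0 < x - p" using x by simp
      fix t assume "0 < t" "t < x - p"
      then have "extend f x = f p + base powi k * (x - p)" "extend f (x - t) = f p + base powi k * (x - t - p)"
        using x by (auto intro!: ext)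
      then show "extend f (x + (-1) * t) = extend f x + (-1) * (base powi k * t)"
        by (simp add: algebra_simps)
    qed
    then show "affine_germ base D (extend f) x (-1) k"
      using inD x by simp
  qed
qed

lemma extend_outside:
  "x < 0 \<or> x \<ge> 1 \<Longrightarrow> f 1 = 1 \<Longrightarrow> has_slope base (extend f) x 1 0 \<and> extend f x = x"
  "x \<le> 0 \<or> x > 1 \<Longrightarrow> f 0 = 0 \<Longrightarrow> has_slope base (extend f) x (-1) 0 \<and> extend f x = x"
proof -
  assume x: "x < 0 \<or> x \<ge> 1" and 1: "f 1 = 1"
  have "extend f x = x" using x 1 by (auto simp: extend_def)
  moreover have "\<exists>e>0. \<forall>t>0. t < e \<longrightarrow> extend f (x + t) = x + t"
    using x by (intro exI[of _ "if x < 0 then - x else 1"]) (auto simp: extend_def)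
  ultimately show "has_slope base (extend f) x 1 0 \<and> extend f x = x"
    by (auto simp: has_slope_def eventually_at_right_field)
next
  assume x: "x \<le> 0 \<or> x > 1" and 0: "f 0 = 0"
  have "extend f x = x" using x 0 by (auto simp: extend_def)
  moreover have "\<exists>e>0. \<forall>t>0. t < e \<longrightarrow> extend f (x - t) = x - t"
    using x by (intro exI[of _ "if x > 1 then x - 1 else 1"]) (auto simp: extend_def)
  ultimately show "has_slope base (extend f) x (-1) 0 \<and> extend f x = x"
    by (auto simp: has_slope_def eventually_at_right_field)
qed

lemma extend_PL:
  assumes f: "f \<in> carrier (F_group n)"
  shows "extend f \<in> carrier (PL base D)"
proof (rule PL_I)
  note FD = F_D[OF f]
  have im: "f ` {0..1} = {0..1}" using FD(2) by (simp add: bij_betw_def)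
  have rng: "f x \<in> {0..1}" if "x \<in> {0..1}" for x using that im by blast
  show "strict_mono (extend f)"
  proof (rule strict_monoI)
    fix x y :: real assume "x < y"
    then show "extend f x < extend f y"
      using FD(3)[of x y] rng[of x] rng[of y] by (auto simp: extend_def)
  qed
  have "\<exists>x. extend f x = y" for y
  proof (cases "y \<in> {0..1}")
    case True
    then obtain x where "x \<in> {0..1}" "f x = y" using im by (metis imageE)
    then show ?thesis by (intro exI[of _ x]) (simp add: extend_def)
  qed (auto simp: extend_def)
  then show "surj (extend f)" by (metis surj_def)
  show "extend f x = x" if "x \<notin> {0..1}" for x using that by (auto simp: extend_def)
  have right: "\<exists>k. affine_germ base D (extend f) x 1 k" for x
  proof (cases "x < 0 \<or> x \<ge> 1")
    case True
    then show ?thesis using extend_outside(1)[of x f] FD(8) D_0 by (intro exI[of _ 0]) simp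
  next
    case False
    obtain q where q: "q \<in> nodes f" "x < q" "{x<..<q} \<inter> nodes f = {}"
      using node_above[OF f, of x] False by auto
    have "q \<le> 1" using q FD(6) by auto
    obtain p where p: "p \<in> nodes f" "p \<le> x" "{p<..x} \<inter> nodes f = {}"
    proof (cases "x \<in> nodes f")
      case True then show ?thesis using that[of x] by simp
    next
      case False
      then have "0 < x" using \<open>\<not> (x < 0 \<or> x \<ge> 1)\<close> by (cases "x = 0") (auto simp: nodes_def)
      then obtain p where "p \<in> nodes f" "p < x" "{p<..<x} \<inter> nodes f = {}"
        using node_below[OF f] by blast
      then show ?thesis using that[of p] False by (force simp: order_le_less)
    qed
    have "0 \<le> p" using p FD(6) by auto
    moreover have "{p<..<q} \<inter> nodes f = {}"
      using p(3) q(3) by (force simp: disjoint_iff)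
    ultimately show ?thesis
      using F_piece_around[OF f p(1) _ _ \<open>q \<le> 1\<close>] p(2) q(2) by (metis order_le_less_trans)
  qed
  have left: "\<exists>k. affine_germ base D (extend f) x (-1) k" for x
  proof (cases "x \<le> 0 \<or> x > 1")
    case True
    then show ?thesis using extend_outside(2)[of x f] FD(7) D_0 by (intro exI[of _ 0]) simp
  next
    case False
    obtain p where p: "p \<in> nodes f" "p < x" "{p<..<x} \<inter> nodes f = {}"
      using node_below[OF f, of x] False by auto
    have "0 \<le> p" using p FD(6) by auto
    then show ?thesis
      using F_piece_around[OF f p(1) _ p(2) _ p(3)] p(2) False by (metis linorder_not_less order_refl)
  qed
  show "\<exists>k. affine_germ base D (extend f) x \<sigma> k" if "\<sigma> \<in> {1,-1}" for x \<sigma>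
    using that left right by auto
  show "\<exists>k. \<forall>\<sigma>\<in>{1,-1}. has_slope base (extend f) x \<sigma> k" if x: "x \<notin> D" for x
  proof (cases "x \<in> {0..1}")
    case False
    then have "x < 0 \<or> x \<ge> 1" "x \<le> 0 \<or> x > 1" by auto
    then show ?thesis using extend_outside[of x f] FD(7,8) by (intro exI[of _ 0]) simp
  next
    case True
    have xn: "x \<notin> nodes f" "x \<noteq> 0" "x \<noteq> 1" using x FD(5) D_0 D_1 by auto
    then have x01: "0 < x" "x < 1" using True by auto
    obtain p q where pq: "p \<in> nodes f" "q \<in> nodes f" "p < x" "x < q" "0 \<le> p" "p < q" "q \<le> 1"
      "{p<..<q} \<inter> nodes f = {}"
      by (rule between_nodes[OF f x01 xn(1)])
    obtain k :: int where
      "\<And>x. p \<le> x \<Longrightarrow> x < q \<Longrightarrow> affine_germ base D (extend f) x 1 k"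
      "\<And>x. p < x \<Longrightarrow> x \<le> q \<Longrightarrow> affine_germ base D (extend f) x (-1) k"
      using F_piece_around[OF f pq(1,5-8)] by metis
    then show ?thesis using pq(3,4) by (intro exI[of _ k]) auto
  qed
qed

text \<open>A map is determined by its graph over the finitely many nodes, as it interpolates linearly in between.\<close>

lemma countable_F: "countable (carrier (F_group n))"
proof -
  define node_graph where "node_graph f = (\<lambda>x. (x, f x)) ` nodes f" for f :: "real \<Rightarrow> real"
  have "inj_on node_graph (carrier (F_group n))"
  proof (rule inj_onI)
    fix f g assume f: "f \<in> carrier (F_group n)" and g: "g \<in> carrier (F_group n)" and eq: "node_graph f = node_graph g"
    have "fst ` node_graph f = nodes f" for f by (simp add: node_graph_def image_image)
    then have nodes: "nodes f = nodes g" using eq by metis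
    have val: "f x = g x" if "x \<in> nodes f" for x
    proof -
      have "(x, f x) \<in> node_graph g" using that eq by (auto simp: node_graph_def)
      then show ?thesis by (auto simp: node_graph_def)
    qed
    show "f = g"
    proof (rule extensionalityI[OF F_D(1)[OF f] F_D(1)[OF g]])
      fix x :: real assume x: "x \<in> {0..1}"
      show "f x = g x"
      proof (cases "x \<in> nodes f")
        case False
        then have x01: "0 < x" "x < 1" using x by (auto simp: nodes_def order_le_less)
        obtain p q where p: "p \<in> nodes f" and q: "q \<in> nodes f" and x: "p < x" "x < q"
          and pq': "0 \<le> p" "p < q" "q \<le> 1" and pq: "{p<..<q} \<inter> nodes f = {}"
          by (rule between_nodes[OF f x01 False])
        obtain k :: int where k: "\<And>y. p \<le> y \<Longrightarrow> y \<le> q \<Longrightarrow> f y = f p + base powi k * (y - p)"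
          using F_piece[OF f pq' pq] by blast
        obtain l :: int where l: "\<And>y. p \<le> y \<Longrightarrow> y \<le> q \<Longrightarrow> g y = g p + base powi l * (y - p)"
          using F_piece[OF g pq' pq[unfolded nodes]] by blast
        have "base powi k * (q - p) = base powi l * (q - p)"
          using k[of q] l[of q] val[OF p] val[OF q] pq'(2) by simp
        then have "base powi k = base powi l" using pq'(2) by simp
        then show ?thesis using k[of x] l[of x] x val[OF p] by simp
      qed (rule val)
    qed
  qed
  moreover have "node_graph ` carrier (F_group n) \<subseteq> {A. A \<subseteq> D \<times> D \<and> finite A}"
    using F_D(4,5,6) F_maps_D by (fastforce simp: node_graph_def)
  then have "countable (node_graph ` carrier (F_group n))"
    using countable_Collect_finite_subset[of "D \<times> D"] countable_inv_adic
    by (metis (no_types, lifting) Collect_cong countable_SIGMA countable_subset)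
  ultimately show ?thesis by (rule countable_image_inj_on[rotated])
qed

end

context thompson begin

abbreviation T where "T \<equiv> PL base D"

lemma T_01:
  assumes f: "f \<in> carrier T"
  shows "f 0 = 0" "f 1 = 1" "f x \<in> {0..1} \<longleftrightarrow> x \<in> {0..1}"
proof -
  have pre: "\<exists>x. f x = y" for y using PL_D(2)[OF f] by (metis surjD)
  have out: "x < 0 \<or> x > 1 \<Longrightarrow> f x = x" for x using PL_D(5)[OF f, of x] by auto
  obtain u v where u: "f u = 0" and v: "f v = 1" using pre by metis
  have "f (f 0) = f 0 \<or> 0 \<le> f 0" "f (f 1) = f 1 \<or> f 1 \<le> 1" using out by force+
  then have "0 \<le> f 0" "f 1 \<le> 1" by (auto simp: PL_eq_iff[OF f])
  moreover have "0 \<le> u" "v \<le> 1" using out[of u] out[of v] u v by linarith+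
  then have "f 0 \<le> f u" "f v \<le> f 1" by (simp_all add: PL_le_iff[OF f])
  ultimately show 0: "f 0 = 0" and 1: "f 1 = 1" using u v by linarith+
  show "f x \<in> {0..1} \<longleftrightarrow> x \<in> {0..1}"
    using PL_le_iff[OF f, of 0 x] PL_le_iff[OF f, of x 1] 0 1 by simp
qed

lemma restrict_has_derivative:
  fixes f :: "real \<Rightarrow> real"
  assumes "open S" "y \<in> S" "y \<in> {0<..<1}" "\<And>u. u \<in> S \<Longrightarrow> f u = A + m * (u - B)"
  shows "(restrict f {0..1} has_field_derivative m) (at y)"
proof (rule has_field_derivative_transform_within_open)
  show "((\<lambda>u. A + m * (u - B)) has_field_derivative m) (at y)"
    by (auto intro!: derivative_eq_intros)
  show "open (S \<inter> {0<..<1})" using assms(1) by (intro open_Int open_greaterThanLessThan)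
qed (use assms in auto)

lemma local_linear:
  assumes "has_slope base f x 1 k" "has_slope base f x (-1) k"
  shows "\<exists>e>0. \<forall>y\<in>ball x e. f y = f x + base powi k * (y - x)"
proof -
  obtain d where d: "d > 0" "\<And>t. 0 < t \<Longrightarrow> t < d \<Longrightarrow> f (x + 1 * t) = f x + 1 * (base powi k * t)"
    using assms(1) unfolding has_slope_def eventually_at_right_field by auto
  obtain e where e: "e > 0" "\<And>t. 0 < t \<Longrightarrow> t < e \<Longrightarrow> f (x + (-1) * t) = f x + (-1) * (base powi k * t)"
    using assms(2) unfolding has_slope_def eventually_at_right_field by blast
  have "f y = f x + base powi k * (y - x)" if "y \<in> ball x (min d e)" for y
  proof (cases y x rule: linorder_cases)
    case less
    have "f (x + (-1) * (x - y)) = f x + (-1) * (base powi k * (x - y))"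
      by (rule e(2)) (use less that in \<open>auto simp: dist_real_def\<close>)
    then show ?thesis by (simp add: algebra_simps)
  next
    case greater
    have "f (x + 1 * (y - x)) = f x + 1 * (base powi k * (y - x))"
      by (rule d(2)) (use greater that in \<open>auto simp: dist_real_def\<close>)
    then show ?thesis by simp
  qed simp
  moreover have "min d e > 0" using d(1) e(1) by simp
  ultimately show ?thesis by blast
qed

text \<open>Hence at a point of differentiability the slopes of both sides agree.\<close>

lemma slope_of_derivative:
  assumes x: "x \<in> {0<..<1}" and der: "(restrict f {0..1} has_field_derivative m) (at x)"
    and \<sigma>: "\<sigma> \<in> {1,-1}" and s: "has_slope base f x \<sigma> k"
  shows "m = base powi k"
proof -
  let ?g = "restrict f {0..1}"
  have lim: "filterlim (\<lambda>t. \<sigma> * t) (at 0) (at_right 0)"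
    unfolding filterlim_at
  proof
    show "\<forall>\<^sub>F t in at_right 0. \<sigma> * t \<in> UNIV \<and> \<sigma> * t \<noteq> 0"
      using eventually_at_right_less[of 0] by eventually_elim (use \<sigma> in auto)
    have "((\<lambda>t. \<sigma> * t) \<longlongrightarrow> \<sigma> * 0) (at_right 0)" by (intro tendsto_intros)
    then show "((\<lambda>t. \<sigma> * t) \<longlongrightarrow> 0) (at_right 0)" by simp
  qed
  have "((\<lambda>h. (?g (x + h) - ?g x) / h) \<longlongrightarrow> m) (at 0)"
    using der by (simp add: DERIV_def)
  then have *: "((\<lambda>t. (?g (x + \<sigma> * t) - ?g x) / (\<sigma> * t)) \<longlongrightarrow> m) (at_right 0)"
    by (rule filterlim_compose[OF _ lim])
  have "\<forall>\<^sub>F t in at_right 0. t < min x (1 - x)"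
    using x unfolding eventually_at_right_field by (intro exI[of _ "min x (1 - x)"]) auto
  then have "\<forall>\<^sub>F t in at_right 0. (?g (x + \<sigma> * t) - ?g x) / (\<sigma> * t) = base powi k"
    using s[unfolded has_slope_def] eventually_at_right_less[of 0]
  proof eventually_elim
    case (elim t)
    have "x + \<sigma> * t \<in> {0..1}" using elim(1,3) \<sigma> x by auto
    then show ?case using elim(2,3) \<sigma> x by auto
  qed
  then have "((\<lambda>t. base powi k) \<longlongrightarrow> m) (at_right (0::real))"
    using * by (simp add: tendsto_cong)
  then show ?thesis by (simp add: tendsto_const_iff)
qed

text \<open>Breakpoints cannot accumulate, because on each side of every point the map is affine for a while. Off the breakpoints
the slope is locally constant, hence constant on an interval without breakpoints.\<close>

lemma restrict_F:
  assumes f: "f \<in> carrier T"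
  shows "restrict f {0..1} \<in> carrier (F_group n)"
proof -
  let ?g = "restrict f {0..1}"
  have im: "f ` {0..1} = {0..1}"
  proof
    show "f ` {0..1} \<subseteq> {0..1}" using T_01(3)[OF f] by blast
    show "{0..1} \<subseteq> f ` {0..1}"
    proof
      fix y :: real assume y: "y \<in> {0..1}"
      obtain x where "f x = y" using PL_D(2)[OF f] by (metis surjD)
      then show "y \<in> f ` {0..1}" using T_01(3)[OF f, of x] y by blast
    qed
  qed
  have inj: "inj_on f {0..1}" using PL_D(4)[OF f] by (rule inj_on_subset) simp
  have Bij: "?g \<in> Bij {0..1}"
    using im inj by (auto simp: Bij_def bij_betw_def inj_on_def)
  have homeo: "\<exists>h. homeomorphism {0..1} {0..1} ?g h"
  proof (rule homeomorphism_compact)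
    have "continuous_on {0..1} ?g \<longleftrightarrow> continuous_on {0..1} f"
      by (rule continuous_on_cong) auto
    then show "continuous_on {0..1} ?g" using PL_continuous[OF f] by blast
  qed (use im inj in \<open>auto simp: inj_on_def\<close>)
  have mono: "strict_mono_on {0..1} ?g"
  proof (rule strict_mono_onI)
    fix x y :: real assume "x \<in> {0..1}" "y \<in> {0..1}" "x < y"
    then show "?g x < ?g y" by (simp add: PL_less_iff[OF f])
  qed
  have not_break: "x \<notin> breaks ?g" if "(?g has_field_derivative m) (at x)" for x m
  proof -
    have "?g differentiable (at x)" using that unfolding real_differentiable_def by blast
    then show ?thesis by (simp add: breaks_def)
  qed
  have fin: "finite (breaks ?g)"
  proof (rule ccontr)
    assume "infinite (breaks ?g)"
    moreover have "breaks ?g \<subseteq> {0..1}" by (auto simp: breaks_def)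
    ultimately obtain z where z: "z islimpt (breaks ?g)"
      using Heine_Borel_imp_Bolzano_Weierstrass[of "{0..1::real}" "breaks ?g"] by auto
    have side: "\<exists>e>0. \<forall>y\<in>breaks ?g. \<not> (0 < \<sigma> * (y - z) \<and> \<sigma> * (y - z) < e)" if \<sigma>: "\<sigma> \<in> {1,-1}" for \<sigma>
    proof -
      obtain k where "has_slope base f z \<sigma> k" using PL_D(6)[OF f \<sigma>] by blast
      then obtain e where e: "e > 0" "\<And>t. 0 < t \<Longrightarrow> t < e \<Longrightarrow> f (z + \<sigma> * t) = f z + \<sigma> * (base powi k * t)"
        unfolding has_slope_def eventually_at_right_field by blast
      have "\<not> (0 < \<sigma> * (y - z) \<and> \<sigma> * (y - z) < e)" if y: "y \<in> breaks ?g" for y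
      proof
        assume ye: "0 < \<sigma> * (y - z) \<and> \<sigma> * (y - z) < e"
        let ?S = "{u. 0 < \<sigma> * (u - z)} \<inter> {u. \<sigma> * (u - z) < e}"
        have "(?g has_field_derivative base powi k) (at y)"
        proof (rule restrict_has_derivative[where S = ?S and A = "f z" and B = z])
          show "open ?S" by (intro open_Int open_Collect_less continuous_intros)
          show "y \<in> {0<..<1}" using y by (auto simp: breaks_def)
          show "f u = f z + base powi k * (u - z)" if "u \<in> ?S" for u
          proof -
            have "z + \<sigma> * (\<sigma> * (u - z)) = u" "\<sigma> * (base powi k * (\<sigma> * (u - z))) = base powi k * (u - z)"
              using \<sigma> by auto
            moreover have "f (z + \<sigma> * (\<sigma> * (u - z))) = f z + \<sigma> * (base powi k * (\<sigma> * (u - z)))"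
              by (rule e(2)) (use that in auto)
            ultimately show ?thesis by (simp only:)
          qed
        qed (use ye in auto)
        then have "y \<notin> breaks ?g" by (rule not_break)
        then show False using y by simp
      qed
      then show ?thesis using e(1) by blast
    qed
    obtain e1 where e1: "e1 > 0" "\<And>y. y \<in> breaks ?g \<Longrightarrow> \<not> (z < y \<and> y < z + e1)"
      using side[of 1] by (auto simp: algebra_simps)
    obtain e2 where e2: "e2 > 0" "\<And>y. y \<in> breaks ?g \<Longrightarrow> \<not> (y < z \<and> z < y + e2)"
      using side[of "-1"] by (auto simp: algebra_simps)
    have "y = z" if "y \<in> breaks ?g" "y \<in> ball z (min e1 e2)" for y
      using e1(2)[OF that(1)] e2(2)[OF that(1)] that(2)
      by (cases y z rule: linorder_cases) (auto simp: dist_real_def)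
    then have "breaks ?g \<inter> ball z (min e1 e2) \<subseteq> {z}" by blast
    then have "finite (breaks ?g \<inter> ball z (min e1 e2))" by (rule finite_subset) simp
    then show False using z e1(1) e2(1) unfolding islimpt_eq_infinite_ball by (meson min_less_iff_conj)
  qed
  have breaks_D: "breaks ?g \<subseteq> D"
  proof
    fix x assume x: "x \<in> breaks ?g"
    show "x \<in> D"
    proof (rule ccontr)
      assume "x \<notin> D"
      then obtain k where "\<forall>\<sigma>\<in>{1,-1}. has_slope base f x \<sigma> k" using PL_D(7)[OF f] by blast
      then obtain e where e: "e > 0" "\<forall>y\<in>ball x e. f y = f x + base powi k * (y - x)"
        using local_linear[of f x k] by auto
      have "(?g has_field_derivative base powi k) (at x)"
      proof (rule restrict_has_derivative[where S = "ball x e" and A = "f x" and B = x])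
        show "x \<in> ball x e" using e(1) by simp
        show "x \<in> {0<..<1}" using x by (simp add: breaks_def)
        show "f u = f x + base powi k * (u - x)" if "u \<in> ball x e" for u using e(2) that by blast
      qed simp
      then have "x \<notin> breaks ?g" by (rule not_break)
      then show False using x by simp
    qed
  qed
  have lin: "\<exists>k::int. linear_with_slope_on (base powi k) {a..b} ?g"
    if ab: "0 \<le> a" "a < b" "b \<le> 1" "{a<..<b} \<inter> breaks ?g = {}" for a b
  proof -
    define \<kappa> where "\<kappa> x = (SOME k. has_slope base f x 1 k)" for x
    have \<kappa>: "has_slope base f x 1 (\<kappa> x)" for x
      unfolding \<kappa>_def using PL_D(6)[OF f, of 1 x] by (metis insertI1 someI_ex)
    have loc: "\<exists>e>0. \<forall>y\<in>ball x e. f y = f x + base powi \<kappa> x * (y - x)" if x: "x \<in> {a<..<b}" for x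
    proof -
      have x01: "x \<in> {0<..<1}" using x ab by auto
      then have "?g differentiable (at x)" using x ab(4) by (auto simp: breaks_def)
      then obtain m where m: "(?g has_field_derivative m) (at x)" by (auto simp: real_differentiable_def)
      obtain l where l: "has_slope base f x (-1) l" using PL_D(6)[OF f, of "-1" x] by auto
      have "base powi \<kappa> x = base powi l"
        using slope_of_derivative[OF x01 m _ \<kappa>] slope_of_derivative[OF x01 m _ l] by simp
      then have "\<kappa> x = l" by (simp add: r_powi_inject)
      then have "has_slope base f x (-1) (\<kappa> x)" using l by simp
      then show ?thesis by (rule local_linear[OF \<kappa>])
    qed
    have const: "\<kappa> x = \<kappa> y" if "x \<in> {a<..<b}" "y \<in> {a<..<b}" for x y
    proof (rule connected_local_const[OF _ that])
      show "connected {a<..<b}" by simp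
      show "\<forall>x\<in>{a<..<b}. \<forall>\<^sub>F y in at x within {a<..<b}. \<kappa> x = \<kappa> y"
      proof
        fix x assume x: "x \<in> {a<..<b}"
        obtain e where e: "e > 0" "\<And>y. y \<in> ball x e \<Longrightarrow> f y = f x + base powi \<kappa> x * (y - x)"
          using loc[OF x] by blast
        have "\<kappa> x = \<kappa> y" if y: "y \<in> ball x e" for y
        proof -
          have "has_slope base f y 1 (\<kappa> x)"
            unfolding has_slope_def eventually_at_right_field
          proof (intro exI[of _ "e - dist x y"] conjI allI impI)
            show "0 < e - dist x y" using y by simp
            fix t assume "0 < t" "t < e - dist x y"
            then have "f (y + t) = f x + base powi \<kappa> x * (y + t - x)"
              by (intro e(2)) (auto simp: dist_real_def)
            then show "f (y + 1 * t) = f y + 1 * (base powi \<kappa> x * t)"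
              by (simp add: e(2)[OF y] algebra_simps)
          qed
          then show ?thesis using has_slope_unique[OF \<kappa>[of y]] by simp
        qed
        then show "\<forall>\<^sub>F y in at x within {a<..<b}. \<kappa> x = \<kappa> y"
          using e(1) by (auto simp: eventually_at dist_commute intro!: exI[of _ e])
      qed
    qed
    define m where "m = base powi \<kappa> ((a + b) / 2)"
    have mid: "(a + b) / 2 \<in> {a<..<b}" using ab by auto
    have der: "((\<lambda>u. f u - m * u) has_field_derivative 0) (at x)" if x: "a < x" "x < b" for x
    proof -
      obtain e where e: "e > 0" "\<And>y. y \<in> ball x e \<Longrightarrow> f y = f x + base powi \<kappa> x * (y - x)"
        using loc[OF greaterThanLessThan_iff[THEN iffD2, OF conjI, OF x]] by blast
      have "base powi \<kappa> x = m" using const[OF mid, of x] x by (simp add: m_def)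
      have "((\<lambda>u. f x - m * x) has_field_derivative 0) (at x)" by simp
      then show ?thesis
      proof (rule has_field_derivative_transform_within_open[where S = "ball x e"])
        show "x \<in> ball x e" using e(1) by simp
        fix u assume "u \<in> ball x e"
        then have "f u = f x + m * (u - x)" using e(2)[of u] \<open>base powi \<kappa> x = m\<close> by simp
        then show "f x - m * x = f u - m * u" by (simp add: algebra_simps)
      qed simp
    qed
    have cont: "continuous_on {a..b} (\<lambda>u. f u - m * u)"
      by (intro continuous_on_diff continuous_on_mult continuous_on_const continuous_on_id PL_continuous[OF f])
    have "f y - m * y = f a - m * a" if "y \<in> {a..b}" for y
      using DERIV_isconst2[where f = "\<lambda>u. f u - m * u" and x = y, OF ab(2) cont der] that by simp
    then have "\<forall>y\<in>{a..b}. ?g y = m * y + (f a - m * a)"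
      using ab by (auto simp: algebra_simps)
    then show ?thesis unfolding linear_with_slope_on_def m_def by blast
  qed
  show ?thesis
    using Bij homeo mono fin breaks_D lin by (simp add: F_group_def)
qed

lemma restrict_iso: "(\<lambda>f. restrict f {0..1}) \<in> iso T (F_group n)"
  unfolding Group.iso_iff
proof (intro conjI)
  let ?R = "\<lambda>f::real \<Rightarrow> real. restrict f {0..1}"
  show "?R \<in> hom T (F_group n)"
  proof (rule homI)
    fix f g assume fg: "f \<in> carrier T" "g \<in> carrier T"
    have "?R f \<in> Bij {0..1}" "?R g \<in> Bij {0..1}"
      using restrict_F[OF fg(1)] restrict_F[OF fg(2)] by (auto simp: F_group_def)
    then show "?R (f \<otimes>\<^bsub>T\<^esub> g) = ?R f \<otimes>\<^bsub>F_group n\<^esub> ?R g"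
      using T_01(3)[OF fg(2)] by (auto simp: F_group_def BijGroup_def compose_def fun_eq_iff restrict_def)
  qed (rule restrict_F)
  have RE: "?R (extend f) = f" if "f \<in> carrier (F_group n)" for f
    using F_D(1)[OF that] by (auto simp: fun_eq_iff extend_def extensional_def)
  show "?R ` carrier T = carrier (F_group n)"
  proof
    show "carrier (F_group n) \<subseteq> ?R ` carrier T"
      using RE extend_PL by (metis image_eqI subsetI)
  qed (use restrict_F in blast)
  have ER: "extend (?R f) = f" if "f \<in> carrier T" for f
    using PL_D(5)[OF that] by (auto simp: fun_eq_iff extend_def)
  show "inj_on ?R (carrier T)" by (rule inj_on_inverseI) (rule ER)
qed

lemma group_F: "group (F_group n)"
proof -
  have "group (F_group n\<lparr>one := restrict id {0..1}\<rparr>)"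
    using group.iso_imp_img_group[OF group_PL restrict_iso] by simp
  moreover have "restrict id {0..1} = \<one>\<^bsub>F_group n\<^esub>"
    by (auto simp: F_group_def BijGroup_def)
  ultimately show ?thesis by simp
qed

lemma T_iso_F: "T \<cong> F_group n" "F_group n \<cong> T"
proof -
  show "T \<cong> F_group n" using restrict_iso by (auto simp: is_iso_def)
  then show "F_group n \<cong> T" by (rule group.iso_sym[OF group_PL])
qed

end

section \<open>Direct sums and wreath products inside Thompson groups\<close>

context scaling begin

abbreviation Q where "Q \<equiv> PL r D"

definition idx :: "'i set \<Rightarrow> ('i \<Rightarrow> real set) \<Rightarrow> real \<Rightarrow> 'i" where
  "idx I J x = (SOME i. i \<in> I \<and> x \<in> J i)"

text \<open>The map that acts on \<open>J i\<close> as \<open>\<iota> i (b i)\<close>. It is defined for families \<open>J\<close> of pairwise disjoint sets, for which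
the index is unique.\<close>

definition glue :: "'i set \<Rightarrow> ('i \<Rightarrow> real set) \<Rightarrow> ('i \<Rightarrow> 'g \<Rightarrow> real \<Rightarrow> real) \<Rightarrow> ('i \<Rightarrow> 'g) \<Rightarrow> real \<Rightarrow> real" where
  "glue I J \<iota> b x = (if \<exists>i\<in>I. x \<in> J i then \<iota> (idx I J x) (b (idx I J x)) x else x)"

text \<open>Membership of the glued map in the group is proved by removing one non-trivial component after the other; this is where finite
support enters.\<close>

lemma glue_props:
  fixes G :: "'i \<Rightarrow> ('g, 'u) monoid_scheme"
  assumes G: "\<And>i. i \<in> I \<Longrightarrow> group (G i)"
    and \<iota>: "\<And>i. i \<in> I \<Longrightarrow> \<iota> i \<in> hom (G i) Q" "\<And>i. i \<in> I \<Longrightarrow> inj_on (\<iota> i) (carrier (G i))"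
    and supp: "\<And>i g x. i \<in> I \<Longrightarrow> g \<in> carrier (G i) \<Longrightarrow> x \<notin> J i \<Longrightarrow> \<iota> i g x = x"
    and disj: "\<And>i j. i \<in> I \<Longrightarrow> j \<in> I \<Longrightarrow> i \<noteq> j \<Longrightarrow> J i \<inter> J j = {}"
  shows "glue I J \<iota> \<in> hom (sum_group I G) Q" "inj_on (glue I J \<iota>) (carrier (sum_group I G))"
    and "\<And>b i x. i \<in> I \<Longrightarrow> x \<in> J i \<Longrightarrow> glue I J \<iota> b x = \<iota> i (b i) x"
    and "\<And>b x. (\<And>i. i \<in> I \<Longrightarrow> x \<notin> J i) \<Longrightarrow> glue I J \<iota> b x = x"
proof -
  have idx: "idx I J x = i" if "i \<in> I" "x \<in> J i" for i x
    unfolding idx_def by (rule some_equality) (use that disj in blast)+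
  show in_J: "glue I J \<iota> b x = \<iota> i (b i) x" if "i \<in> I" "x \<in> J i" for b i x
    using idx[OF that] that by (auto simp: glue_def)
  show not_J: "glue I J \<iota> b x = x" if "\<And>i. i \<in> I \<Longrightarrow> x \<notin> J i" for b x
    using that by (auto simp: glue_def)
  have \<iota>_Q: "\<iota> i g \<in> carrier Q" if "i \<in> I" "g \<in> carrier (G i)" for i g
    using \<iota>(1)[OF that(1)] that(2) by (auto simp: hom_def)
  have \<iota>_one: "\<iota> i \<one>\<^bsub>G i\<^esub> = id" if "i \<in> I" for i
    using hom_one[OF \<iota>(1)[OF that] G[OF that] group_PL] by simp
  have \<iota>_mult: "\<iota> i (g \<otimes>\<^bsub>G i\<^esub> h) = \<iota> i g \<circ> \<iota> i h" if "i \<in> I" "g \<in> carrier (G i)" "h \<in> carrier (G i)" for i g h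
    using \<iota>(1)[OF that(1)] that(2,3) by (auto simp: hom_def)
  have maps: "\<iota> i g x \<in> J i" if i: "i \<in> I" "g \<in> carrier (G i)" "x \<in> J i" for i g x
  proof (rule ccontr)
    assume "\<iota> i g x \<notin> J i"
    then have "\<iota> i g (\<iota> i g x) = \<iota> i g x" by (rule supp[OF i(1,2)])
    then have "\<iota> i g x = x" using PL_eq_iff[OF \<iota>_Q[OF i(1,2)]] by blast
    then show False using \<open>\<iota> i g x \<notin> J i\<close> i(3) by simp
  qed
  have glue_Q: "glue I J \<iota> b \<in> carrier Q"
    if "finite A" "A \<subseteq> I" "\<And>i. i \<in> I \<Longrightarrow> b i \<in> carrier (G i)" "\<And>i. i \<in> I \<Longrightarrow> i \<notin> A \<Longrightarrow> b i = \<one>\<^bsub>G i\<^esub>" for A b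
    using that
  proof (induction A arbitrary: b rule: finite_induct)
    case empty
    have "glue I J \<iota> b = id"
    proof
      fix x
      show "glue I J \<iota> b x = id x"
      proof (cases "\<exists>i\<in>I. x \<in> J i")
        case True
        then obtain i where "i \<in> I" "x \<in> J i" by blast
        then show ?thesis using in_J[of i x b] empty.prems(3)[of i] \<iota>_one[of i] by simp
      qed (use not_J in auto)
    qed
    then show ?case using PL_id by (simp only:)
  next
    case (insert i A)
    let ?b = "b(i := \<one>\<^bsub>G i\<^esub>)"
    have i: "i \<in> I" using insert.prems(1) by simp
    interpret Gi: group "G i" by (rule G[OF i])
    have "glue I J \<iota> ?b \<in> carrier Q"
      by (rule insert.IH) (use insert.prems in auto)
    moreover have "glue I J \<iota> b = \<iota> i (b i) \<circ> glue I J \<iota> ?b"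
    proof
      fix x
      show "glue I J \<iota> b x = (\<iota> i (b i) \<circ> glue I J \<iota> ?b) x"
      proof (cases "\<exists>j\<in>I. x \<in> J j")
        case True
        then obtain j where j: "j \<in> I" "x \<in> J j" by blast
        show ?thesis
        proof (cases "j = i")
          case True
          then show ?thesis using in_J[OF j, of b] in_J[OF j, of ?b] \<iota>_one[OF i] by simp
        next
          case False
          have "\<iota> j (b j) x \<in> J j" by (rule maps[OF j(1) insert.prems(2)[OF j(1)] j(2)])
          then have "\<iota> j (b j) x \<notin> J i" using disj[OF i j(1)] False by auto
          then have "\<iota> i (b i) (\<iota> j (b j) x) = \<iota> j (b j) x"
            by (rule supp[OF i insert.prems(2)[OF i]])
          then show ?thesis using in_J[OF j, of b] in_J[OF j, of ?b] False by simp
        qed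
      next
        case False
        have "\<iota> i (b i) x = x" by (rule supp[OF i insert.prems(2)[OF i]]) (use False i in blast)
        then show ?thesis using not_J[of x b] not_J[of x ?b] False by auto
      qed
    qed
    ultimately show ?case using PL_comp[OF \<iota>_Q[OF i insert.prems(2)[OF i]]] by (simp only:)
  qed
  note car = carrier_sum_group[of I G, OF G]
  show "glue I J \<iota> \<in> hom (sum_group I G) Q"
  proof (rule homI)
    fix b assume "b \<in> carrier (sum_group I G)"
    then show "glue I J \<iota> b \<in> carrier Q"
      by (intro glue_Q[of "{i\<in>I. b i \<noteq> \<one>\<^bsub>G i\<^esub>}"]) (auto simp: car)
  next
    fix b c assume bc: "b \<in> carrier (sum_group I G)" "c \<in> carrier (sum_group I G)"
    then have mem: "b i \<in> carrier (G i)" "c i \<in> carrier (G i)" if "i \<in> I" for i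
      using that by (auto simp: car)
    show "glue I J \<iota> (b \<otimes>\<^bsub>sum_group I G\<^esub> c) = glue I J \<iota> b \<otimes>\<^bsub>Q\<^esub> glue I J \<iota> c"
    proof
      fix x
      show "glue I J \<iota> (b \<otimes>\<^bsub>sum_group I G\<^esub> c) x = (glue I J \<iota> b \<otimes>\<^bsub>Q\<^esub> glue I J \<iota> c) x"
      proof (cases "\<exists>i\<in>I. x \<in> J i")
        case True
        then obtain i where i: "i \<in> I" "x \<in> J i" by blast
        have "\<iota> i (c i) x \<in> J i" by (rule maps[OF i(1) mem(2)[OF i(1)] i(2)])
        then show ?thesis
          using in_J[OF i, of "b \<otimes>\<^bsub>sum_group I G\<^esub> c"] in_J[OF i, of c] in_J[OF i(1), of "\<iota> i (c i) x" b]
            \<iota>_mult[OF i(1) mem(1)[OF i(1)] mem(2)[OF i(1)]] i(1) by simp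
      next
        case False
        then show ?thesis
          using not_J[of x "b \<otimes>\<^bsub>sum_group I G\<^esub> c"] not_J[of x b] not_J[of x c] by auto
      qed
    qed
  qed
  show "inj_on (glue I J \<iota>) (carrier (sum_group I G))"
  proof (rule inj_onI)
    fix b c assume bc: "b \<in> carrier (sum_group I G)" "c \<in> carrier (sum_group I G)" "glue I J \<iota> b = glue I J \<iota> c"
    have eq: "b i = c i" if i: "i \<in> I" for i
    proof -
      have mem: "b i \<in> carrier (G i)" "c i \<in> carrier (G i)" using bc i by (auto simp: car)
      have "\<iota> i (b i) x = \<iota> i (c i) x" for x
        using in_J[OF i, of x b] in_J[OF i, of x c] supp[OF i mem(1), of x] supp[OF i mem(2), of x] bc(3)
        by (cases "x \<in> J i") auto
      then have "\<iota> i (b i) = \<iota> i (c i)" by blast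
      then show ?thesis using inj_onD[OF \<iota>(2)[OF i] _ mem] by blast
    qed
    have "b \<in> extensional I" "c \<in> extensional I" using bc by (auto simp: car PiE_def)
    then show "b = c" using eq by (rule extensionalityI)
  qed
qed

text \<open>Conjugation with the affine map that takes \<open>[0,1]\<close> to the interval of length \<open>r\<^sup>k\<close> starting at \<open>u\<close>.\<close>

definition shrink :: "real \<Rightarrow> int \<Rightarrow> (real \<Rightarrow> real) \<Rightarrow> real \<Rightarrow> real" where
  "shrink u k f x = u + r powi k * f (r powi (- k) * (x - u))"

lemma shrink_Q:
  assumes u: "u \<in> D" "0 \<le> u" "u + r powi k \<le> 1" and f: "f \<in> carrier Q"
  shows "shrink u k f \<in> carrier Q"
proof (rule PL_I)
  let ?y = "\<lambda>x. r powi (- k) * (x - u)"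
  have y: "u + r powi k * ?y x = x" for x by (simp add: r_powi_cancel(2))
  have y_less: "?y x < ?y x' \<longleftrightarrow> x < x'" for x x' using r_pos[of "- k"] by simp
  show "strict_mono (shrink u k f)"
    by (rule strict_monoI) (use PL_less_iff[OF f] y_less r_pos[of k] in \<open>simp add: shrink_def\<close>)
  have "\<exists>x. shrink u k f x = z" for z
  proof -
    obtain w where w: "f w = ?y z" using PL_D(2)[OF f] by (metis surjD)
    have "shrink u k f (u + r powi k * w) = z"
      by (simp add: shrink_def r_powi_cancel w)
    then show ?thesis ..
  qed
  then show "surj (shrink u k f)" by (metis surj_def)
  show "shrink u k f x = x" if x: "x \<notin> {0..1}" for x
  proof -
    have "?y x \<notin> {0..1}"
    proof
      assume "?y x \<in> {0..1}"
      then have "0 \<le> r powi k * ?y x" "r powi k * ?y x \<le> r powi k * 1"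
        using r_pos[of k] by (auto intro!: mult_left_mono mult_nonneg_nonneg simp del: r_pos)
      then have "u \<le> x" "x \<le> u + r powi k" using y[of x] by linarith+
      then show False using u x by auto
    qed
    then have "f (?y x) = ?y x" by (rule PL_D(5)[OF f])
    then show ?thesis using y[of x] by (simp only: shrink_def)
  qed
  have slope: "has_slope r (shrink u k f) x \<sigma> l" if "has_slope r f (?y x) \<sigma> l" for x \<sigma> l
  proof -
    have "\<forall>\<^sub>F t in at_right 0. f (?y x + \<sigma> * (r powi (- k) * t)) = f (?y x) + \<sigma> * (r powi l * (r powi (- k) * t))"
      using that unfolding has_slope_def by (rule eventually_compose_filterlim[OF _ filterlim_scale])
    then show ?thesis unfolding has_slope_def
    proof eventually_elim
      case (elim t)
      have 1: "?y (x + \<sigma> * t) = ?y x + \<sigma> * (r powi (- k) * t)" by (simp add: algebra_simps)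
      have "r powi k * (f (?y x) + \<sigma> * (r powi l * (r powi (- k) * t)))
          = r powi k * f (?y x) + \<sigma> * (r powi l * (r powi k * (r powi (- k) * t)))"
        by (simp add: algebra_simps)
      then show ?case
        unfolding shrink_def 1 elim by (simp add: r_powi_cancel(2))
    qed
  qed
  show "\<exists>l. affine_germ r D (shrink u k f) x \<sigma> l" if \<sigma>: "\<sigma> \<in> {1,-1}" for x \<sigma>
  proof -
    obtain l where l: "has_slope r f (?y x) \<sigma> l" "f (?y x) - r powi l * ?y x \<in> D"
      using PL_D(6)[OF f \<sigma>] by blast
    have "(u - r powi l * u) + r powi k * (f (?y x) - r powi l * ?y x) \<in> D"
      using l u by (intro D_add D_diff[OF u(1) D_scale[OF u(1)]] D_scale)
    also have "(u - r powi l * u) + r powi k * (f (?y x) - r powi l * ?y x)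
        = shrink u k f x - r powi l * (u + r powi k * ?y x)"
      by (simp add: shrink_def algebra_simps)
    finally show ?thesis using slope[OF l(1)] unfolding y by blast
  qed
  show "\<exists>l. \<forall>\<sigma>\<in>{1,-1}. has_slope r (shrink u k f) x \<sigma> l" if x: "x \<notin> D" for x
  proof -
    have "?y x \<notin> D"
    proof
      assume "?y x \<in> D"
      then have "u + r powi k * ?y x \<in> D" by (rule D_add[OF u(1) D_scale])
      then show False using x unfolding y by simp
    qed
    then obtain l where "\<forall>\<sigma>\<in>{1,-1}. has_slope r f (?y x) \<sigma> l" using PL_D(7)[OF f] by blast
    then show ?thesis using slope by blast
  qed
qed

lemma shrink_comp: "shrink u k (f \<circ> g) = shrink u k f \<circ> shrink u k g"
  by (simp add: shrink_def fun_eq_iff r_powi_cancel(1))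

lemma shrink_inj: "shrink u k f = shrink u k g \<Longrightarrow> f = g"
proof
  fix y assume "shrink u k f = shrink u k g"
  from fun_cong[OF this, of "u + r powi k * y"] show "f y = g y"
    using r_gt_1 by (auto simp: shrink_def r_powi_cancel(1))
qed

end

definition increasing_on :: "(real \<Rightarrow> real) \<Rightarrow> real \<Rightarrow> real \<Rightarrow> bool" where
  "increasing_on f l h \<longleftrightarrow> (\<forall>x y. l \<le> x \<and> x < y \<and> y \<le> h \<longrightarrow> f x < f y)"

lemma increasing_on_join:
  assumes "increasing_on f l m" "increasing_on f m h"
  shows "increasing_on f l h"
  unfolding increasing_on_def
proof (intro allI impI)
  fix x y assume xy: "l \<le> x \<and> x < y \<and> y \<le> h"
  consider "y \<le> m" | "m \<le> x" | "x < m" "m < y" by linarith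
  then show "f x < f y"
  proof cases
    case 3
    then have "f x < f m" "f m < f y"
      using assms xy unfolding increasing_on_def by auto
    then show ?thesis by simp
  qed (use assms xy in \<open>auto simp: increasing_on_def\<close>)
qed

context scaling begin

lemma affine_piece:
  assumes affine: "\<forall>x. l \<le> x \<and> x \<le> h \<longrightarrow> f x = r powi k * x + m" and m: "m \<in> D"
  shows "increasing_on f l h"
    "l \<le> x \<Longrightarrow> x < h \<Longrightarrow> affine_germ r D f x 1 k"
    "l < x \<Longrightarrow> x \<le> h \<Longrightarrow> affine_germ r D f x (-1) k"
    "r powi k * l + m \<le> y \<Longrightarrow> y \<le> r powi k * h + m \<Longrightarrow> \<exists>x. f x = y"
proof -
  note assms = affine[rule_format, OF conjI] m
  show "increasing_on f l h"
    unfolding increasing_on_def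
  proof (intro allI impI)
    fix x y assume "l \<le> x \<and> x < y \<and> y \<le> h"
    then show "f x < f y" using assms(1)[of x] assms(1)[of y] r_pos[of k] by simp
  qed
  show "affine_germ r D f x 1 k" if x: "l \<le> x" "x < h"
  proof
    show "f x - r powi k * x \<in> D" using assms x by simp
    show "has_slope r f x 1 k"
      unfolding has_slope_def eventually_at_right_field
    proof (intro exI[of _ "h - x"] conjI allI impI)
      fix t assume "0 < t" "t < h - x"
      then show "f (x + 1 * t) = f x + 1 * (r powi k * t)"
        using assms(1)[of x] assms(1)[of "x + t"] x by (simp add: algebra_simps)
    qed (use x in simp)
  qed
  show "affine_germ r D f x (-1) k" if x: "l < x" "x \<le> h"
  proof
    show "f x - r powi k * x \<in> D" using assms x by simp
    show "has_slope r f x (-1) k"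
      unfolding has_slope_def eventually_at_right_field
    proof (intro exI[of _ "x - l"] conjI allI impI)
      fix t assume "0 < t" "t < x - l"
      then show "f (x + (-1) * t) = f x + (-1) * (r powi k * t)"
        using assms(1)[of x] assms(1)[of "x - t"] x by (simp add: algebra_simps)
    qed (use x in simp)
  qed
  show "\<exists>x. f x = y" if y: "r powi k * l + m \<le> y" "y \<le> r powi k * h + m"
  proof
    let ?x = "r powi (- k) * (y - m)"
    have "r powi k * l \<le> r powi k * ?x" "r powi k * ?x \<le> r powi k * h"
      unfolding r_powi_cancel(2) using y by linarith+
    then have "l \<le> ?x" "?x \<le> h" using r_pos[of k] by (auto simp del: r_pos)
    then have "f ?x = r powi k * ?x + m" by (rule assms(1))
    then show "f ?x = y" unfolding r_powi_cancel(2) by simp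
  qed
qed

text \<open>An element whose graph has the slopes \<open>r\<close>, \<open>1\<close> and \<open>1/r\<close>; the middle piece is moved to the right, so that a
suitable small interval starting at \<open>r\<^sup>-\<^sup>2\<close> is disjoint from all its translates (\<open>shift_displaces\<close>).\<close>

definition shift :: "real \<Rightarrow> real" where
  "shift x = (if x \<le> 0 then x
     else if x \<le> r powi (-2) then r * x
     else if x \<le> 1 - r powi (-1) then x + (r powi (-1) - r powi (-2))
     else if x \<le> 1 then r powi (-1) * x + (1 - r powi (-1)) else x)"

lemma shift_Q:
  assumes r2: "r \<ge> 2"
  shows "shift \<in> carrier Q"
proof -
  define \<rho> where "\<rho> = r powi (-1)"
  define w where "w = \<rho> * \<rho>"
  have p: "r powi (-2) = w" unfolding w_def \<rho>_def using r_gt_1 by (simp add: power_int_minus power2_eq_square)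
  have \<rho>1: "r powi (-1) = \<rho>" by (simp add: \<rho>_def)
  have \<rho>: "0 < \<rho>" "\<rho> \<le> 1/2" "r * \<rho> = 1"
    using r2 by (auto simp: \<rho>_def power_int_minus field_simps)
  have rp: "r * (w) = \<rho>" using \<rho>(3) by (simp add: w_def)
  have \<rho>\<rho>: "w \<le> 1 / 2 * \<rho>" unfolding w_def using \<rho> by (intro mult_right_mono) auto
  then have pq: "0 < w" "w < 1 - \<rho>" "1 - \<rho> < 1" using \<rho> \<rho>\<rho> by (simp add: w_def, linarith, simp)
  have \<rho>D: "\<rho> \<in> D" unfolding \<rho>_def using D_scale[OF D_1, of "-1"] by simp
  have pD: "w \<in> D" using D_scale[OF \<rho>D, of "-1"] unfolding \<rho>1 w_def .
  note def = shift_def[unfolded p \<rho>1]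
  have P1: "\<forall>x. l \<le> x \<and> x \<le> 0 \<longrightarrow> shift x = r powi 0 * x + 0" for l by (simp add: def)
  have P2: "\<forall>x. 0 \<le> x \<and> x \<le> w \<longrightarrow> shift x = r powi 1 * x + 0" by (simp add: def)
  have P3: "\<forall>x. w \<le> x \<and> x \<le> 1 - \<rho> \<longrightarrow> shift x = r powi 0 * x + (\<rho> - w)"
    using pq rp by (auto simp: def)
  have "shift x = r powi (-1) * x + (1 - \<rho>)" if "1 - \<rho> \<le> x" "x \<le> 1" for x
  proof (cases "x = 1 - \<rho>")
    case True
    then have "shift x = x + (\<rho> - w)" using pq by (simp add: def)
    then show ?thesis unfolding \<rho>1 by (simp add: True w_def algebra_simps)
  qed (use that pq \<rho>1 in \<open>simp add: def\<close>)
  then have P4: "\<forall>x. 1 - \<rho> \<le> x \<and> x \<le> 1 \<longrightarrow> shift x = r powi (-1) * x + (1 - \<rho>)" by blast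
  have P5: "\<forall>x. 1 \<le> x \<and> x \<le> h \<longrightarrow> shift x = r powi 0 * x + 0" for h
    using pq by (auto simp: def)
  have m: "0 \<in> D" "\<rho> - w \<in> D" "1 - \<rho> \<in> D"
    using D_0 D_diff[OF \<rho>D pD] D_diff[OF D_1 \<rho>D] by auto
  note A1 = affine_piece[OF P1 m(1)] and A2 = affine_piece[OF P2 m(1)] and A3 = affine_piece[OF P3 m(2)]
    and A4 = affine_piece[OF P4 m(3)] and A5 = affine_piece[OF P5 m(1)]
  show ?thesis
  proof (rule PL_I)
    show "strict_mono shift"
    proof (rule strict_monoI)
      fix x y :: real assume xy: "x < y"
      have "increasing_on shift (min x 0) (max y 1)"
        by (rule increasing_on_join[OF A1(1) increasing_on_join[OF A2(1) increasing_on_join[OF A3(1)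
              increasing_on_join[OF A4(1) A5(1)]]]])
      then show "shift x < shift y" using xy unfolding increasing_on_def by auto
    qed
    have "\<exists>x. shift x = y" for y
    proof -
      consider "y \<le> 0" | "0 \<le> y" "y \<le> \<rho>" | "\<rho> \<le> y" "y \<le> 1 - w" | "1 - w \<le> y" "y \<le> 1" | "1 \<le> y"
        by linarith
      then show ?thesis
      proof cases
        case 1 then show ?thesis by (intro exI[of _ y]) (simp add: def)
      next
        case 2 then show ?thesis by (intro A2(4)) (simp_all add: rp)
      next
        case 3 then show ?thesis by (intro A3(4)) simp_all
      next
        case 4 then show ?thesis by (intro A4(4)) (unfold \<rho>1 w_def, simp_all add: algebra_simps)
      next
        case 5
        show ?thesis by (rule A5(4)[where h = y]) (use 5 in simp_all)
      qed
    qed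
    then show "surj shift" by (metis surj_def)
    show "shift x = x" if "x \<notin> {0..1}" for x using that pq by (auto simp: def)
    note R = A1(2)[OF order_refl] A2(2) A3(2) A4(2) A5(2)[OF _ less_add_one]
    have "x - 1 < x" for x :: real by simp
    note L = A1(3)[OF this] A2(3) A3(3) A4(3) A5(3)[OF _ order_refl]
    have right: "\<exists>k. affine_germ r D shift x 1 k" for x
    proof -
      consider "x < 0" | "0 \<le> x" "x < w" | "w \<le> x" "x < 1 - \<rho>" | "1 - \<rho> \<le> x" "x < 1" | "1 \<le> x"
        by linarith
      then show ?thesis by cases (use R in blast)+
    qed
    have left: "\<exists>k. affine_germ r D shift x (-1) k" for x
    proof -
      consider "x \<le> 0" | "0 < x" "x \<le> w" | "w < x" "x \<le> 1 - \<rho>" | "1 - \<rho> < x" "x \<le> 1" | "1 < x"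
        by linarith
      then show ?thesis by cases (use L in blast)+
    qed
    show "\<exists>k. affine_germ r D shift x \<sigma> k" if "\<sigma> \<in> {1,-1}" for x \<sigma>
      using that left right by auto
    show "\<exists>k. \<forall>\<sigma>\<in>{1,-1}. has_slope r shift x \<sigma> k" if x: "x \<notin> D" for x
    proof -
      have "x \<noteq> 0" "x \<noteq> w" "x \<noteq> 1 - \<rho>" "x \<noteq> 1" using x m pD D_1 by auto
      then consider "x < 0" | "0 < x" "x < w" | "w < x" "x < 1 - \<rho>" | "1 - \<rho> < x" "x < 1" | "1 < x"
        by linarith
      then have "\<exists>k. has_slope r shift x 1 k \<and> has_slope r shift x (-1) k"
      proof cases
        case 1 then show ?thesis using R(1)[of x] L(1)[of x] by auto
      next
        case 2 then show ?thesis using R(2)[of x] L(2)[of x] by auto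
      next
        case 3 then show ?thesis using R(3)[of x] L(3)[of x] by auto
      next
        case 4 then show ?thesis using R(4)[of x] L(4)[of x] by auto
      next
        case 5 then show ?thesis using R(5)[of x] L(5)[of x] by auto
      qed
      then show ?thesis by simp
    qed
  qed
qed

lemma shift_displaces:
  assumes r2: "r \<ge> 2"
  shows "r powi (-2) + r powi (-3) \<le> shift (r powi (-2))" "r powi (-2) + r powi (-3) \<le> 1"
proof -
  define \<rho> where "\<rho> = r powi (-1)"
  define w where "w = \<rho> * \<rho>"
  have p: "r powi (-2) = w" "r powi (-3) = w * \<rho>" unfolding w_def \<rho>_def using r_gt_1
    by (simp_all add: power_int_minus power2_eq_square power3_eq_cube)
  have \<rho>: "0 < \<rho>" "\<rho> \<le> 1/2" "r * \<rho> = 1"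
    using r2 by (auto simp: \<rho>_def power_int_minus field_simps)
  have \<rho>\<rho>: "w \<le> 1 / 2 * \<rho>" unfolding w_def using \<rho> by (intro mult_right_mono) auto
  moreover have "w * \<rho> \<le> w * (1 / 2)" using \<rho>(2) by (intro mult_left_mono) (auto simp: w_def)
  ultimately have le: "w + w * \<rho> \<le> \<rho>" using \<rho>(1) by linarith
  have neg: "\<not> w \<le> 0" using mult_pos_pos[OF \<rho>(1) \<rho>(1)] unfolding w_def[symmetric] by linarith
  have "shift (r powi (-2)) = r * (w)" using neg unfolding shift_def p by simp
  also have "\<dots> = \<rho>" using \<rho>(3) by (simp add: w_def)
  finally show "r powi (-2) + r powi (-3) \<le> shift (r powi (-2))" using le p by simp
  show "r powi (-2) + r powi (-3) \<le> 1" using le \<rho> p by simp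
qed

end

context thompson begin

lemma PL_at_01: "f \<in> carrier T \<Longrightarrow> y < 0 \<or> 1 \<le> y \<Longrightarrow> f y = y"
  using PL_D(5)[of f D y] T_01(2)[of f] by (cases "y = 1") auto

lemma shrink_supp:
  assumes f: "f \<in> carrier T" and x: "x \<notin> {u..<u + base powi k}"
  shows "shrink u k f x = x"
proof -
  let ?y = "base powi (- k) * (x - u)"
  have y: "u + base powi k * ?y = x" by (simp add: r_powi_cancel(2))
  have "?y < 0 \<or> 1 \<le> ?y"
  proof (rule ccontr)
    assume "\<not> ?thesis"
    then have "0 \<le> base powi k * ?y" "base powi k * ?y < base powi k * 1"
      using r_pos[of k] by (auto intro!: mult_strict_left_mono mult_nonneg_nonneg simp del: r_pos simp: r_pos[of k] less_imp_le)
    then have "u \<le> x" "x < u + base powi k" using y by linarith+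
    then show False using x by auto
  qed
  then have "f ?y = ?y" by (rule PL_at_01[OF f])
  then show ?thesis using y by (simp only: shrink_def)
qed

lemma embeds_shrink:
  assumes h: "h \<in> hom K T" "inj_on h (carrier K)" and u: "u \<in> D" "0 \<le> u" "u + base powi k \<le> 1"
  shows "(\<lambda>g. shrink u k (h g)) \<in> hom K T" "inj_on (\<lambda>g. shrink u k (h g)) (carrier K)"
proof -
  show "(\<lambda>g. shrink u k (h g)) \<in> hom K T"
    by (rule homI) (use h(1) shrink_Q[OF u] in \<open>auto simp: hom_def shrink_comp\<close>)
  show "inj_on (\<lambda>g. shrink u k (h g)) (carrier K)"
    by (rule inj_onI) (use shrink_inj h(2) in \<open>auto simp: inj_on_def\<close>)
qed

text \<open>The \<open>i\<close>-th summand is scaled into the interval of length \<open>n\<^sup>-\<^sup>(\<^sup>i\<^sup>+\<^sup>2\<^sup>)\<close> starting at \<open>n\<^sup>-\<^sup>(\<^sup>i\<^sup>+\<^sup>1\<^sup>)\<close>. These intervals are disjoint as \<open>n \<ge> 2\<close>.\<close>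

lemma embeds_sum:
  fixes G :: "nat \<Rightarrow> ('g, 'u) monoid_scheme"
  assumes G: "\<And>i. i \<in> I \<Longrightarrow> group (G i)" and emb: "\<And>i. i \<in> I \<Longrightarrow> embeds (G i) T"
  shows "embeds (sum_group I G) T"
proof -
  have "\<exists>h. \<forall>i\<in>I. h i \<in> hom (G i) T \<and> inj_on (h i) (carrier (G i))"
    using emb by (intro bchoice) (auto simp: embeds_def)
  then obtain h where h: "\<forall>i\<in>I. h i \<in> hom (G i) T \<and> inj_on (h i) (carrier (G i))" by (rule exE)
  define u where "u i = base powi (- int i - 1)" for i
  define k where "k i = - int i - 2" for i
  define \<iota> where "\<iota> i g = shrink (u i) (k i) (h i g)" for i g
  define J where "J i = {u i..<u i + base powi k i}" for i
  have b2: "base \<ge> 2" using n_ge_2 by simp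
  have uD: "u i \<in> D" for i unfolding u_def using D_scale[OF D_1] by simp
  have u0: "0 \<le> u i" for i unfolding u_def using r_pos by (simp add: less_imp_le)
  have step: "u (Suc i) = base powi k i" for i
    unfolding u_def k_def by (rule arg_cong[where f = "\<lambda>t. base powi t"]) simp
  have half: "u (Suc i) \<le> u i / 2" for i
  proof -
    have "u i = base powi (1 + (- int (Suc i) - 1))"
      unfolding u_def by (rule arg_cong[where f = "\<lambda>t. base powi t"]) simp
    also have "\<dots> = base powi 1 * u (Suc i)"
      unfolding u_def by (rule power_int_add) (use r_gt_1 in auto)
    finally have "u i = base * u (Suc i)" by simp
    moreover have "2 * u (Suc i) \<le> base * u (Suc i)" using b2 u0 by (intro mult_right_mono)
    ultimately show ?thesis by simp
  qed
  have anti: "u j \<le> u i" if "i \<le> j" for i j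
    using that
  proof (induction rule: dec_induct)
    case (step m)
    then show ?case using half[of m] u0[of m] by linarith
  qed simp
  have "u 0 \<le> 1/2" using b2 by (simp add: u_def power_int_minus field_simps)
  then have u1: "u i + base powi k i \<le> 1" for i
    using half[of i] anti[of 0 i] u0[of i] step[of i] by linarith
  have below: "u j + base powi k j \<le> u i" if "i < j" for i j
    using anti[of "Suc i" j] that half[of i] half[of j] u0[of j] step[of j] by linarith
  have disj: "J i \<inter> J j = {}" if "i \<noteq> j" for i j
    using that below[of i j] below[of j i] by (cases i j rule: linorder_cases) (auto simp: J_def)
  have \<iota>: "\<iota> i \<in> hom (G i) T" "inj_on (\<iota> i) (carrier (G i))" if "i \<in> I" for i
    using embeds_shrink[OF _ _ uD u0 u1] bspec[OF h that] unfolding \<iota>_def by blast+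
  have supp: "\<iota> i g x = x" if "i \<in> I" "g \<in> carrier (G i)" "x \<notin> J i" for i g x
    unfolding \<iota>_def by (rule shrink_supp) (use bspec[OF h that(1)] that in \<open>auto simp: hom_def J_def\<close>)
  show ?thesis
    by (rule embedsI; rule glue_props[of I G \<iota> J]) (fact G \<iota> supp | rule disj; assumption)+
qed

end

context thompson begin

text \<open>Scale \<open>K\<close> into the interval \<open>[u,v)\<close>, whose translates by \<open>c = shift\<close> are disjoint. The copy with index \<open>s\<close> acts
on \<open>c\<^sup>-\<^sup>s [u,v)\<close>; with this sign conjugation by \<open>c\<^sup>t\<close> moves the entry at \<open>s + t\<close> to \<open>s\<close>, which is
the action in the wreath product. The exponent of \<open>c\<close> can be read off at \<open>u\<close>: the glued maps fix the orbit of \<open>u\<close>,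
on which \<open>c\<close> acts freely.\<close>

lemma embeds_wreath:
  assumes K: "group K" and emb: "embeds K T"
  shows "embeds (wreath_Z K) T"
proof -
  interpret T: group T by (rule group_PL)
  obtain h where h: "h \<in> hom K T" "inj_on h (carrier K)" using emb by (auto simp: embeds_def)
  define u where "u = base powi (-2)"
  define v where "v = u + base powi (-3)"
  have b2: "base \<ge> 2" using n_ge_2 by simp
  have cT: "shift \<in> carrier T" by (rule shift_Q[OF b2])
  have v: "v \<le> shift u" "v \<le> 1" using shift_displaces[OF b2] by (auto simp: u_def v_def)
  have uD: "u \<in> D" unfolding u_def using D_scale[OF D_1] by simp
  have u0: "0 \<le> u" unfolding u_def using r_pos by (simp add: less_imp_le)
  have uv: "u < v" unfolding v_def using r_pos by simp
  define cp where "cp t = shift [^]\<^bsub>T\<^esub> (t :: int)" for t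
  have cpT: "cp t \<in> carrier T" for t unfolding cp_def using cT by simp
  have merge: "cp s (cp t y) = cp (s + t) y" for s t y
    using T.int_pow_mult[OF cT, of s t] by (simp add: cp_def)
  have comp: "cp s \<circ> cp t = cp (s + t)" for s t by (rule ext) (simp add: merge)
  have cp0: "cp 0 y = y" for y unfolding cp_def using cT by simp
  have cp1: "cp 1 = shift" unfolding cp_def using cT by simp
  have cp_less: "cp t x < cp t y \<longleftrightarrow> x < y" for t x y by (rule PL_less_iff[OF cpT])
  have cp_le: "cp t x \<le> cp t y \<longleftrightarrow> x \<le> y" for t x y by (rule PL_le_iff[OF cpT])
  have up: "v \<le> cp (1 + int m) u" for m
  proof (induction m)
    case 0
    then show ?case using v(1) by (simp add: cp1)
  next
    case (Suc m)
    have "u \<le> cp (1 + int m) u" using Suc uv by linarith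
    then have "cp 1 u \<le> cp 1 (cp (1 + int m) u)" using cp_le by blast
    also have "cp 1 (cp (1 + int m) u) = cp (1 + int (Suc m)) u"
      unfolding merge by (rule arg_cong[where f = "\<lambda>t. cp t u"]) simp
    finally show ?case using v(1) unfolding cp1 by linarith
  qed
  have displace: "v \<le> cp k y" if "0 < k" "u \<le> y" for k y
  proof -
    have "v \<le> cp k u" using up[of "nat (k - 1)"] that(1) by simp
    also have "\<dots> \<le> cp k y" using that(2) cp_le by blast
    finally show ?thesis .
  qed
  define \<iota> where "\<iota> s g = cp (- s) \<circ> shrink u (-3) (h g) \<circ> cp s" for s g
  define J where "J s = {x. cp s x \<in> {u..<v}}" for s
  have hT: "h g \<in> carrier T" if "g \<in> carrier K" for g using h(1) that by (auto simp: hom_def)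
  note sh = embeds_shrink[OF h uD u0, of "-3", folded v_def, OF v(2)]
  have shT: "shrink u (-3) (h g) \<in> carrier T" if "g \<in> carrier K" for g
    using sh(1) that by (auto simp: hom_def)
  have supp0: "shrink u (-3) (h g) x = x" if "g \<in> carrier K" "x \<notin> {u..<v}" for g x
    by (rule shrink_supp[OF hT[OF that(1)]]) (use that(2) in \<open>simp add: v_def\<close>)
  have \<iota>: "\<iota> s \<in> hom K T" "inj_on (\<iota> s) (carrier K)" for s
  proof -
    show "\<iota> s \<in> hom K T"
    proof (rule homI)
      show "\<iota> s g \<in> carrier T" if "g \<in> carrier K" for g
        unfolding \<iota>_def by (intro PL_comp cpT shT that)
      show "\<iota> s (g \<otimes>\<^bsub>K\<^esub> g') = \<iota> s g \<otimes>\<^bsub>T\<^esub> \<iota> s g'" if "g \<in> carrier K" "g' \<in> carrier K" for g g'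
        using sh(1) that by (simp add: \<iota>_def hom_def fun_eq_iff merge cp0)
    qed
    show "inj_on (\<iota> s) (carrier K)"
    proof (rule inj_onI)
      fix g g' assume g: "g \<in> carrier K" "g' \<in> carrier K" and eq: "\<iota> s g = \<iota> s g'"
      have "shrink u (-3) (h g) x = shrink u (-3) (h g') x" for x
      proof -
        have "cp (- s) (shrink u (-3) (h g) x) = cp (- s) (shrink u (-3) (h g') x)"
          using fun_cong[OF eq, of "cp (- s) x"] by (simp add: \<iota>_def merge cp0)
        then show ?thesis using PL_eq_iff[OF cpT] by blast
      qed
      then have "shrink u (-3) (h g) = shrink u (-3) (h g')" by blast
      then show "g = g'" using inj_onD[OF sh(2) _ g] by blast
    qed
  qed
  have supp: "\<iota> s g x = x" if "g \<in> carrier K" "x \<notin> J s" for s g x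
    using supp0[OF that(1), of "cp s x"] that(2) by (simp add: \<iota>_def J_def merge cp0)
  have disj: "J s \<inter> J t = {}" if "s \<noteq> t" for s t
  proof -
    have *: "x \<notin> J t" if st: "s < t" and x: "x \<in> J s" for s t x
    proof -
      have "v \<le> cp (t - s) (cp s x)" by (rule displace) (use st x in \<open>auto simp: J_def\<close>)
      then show ?thesis by (simp add: merge J_def)
    qed
    show ?thesis using that *[of s t] *[of t s] by (cases s t rule: linorder_cases) auto
  qed
  define \<phi> where "\<phi> = glue (UNIV :: int set) J \<iota>"
  note gp = glue_props[of "UNIV :: int set" "\<lambda>_. K" \<iota> J, OF K \<iota> supp disj, folded \<phi>_def, simplified]
  have car: "carrier (sum_group (UNIV :: int set) (\<lambda>_. K)) = {b. (\<forall>s. b s \<in> carrier K) \<and> finite {s. b s \<noteq> \<one>\<^bsub>K\<^esub>}}"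
    using K by (auto simp: carrier_sum_group)
  note ws = wreath_int_simps[OF K]
  have \<phi>_T: "\<phi> b \<in> carrier T" if "b \<in> carrier (sum_group (UNIV :: int set) (\<lambda>_. K))" for b
    using gp(1) that by (auto simp: hom_def)
  have conj: "cp t (\<phi> b x) = \<phi> (\<lambda>s. b (s + t)) (cp t x)" for b t x
  proof (cases "\<exists>i. x \<in> J i")
    case True
    then obtain i where i: "x \<in> J i" by blast
    then have "cp t x \<in> J (i - t)" by (simp add: J_def merge)
    then show ?thesis
      unfolding gp(3)[OF i] using gp(3)[of "cp t x" "i - t"] by (simp add: \<iota>_def merge)
  next
    case False
    moreover have "cp t x \<notin> J i" for i
    proof
      assume "cp t x \<in> J i"
      then have "x \<in> J (i + t)" by (simp add: J_def merge)
      then show False using False by blast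
    qed
    ultimately show ?thesis using gp(4)[of x b] gp(4)[of "cp t x"] by simp
  qed
  have \<phi>_u: "\<phi> b (cp t u) = cp t u" if b: "\<And>s. b s \<in> carrier K" for b t
  proof -
    have "cp t u \<in> J (- t)" using uv by (simp add: J_def merge cp0)
    moreover have "shrink u (-3) (h (b (- t))) u = u"
      using T_01(1)[OF hT[OF b]] by (simp add: shrink_def)
    ultimately show ?thesis using gp(3)[of "cp t u" "- t"] by (simp add: \<iota>_def merge cp0)
  qed
  define \<Psi> where "\<Psi> = (\<lambda>(b, t). \<phi> b \<circ> cp t)"
  have "\<Psi> \<in> hom (wreath_Z K) T"
  proof (rule homI)
    fix x assume "x \<in> carrier (wreath_Z K)"
    then show "\<Psi> x \<in> carrier T"
      by (cases x) (auto simp: \<Psi>_def ws car intro!: PL_comp \<phi>_T cpT)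
  next
    fix x y assume xy: "x \<in> carrier (wreath_Z K)" "y \<in> carrier (wreath_Z K)"
    obtain b t c s where x: "x = (b, t)" and y: "y = (c, s)" by (cases x, cases y) auto
    have b: "b \<in> carrier (sum_group (UNIV :: int set) (\<lambda>_. K))"
      and c: "c \<in> carrier (sum_group (UNIV :: int set) (\<lambda>_. K))"
      using xy by (auto simp: x y ws car)
    have "{i. c (i + t) \<noteq> \<one>\<^bsub>K\<^esub>} \<subseteq> (\<lambda>i. i - t) ` {i. c i \<noteq> \<one>\<^bsub>K\<^esub>}"
      by (auto intro!: image_eqI[of _ _ "_ + t"])
    then have "finite {i. c (i + t) \<noteq> \<one>\<^bsub>K\<^esub>}"
      using c by (auto simp: car intro: finite_subset)
    then have c': "(\<lambda>i. c (i + t)) \<in> carrier (sum_group (UNIV :: int set) (\<lambda>_. K))"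
      using c by (simp add: car)
    have "\<phi> (\<lambda>i. b i \<otimes>\<^bsub>K\<^esub> c (i + t)) = \<phi> b \<circ> \<phi> (\<lambda>i. c (i + t))"
      using hom_mult[OF gp(1) b c'] by (simp add: restrict_def)
    then show "\<Psi> (x \<otimes>\<^bsub>wreath_Z K\<^esub> y) = \<Psi> x \<otimes>\<^bsub>T\<^esub> \<Psi> y"
      by (simp add: \<Psi>_def x y ws fun_eq_iff conj merge)
  qed
  moreover have "inj_on \<Psi> (carrier (wreath_Z K))"
  proof (rule inj_onI)
    fix x y assume xy: "x \<in> carrier (wreath_Z K)" "y \<in> carrier (wreath_Z K)"
      and eq: "\<Psi> x = \<Psi> y"
    obtain b t c s where x: "x = (b, t)" and y: "y = (c, s)" by (cases x, cases y) auto
    have b: "b \<in> carrier (sum_group (UNIV :: int set) (\<lambda>_. K))"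
      and c: "c \<in> carrier (sum_group (UNIV :: int set) (\<lambda>_. K))"
      using xy by (auto simp: x y ws car)
    have eq': "\<phi> b (cp t z) = \<phi> c (cp s z)" for z using fun_cong[OF eq, of z] by (simp add: \<Psi>_def x y)
    have ts: "cp t u = cp s u" using eq'[of u] \<phi>_u[of b t] \<phi>_u[of c s] b c by (simp add: car)
    have "\<not> p < q" if "cp p u = cp q u" for p q
    proof
      assume "p < q"
      then have "v \<le> cp (q - p) u" by (intro displace) auto
      then have "u < cp (q - p) u" using uv by linarith
      then have "cp p u < cp p (cp (q - p) u)" using cp_less by blast
      then show False using that by (simp add: merge)
    qed
    from this[OF ts] this[OF ts[symmetric]] have st: "t = s" by linarith
    have "\<phi> b z = \<phi> c z" for z using eq'[of "cp (- t) z"] by (simp add: st merge cp0)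
    then have "\<phi> b = \<phi> c" by blast
    then have "b = c" using inj_onD[OF gp(2) _ b c] by blast
    then show "x = y" using st x y by simp
  qed
  ultimately show ?thesis by (rule embedsI)
qed

definition solvable_subgroup_classes :: "'a::infinite monoid set set" where
  "solvable_subgroup_classes = {H. \<exists>S. subgroup S (F_group n) \<and> solvable (F_group n\<lparr>carrier := S\<rparr>) \<and>
     H = iso_class (F_group n\<lparr>carrier := S\<rparr>)}"

lemma solvable_subgroup_classesI:
  assumes Y: "group Y" "solvable Y" "embeds Y T"
  shows "(iso_class Y :: 'a::infinite monoid set) \<in> solvable_subgroup_classes"
proof -
  have "embeds Y (F_group n)" by (rule embeds_trans[OF Y(3) iso_imp_embeds[OF T_iso_F(1)]])
  then obtain h where h: "h \<in> hom Y (F_group n)" "inj_on h (carrier Y)" by (auto simp: embeds_def)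
  define S where "S = h ` carrier Y"
  note im = embeds_iso_image[OF Y(1) group_F h, folded S_def]
  have iso: "Y \<cong> F_group n\<lparr>carrier := S\<rparr>" using im(2) by (auto simp: is_iso_def)
  have grp: "group (F_group n\<lparr>carrier := S\<rparr>)" by (rule group.subgroup_imp_group[OF group_F im(1)])
  have "solvable (F_group n\<lparr>carrier := S\<rparr>)"
    by (rule solvable_embeds[OF grp Y(1) iso_imp_embeds[OF group.iso_sym[OF Y(1) iso]] Y(2)])
  moreover have "(iso_class Y :: 'a monoid set) = iso_class (F_group n\<lparr>carrier := S\<rparr>)"
    by (rule iso_class_cong[OF Y(1) iso])
  ultimately show ?thesis using im(1) unfolding solvable_subgroup_classes_def by blast
qed

lemma solvable_subgroup_classesD:
  assumes "K \<in> \<Union> (solvable_subgroup_classes :: 'a::infinite monoid set set)"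
  shows "group K" "solvable K" "embeds K T"
proof -
  obtain S where S: "subgroup S (F_group n)" "solvable (F_group n\<lparr>carrier := S\<rparr>)"
    "K \<in> iso_class (F_group n\<lparr>carrier := S\<rparr>)"
    using assms unfolding solvable_subgroup_classes_def by blast
  then have K: "group K" "K \<cong> F_group n\<lparr>carrier := S\<rparr>" by (auto simp: iso_class_def)
  have grp: "group (F_group n\<lparr>carrier := S\<rparr>)" by (rule group.subgroup_imp_group[OF group_F S(1)])
  note emb = iso_imp_embeds[OF K(2)]
  show "group K" by (rule K(1))
  show "solvable K" by (rule solvable_embeds[OF K(1) grp emb S(2)])
  show "embeds K T"
    by (rule embeds_trans[OF emb embeds_trans[OF embeds_carrier_subset[OF subgroup.subset[OF S(1)]]
      iso_imp_embeds[OF T_iso_F(2)]]])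
qed

text \<open>Countability enters in the first condition: every subgroup must have a copy on the given infinite type.\<close>

lemma closed_family_solvable_subgroup_classes:
  "closed_family (solvable_subgroup_classes :: 'a::infinite monoid set set)"
proof
  let ?C = "solvable_subgroup_classes :: 'a monoid set set"
  show "?C \<subseteq> iso_classes"
  proof
    fix H assume "H \<in> ?C"
    then obtain S where S: "subgroup S (F_group n)" "H = iso_class (F_group n\<lparr>carrier := S\<rparr>)"
      unfolding solvable_subgroup_classes_def by blast
    have "countable (carrier (F_group n\<lparr>carrier := S\<rparr>))"
      using countable_subset[OF subgroup.subset[OF S(1)] countable_F] by simp
    then show "H \<in> iso_classes"
      unfolding S(2) by (rule iso_class_representative[OF group.subgroup_imp_group[OF group_F S(1)]])
  qed
  show "closed_under_subgroups ?C"
    unfolding closed_under_subgroups_def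
  proof (intro ballI allI impI)
    fix G :: "'a monoid" and S assume G: "G \<in> \<Union>?C" and S: "subgroup S G"
    note GD = solvable_subgroup_classesD[OF G]
    have grp: "group (G\<lparr>carrier := S\<rparr>)" by (rule group.subgroup_imp_group[OF GD(1) S])
    have emb: "embeds (G\<lparr>carrier := S\<rparr>) G" by (rule embeds_carrier_subset[OF subgroup.subset[OF S]])
    show "iso_class (G\<lparr>carrier := S\<rparr>) \<in> ?C"
      by (rule solvable_subgroup_classesI[OF grp solvable_embeds[OF grp GD(1) emb GD(2)] embeds_trans[OF emb GD(3)]])
  qed
  show "closed_under_wreath_Z ?C"
    unfolding closed_under_wreath_Z_def
  proof
    fix K :: "'a monoid" assume K: "K \<in> \<Union>?C"
    note KD = solvable_subgroup_classesD[OF K]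
    show "iso_class (wreath_Z K) \<in> ?C"
      by (rule solvable_subgroup_classesI[OF group_wreath_int[OF KD(1)] solvable_wreath_int[OF KD(1,2)]
        embeds_wreath[OF KD(1,3)]])
  qed
  show "closed_under_bounded_sums ?C"
    unfolding closed_under_bounded_sums_def
  proof (intro allI impI)
    fix I :: "nat set" and G :: "nat \<Rightarrow> 'a monoid"
    assume asm: "(\<forall>i\<in>I. G i \<in> \<Union>?C) \<and> (\<exists>d. \<forall>i\<in>I. derived_length (G i) \<le> enat d)"
    then obtain d where d: "\<And>i. i \<in> I \<Longrightarrow> derived_length (G i) \<le> enat d" by blast
    have G: "group (G i)" "embeds (G i) T" if "i \<in> I" for i
      using solvable_subgroup_classesD[of "G i"] asm that by blast+
    have grp: "group (sum_group I G)" by (rule sum_group) (rule G)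
    have "(derived (sum_group I G) ^^ d) (carrier (sum_group I G)) = {\<one>\<^bsub>sum_group I G\<^esub>}"
      by (rule derived_sum_group_trivial) (use G(1) d derived_length_le_iff in blast)+
    then have "solvable (sum_group I G)"
      using group.solvable_iff_trivial_derived_seq[OF grp] by blast
    then show "iso_class (sum_group I G) \<in> ?C"
      by (intro solvable_subgroup_classesI grp embeds_sum G)
  qed
qed

text \<open>Forgetting the condition on breakpoints embeds the Thompson group into the group to which \<open>solvable_PL_mem\<close>
applies.\<close>

lemma solvable_subgroup_mem:
  fixes C :: "'a::infinite monoid set set"
  assumes C: "closed_family C" and S: "subgroup S (F_group n)" "solvable (F_group n\<lparr>carrier := S\<rparr>)"
  shows "iso_class (F_group n\<lparr>carrier := S\<rparr>) \<in> C"
proof -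
  let ?G = "F_group n\<lparr>carrier := S\<rparr>"
  have grp: "group ?G" by (rule group.subgroup_imp_group[OF group_F S(1)])
  have "T\<lparr>carrier := carrier T\<rparr> = T" by simp
  have "embeds ?G T"
    by (rule embeds_trans[OF embeds_carrier_subset[OF subgroup.subset[OF S(1)]] iso_imp_embeds[OF T_iso_F(2)]])
  moreover have "embeds T P"
    by (rule embedsI[of "\<lambda>x. x"]) (use PL_UNIV in \<open>auto simp: hom_def\<close>)
  ultimately have "embeds ?G P" by (rule embeds_trans)
  then obtain h where h: "h \<in> hom ?G P" "inj_on h (carrier ?G)" by (auto simp: embeds_def)
  define L where "L = h ` carrier ?G"
  note im = embeds_iso_image[OF grp P.group_axioms h, folded L_def]
  have iso: "?G \<cong> PL_sub L" using im(2) by (auto simp: is_iso_def)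
  have grpL: "group (PL_sub L)" by (rule P.subgroup_imp_group[OF im(1)])
  have "solvable (PL_sub L)"
    by (rule solvable_embeds[OF grpL grp iso_imp_embeds[OF group.iso_sym[OF grp iso]] S(2)])
  then obtain d where "(derived (PL_sub L) ^^ d) L = {id}"
    using group.solvable_iff_trivial_derived_seq[OF grpL] by auto
  then have "(derived P ^^ d) L = {id}"
    using P.exp_derived_consistent[OF subset_refl im(1)] by simp
  then have "iso_class (PL_sub L) \<in> C"
    by (rule solvable_PL_mem[OF C im(1)])
  then show ?thesis using iso_class_cong[OF grp iso] by metis
qed

end

theorem corollary1p5:
  fixes n :: int and H :: "'a::infinite monoid set"
  assumes "n \<ge> 2" and "H \<in> iso_classes"
  shows "H \<in> class_R \<longleftrightarrow>
    (\<exists>S. subgroup S (F_group n) \<and> solvable (F_group n \<lparr>carrier := S\<rparr>) \<and>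
         H = iso_class (F_group n \<lparr>carrier := S\<rparr>))"
proof -
  interpret thompson n by standard (rule assms(1))
  let ?C = "solvable_subgroup_classes :: 'a monoid set set"
  have C: "closed_family ?C" by (rule closed_family_solvable_subgroup_classes)
  have ne: "?C \<noteq> {}"
  proof -
    have "iso_class (sum_group ({} :: nat set) (\<lambda>_. undefined :: 'a monoid)) \<in> ?C"
      by (rule closed_family.C_sums[OF C, unfolded closed_under_bounded_sums_def, THEN spec, THEN spec, THEN mp]) simp
    then show ?thesis by blast
  qed
  show ?thesis
  proof
    assume "H \<in> class_R"
    then have "H \<in> ?C"
      unfolding class_R_def
      by (rule InterD) (use C ne in \<open>simp add: closed_family_def\<close>)
    then show "\<exists>S. subgroup S (F_group n) \<and> solvable (F_group n \<lparr>carrier := S\<rparr>) \<and>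
         H = iso_class (F_group n \<lparr>carrier := S\<rparr>)"
      by (simp add: solvable_subgroup_classes_def)
  next
    assume "\<exists>S. subgroup S (F_group n) \<and> solvable (F_group n \<lparr>carrier := S\<rparr>) \<and>
         H = iso_class (F_group n \<lparr>carrier := S\<rparr>)"
    then obtain S where S: "subgroup S (F_group n)" "solvable (F_group n \<lparr>carrier := S\<rparr>)"
      and H: "H = iso_class (F_group n \<lparr>carrier := S\<rparr>)" by blast
    show "H \<in> class_R"
      unfolding class_R_def
    proof (rule InterI)
      fix C :: "'a monoid set set"
      assume "C \<in> {C. C \<subseteq> iso_classes \<and> C \<noteq> {} \<and> closed_under_subgroups C \<and>
                  closed_under_wreath_Z C \<and> closed_under_bounded_sums C}"
      then have "closed_family C" by (simp add: closed_family_def)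
      then show "H \<in> C" unfolding H by (rule solvable_subgroup_mem[OF _ S])
    qed
  qed
qed

end
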